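(* Let $\alpha\in(0,1)$ and let $X$ be a spectrally positive stable process of index $1+\alpha\in(1,2)$ with Laplace exponent $\psi(\eta)=\eta^{1+\alpha}$. Let $$m_h^\circ(y,T)=\#\{0\le t\le T: X_{t-}+h\le y\le X_t-h\},\qquad h>0,\ y\in\mathbb{R},\ T\ge 0,$$ and let $c^\circ=2^\alpha\Gamma(1-\alpha)$. Then almost surely, for all $T>0$, $$\lim_{h\downarrow 0}\ \sup_{0\le t\le T}\ \sup_{y\in\mathbb{R}}\left|c^\circ h^{\alpha}m_h^\circ(y,t)-\ell^y(t)\right|=0.$$
   Context: $X=(X_t,t\ge 0)$ is a Lévy process with $X_0=0$, no negative jumps, and $\mathbb{E}(e^{-\eta X_t})=e^{t\psi(\eta)}$, $\eta\ge 0$. $(\ell^y(t),y\in\mathbb{R},t\ge0)$ are the jointly continuous local times of $X$, normalised by the occupation density formula $\int_0^Tf(X_t)\,dt=\int_{-\infty}^\infty f(y)\ell^y(T)\,dy$ a.s. for all bounded measurable $f:\mathbb{R}\to\mathbb{R}$ and $T\ge0$. *)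

theory Defs
  imports "HOL-Probability.Probability"
begin

text \<open>
  Processes are indexed by \<^typ>\<open>real\<close>; only the values at times \<open>t \<ge> 0\<close> are ever constrained
  or used.
\<close>

definition cadlag :: "(real \<Rightarrow> real) \<Rightarrow> bool" where
  "cadlag x \<longleftrightarrow>
     (\<forall>t\<ge>0. (x \<longlongrightarrow> x t) (at_right t)) \<and>
     (\<forall>t>0. \<exists>l. (x \<longlongrightarrow> l) (at_left t))"

text \<open>
  The left limit \<open>x\<^sub>t\<^sub>-\<close>, with the usual convention that there is no jump at time 0.
\<close>

definition left_limit :: "(real \<Rightarrow> real) \<Rightarrow> real \<Rightarrow> real" where
  "left_limit x t = (if t = 0 then x 0 else Lim (at_left t) x)"

locale levy_process = prob_space M for M :: "'a measure" +
  fixes X :: "real \<Rightarrow> 'a \<Rightarrow> real"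
  assumes measurable_X: "\<And>t. t \<ge> 0 \<Longrightarrow> X t \<in> borel_measurable M"
    and start_0: "AE \<omega> in M. X 0 \<omega> = 0"
    and indep_increments:
      "\<And>(n::nat) s. 0 \<le> s 0 \<Longrightarrow> mono s \<Longrightarrow>
         indep_vars (\<lambda>_. borel) (\<lambda>i \<omega>. X (s (Suc i)) \<omega> - X (s i) \<omega>) {..<n}"
    and stationary_increments:
      "\<And>s t. s \<ge> 0 \<Longrightarrow> t \<ge> 0 \<Longrightarrow>
         distr M borel (\<lambda>\<omega>. X (s + t) \<omega> - X s \<omega>) = distr M borel (X t)"
    and cadlag_paths: "AE \<omega> in M. cadlag (\<lambda>t. X t \<omega>)"

locale spectrally_positive_levy_process = levy_process +
  assumes no_negative_jumps:
    "AE \<omega> in M. \<forall>t>0. left_limit (\<lambda>s. X s \<omega>) t \<le> X t \<omega>"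

text \<open>
  Stability of index \<open>\<beta>\<close> is the scaling property: for every \<open>c > 0\<close> the processes
  \<open>(X\<^bsub>ct\<^esub>)\<close> and \<open>(c\<^bsup>1/\<beta>\<^esup> X\<^sub>t)\<close> have the same finite-dimensional distributions.
\<close>

locale spectrally_positive_stable_process = spectrally_positive_levy_process +
  fixes \<beta> :: real
  assumes scaling:
    "\<And>c J. c > 0 \<Longrightarrow> finite J \<Longrightarrow> J \<subseteq> {0..} \<Longrightarrow>
       distr M (PiM J (\<lambda>_. borel)) (\<lambda>\<omega>. \<lambda>t\<in>J. X (c * t) \<omega>) =
       distr M (PiM J (\<lambda>_. borel)) (\<lambda>\<omega>. \<lambda>t\<in>J. c powr (1 / \<beta>) * X t \<omega>)"

text \<open>
  The right-hand side is positive, whereas the Bochner integral of a non-integrable function is 0,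
  so the equation includes the integrability of \<open>exp (- \<eta> X\<^sub>t)\<close>.
\<close>

definition has_laplace_exponent ::
    "'a measure \<Rightarrow> (real \<Rightarrow> 'a \<Rightarrow> real) \<Rightarrow> (real \<Rightarrow> real) \<Rightarrow> bool" where
  "has_laplace_exponent M X \<psi> \<longleftrightarrow>
     (\<forall>t\<ge>0. \<forall>\<eta>\<ge>0. (\<integral>\<omega>. exp (- \<eta> * X t \<omega>) \<partial>M) = exp (t * \<psi> \<eta>))"

text \<open>
  \<open>L y t \<omega>\<close> is the local time at level \<open>y\<close> up to time \<open>t\<close>. For \<open>T > 0\<close>, taking \<open>f = 1\<close> in the
  occupation density formula shows that \<open>y \<mapsto> L y T \<omega>\<close> is integrable.
\<close>

definition jointly_continuous_local_times ::
    "'a measure \<Rightarrow> (real \<Rightarrow> 'a \<Rightarrow> real) \<Rightarrow> (real \<Rightarrow> real \<Rightarrow> 'a \<Rightarrow> real) \<Rightarrow> bool" where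
  "jointly_continuous_local_times M X L \<longleftrightarrow>
     (\<forall>y. \<forall>t\<ge>0. L y t \<in> borel_measurable M) \<and>
     (AE \<omega> in M. continuous_on (UNIV \<times> {0..}) (\<lambda>(y, t). L y t \<omega>)) \<and>
     (AE \<omega> in M. \<forall>f :: real \<Rightarrow> real. f \<in> borel_measurable borel \<longrightarrow> bounded (range f) \<longrightarrow>
        (\<forall>T\<ge>0. (LINT t:{0..T}|lborel. f (X t \<omega>)) = (LINT y|lborel. f y * L y T \<omega>)))"

text \<open>
  For \<open>h > 0\<close> the set below is finite whenever \<open>x\<close> is cadlag, since it consists of jump times of
  size at least \<open>2 h\<close>.
\<close>

definition jump_count :: "(real \<Rightarrow> real) \<Rightarrow> real \<Rightarrow> real \<Rightarrow> real \<Rightarrow> nat" where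
  "jump_count x h y T = card {t. 0 \<le> t \<and> t \<le> T \<and> left_limit x t + h \<le> y \<and> y \<le> x t - h}"

end

theory Submission
  imports Defs "HOL-Real_Asymp.Real_Asymp"
begin

text \<open>
  A jump of the path that counts for \<open>m h y t = jump_count x h y t\<close> starts at some \<open>z \<le> y - h\<close> and
  has size at least \<open>y + h - z\<close>. The Levy measure of \<open>X\<close> has the tail
  \<open>\<alpha> / Gamma (1 - \<alpha>) * u powr (- 1 - \<alpha>)\<close>, so the predictable intensity of these jumps, integrated over
  time, is \<open>A h y t = \<integral> \<alpha> / Gamma (1 - \<alpha>) * u powr (- 1 - \<alpha>) * L (y + h - u) t du\<close> over \<open>u \<ge> 2 h\<close>,
  by the occupation density formula. Multiplied by \<open>2 powr \<alpha> * Gamma (1 - \<alpha>) * h powr \<alpha>\<close> the kernel is a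
  probability density that concentrates at \<open>0\<close>, and since the local time is continuous and
  vanishes outside the range of the path, the normalised \<open>A h y t\<close> tends to \<open>L y t\<close> uniformly
  (\<open>normalised_compensator_uniform_limit\<close>).

  It remains to see that \<open>m - A\<close> is of smaller order than \<open>h powr (- \<alpha>)\<close>, uniformly. For fixed
  \<open>y\<close> and \<open>t\<close> this is a large deviation estimate for a counting process and its compensator: the
  expectation of \<open>exp (\<theta> m - (exp \<theta> - 1) A)\<close> is at most \<open>1\<close> for both signs of \<open>\<theta>\<close>. The probability that
  the exponent exceeds \<open>h powr (- \<alpha> / 2)\<close> is then smaller than every power of \<open>h\<close>, so that the
  Borel-Cantelli lemma covers a polynomial grid of levels and times simultaneously
  (\<open>AE_eventually_grid_estimate\<close>). Between grid points the counts are controlled by monotonicity, because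
  a shift of the level can be absorbed into \<open>h\<close> (\<open>pathwise_uniform_limit\<close>).

  The exponential inequality (\<open>deviation_bound\<close>) is a limit of inequalities for random walks. Along a time grid
  the increments are independent, and the crossings of the level, compensated step by step, satisfy the
  inequality one step after the other (\<open>exp_crossing_exponent_le_1\<close>). As the
  mesh tends to \<open>0\<close>, the crossings of the walk turn into jumps of the cadlag path, and the
  one-step probabilities, divided by the mesh, tend to the tail of the Levy measure. By scaling, the latter is the
  tail asymptotics of the law of \<open>X 1\<close>, which follows from the Laplace transform by Karamata's argument with polynomial test
  functions (\<open>tail_asymptotics\<close>). Fatou's lemma then gives the limiting inequality.
\<close>

section \<open>Laplace transforms of the stable jump density\<close>

lemma nn_integral_gamma_kernel:
  fixes \<alpha> c :: real
  assumes "\<alpha> < 1" "0 < c"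
  shows "(\<integral>\<^sup>+z\<in>{0<..}. ennreal (z powr (-\<alpha>) * exp (- c * z)) \<partial>lborel)
    = ennreal (Gamma (1 - \<alpha>) * c powr (\<alpha> - 1))"
proof -
  let ?f = "\<lambda>z::real. ennreal (z powr (-\<alpha>) * exp (- c * z)) * indicator {0<..} z"
  have "((\<lambda>t. t powr (-\<alpha>) / exp t) has_integral Gamma (1-\<alpha>)) {0..}"
    using Gamma_integral_real[of "1-\<alpha>"] assms by simp
  from nn_integral_has_integral_lebesgue[OF _ this]
  have G: "(\<integral>\<^sup>+t. ennreal (indicator {0..} t * (t powr (-\<alpha>) / exp t)) \<partial>lborel) = ennreal (Gamma (1-\<alpha>))"
    by simp
  have "(\<integral>\<^sup>+z. ?f z \<partial>lborel) = ennreal \<bar>1/c\<bar> * (\<integral>\<^sup>+x. ?f (0 + (1/c) * x) \<partial>lborel)"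
    by (rule nn_integral_real_affine) (use assms in auto)
  also have "(\<lambda>x. ?f (0 + (1/c) * x)) =
     (\<lambda>x. ennreal (c powr \<alpha>) * ennreal (indicator {0..} x * (x powr (-\<alpha>) / exp x)))"
    using assms by (auto simp: fun_eq_iff indicator_def zero_less_divide_iff powr_divide powr_minus
        ennreal_mult'[symmetric] exp_minus field_simps)
  also have "(\<integral>\<^sup>+x. ennreal (c powr \<alpha>) * ennreal (indicator {0..} x * (x powr (-\<alpha>) / exp x)) \<partial>lborel)
     = ennreal (c powr \<alpha>) * ennreal (Gamma (1-\<alpha>))"
    by (subst nn_integral_cmult) (simp_all only: G, simp)
  also have "ennreal \<bar>1/c\<bar> * (ennreal (c powr \<alpha>) * ennreal (Gamma (1-\<alpha>))) =
      ennreal (Gamma (1 - \<alpha>) * c powr (\<alpha> - 1))"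
    using assms Gamma_real_pos[of "1-\<alpha>"]
    by (simp add: ennreal_mult'[symmetric] powr_diff field_simps)
  finally show ?thesis .
qed

text \<open>
  Since \<open>(1 - exp (- z)) / z\<close> is the average of \<open>exp (- a z)\<close> over \<open>0 \<le> a \<le> 1\<close>, such a factor
  averages a Laplace transform over a unit interval.
\<close>

lemma nn_integral_difference_kernel:
  fixes f :: "real \<Rightarrow> real"
  assumes [measurable]: "f \<in> borel_measurable borel" and f: "\<And>z. 0 < z \<Longrightarrow> 0 \<le> f z"
  shows "(\<integral>\<^sup>+z\<in>{0<..}. ennreal (f z * ((1 - exp (-z)) / z) * exp (- c * z)) \<partial>lborel)
    = (\<integral>\<^sup>+a\<in>{0..1}. (\<integral>\<^sup>+z\<in>{0<..}. ennreal (f z * exp (- (c + a) * z)) \<partial>lborel) \<partial>lborel)"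
proof -
  have E: "(\<integral>\<^sup>+a\<in>{0..1}. ennreal (exp (- a * z)) \<partial>lborel) = ennreal ((1 - exp (-z)) / z)"
    if "0 < z" for z :: real
  proof -
    have "(\<integral>\<^sup>+a\<in>{0..1}. ennreal (exp (- a * z)) \<partial>lborel)
        = ennreal ((- exp (- 1 * z) / z) - (- exp (- 0 * z) / z))"
      by (rule nn_integral_FTC_Icc)
        (use that in \<open>auto intro!: derivative_eq_intros simp: field_simps\<close>)
    then show ?thesis by (simp add: diff_divide_distrib)
  qed
  have "(\<integral>\<^sup>+a\<in>{0..1}. (\<integral>\<^sup>+z\<in>{0<..}. ennreal (f z * exp (- (c + a) * z)) \<partial>lborel) \<partial>lborel)
     = (\<integral>\<^sup>+a. (\<integral>\<^sup>+z. indicator {0..1::real} a * (ennreal (f z * exp (- (c + a) * z)) * indicator {0<..} z) \<partial>lborel) \<partial>lborel)"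
    by (intro nn_integral_cong) (auto simp: indicator_def)
  also have "\<dots> = (\<integral>\<^sup>+z. (\<integral>\<^sup>+a. indicator {0..1::real} a * (ennreal (f z * exp (- (c + a) * z)) * indicator {0<..} z) \<partial>lborel) \<partial>lborel)"
    by (rule lborel_pair.Fubini') simp
  also have "\<dots> = (\<integral>\<^sup>+z\<in>{0<..}. ennreal (f z * ((1 - exp (-z)) / z) * exp (- c * z)) \<partial>lborel)"
  proof (intro nn_integral_cong)
    fix z :: real
    show "(\<integral>\<^sup>+a. indicator {0..1::real} a * (ennreal (f z * exp (- (c + a) * z)) * indicator {0<..} z) \<partial>lborel)
      = ennreal (f z * ((1 - exp (-z)) / z) * exp (- c * z)) * indicator {0<..} z"
    proof (cases "0 < z")
      case True
      have "(\<integral>\<^sup>+a. indicator {0..1::real} a * (ennreal (f z * exp (- (c + a) * z)) * indicator {0<..} z) \<partial>lborel)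
        = (\<integral>\<^sup>+a. ennreal (f z * exp (- c * z)) * (ennreal (exp (- a * z)) * indicator {0..1} a) \<partial>lborel)"
        using f[OF True] True
        by (intro nn_integral_cong)
          (auto simp: indicator_def ennreal_mult'[symmetric] exp_add[symmetric] algebra_simps)
      also have "\<dots> = ennreal (f z * exp (- c * z)) * ennreal ((1 - exp (-z)) / z)"
        by (subst nn_integral_cmult) (simp_all only: E[OF True], simp)
      finally show ?thesis using f[OF True] True
        by (simp add: ennreal_mult'[symmetric] algebra_simps)
    qed simp
  qed
  finally show ?thesis by simp
qed

lemma nn_integral_shifted_powr:
  fixes c p k :: real
  assumes "0 \<le> c" "0 < p" "0 \<le> k"
  shows "(\<integral>\<^sup>+a\<in>{0..1}. ennreal (k * (c + a) powr (p - 1)) \<partial>lborel)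
    = ennreal (k * ((c + 1) powr p - c powr p) / p)"
proof -
  have "((\<lambda>a. k * (c + a) powr (p - 1)) has_integral
      (k * (c + 1) powr p / p - k * (c + 0) powr p / p)) {0..1}"
  proof (rule fundamental_theorem_of_calculus_interior)
    show "continuous_on {0..1} (\<lambda>a. k * (c + a) powr p / p)"
      using assms by (intro continuous_on_mult continuous_on_divide continuous_on_powr' continuous_intros) auto
    fix x :: real assume "x \<in> {0<..<1}"
    then have "((\<lambda>a. (c + a) powr p) has_real_derivative p * (c + x) powr (p - 1) * 1) (at x)"
      using assms by (intro DERIV_chain2[OF has_real_derivative_powr]) (auto intro!: derivative_eq_intros)
    then have "((\<lambda>a. k * (c + a) powr p / p) has_real_derivative
        k * (p * (c + x) powr (p - 1) * 1) / p) (at x)"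
      by (intro DERIV_cdivide DERIV_cmult)
    then have "((\<lambda>a. k * (c + a) powr p / p) has_real_derivative k * (c + x) powr (p - 1)) (at x)"
      using assms by simp
    then show "((\<lambda>a. k * (c + a) powr p / p) has_vector_derivative k * (c + x) powr (p - 1)) (at x)"
      by (simp add: has_real_derivative_iff_has_vector_derivative)
  qed simp
  from nn_integral_has_integral_lebesgue[OF _ this] assms
  have "(\<integral>\<^sup>+a. ennreal (indicator {0..1} a * (k * (c + a) powr (p - 1))) \<partial>lborel)
    = ennreal (k * ((c + 1) powr p - c powr p) / p)"
    by (simp add: diff_divide_distrib right_diff_distrib)
  also have "(\<integral>\<^sup>+a. ennreal (indicator {0..1} a * (k * (c + a) powr (p - 1))) \<partial>lborel)
    = (\<integral>\<^sup>+a\<in>{0..1}. ennreal (k * (c + a) powr (p - 1)) \<partial>lborel)"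
    by (intro nn_integral_cong) (auto simp: indicator_def)
  finally show ?thesis .
qed

text \<open>
  Averaging the Laplace transform of \<open>z powr (- \<alpha>)\<close> twice integrates a power twice, which yields a
  second difference of \<open>c powr (1 + \<alpha>)\<close>. This identifies the Levy density through the Laplace exponent.
\<close>

lemma nn_integral_second_difference_kernel:
  fixes \<alpha> c :: real
  assumes "0 < \<alpha>" "\<alpha> < 1" "0 \<le> c"
  shows "(\<integral>\<^sup>+z\<in>{0<..}. ennreal (exp (- c * z) * (1 - exp (-z))\<^sup>2 * z powr (- (2 + \<alpha>))) \<partial>lborel)
    = ennreal (Gamma (1 - \<alpha>) / (\<alpha> * (1 + \<alpha>)) *
        (c powr (1+\<alpha>) - 2 * (c+1) powr (1+\<alpha>) + (c+2) powr (1+\<alpha>)))"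
proof -
  have G: "0 < Gamma (1 - \<alpha>)" using assms by (simp add: Gamma_real_pos)
  have I1: "(\<integral>\<^sup>+z\<in>{0<..}. ennreal (z powr (-\<alpha>) * ((1 - exp (-z)) / z) * exp (- c * z)) \<partial>lborel)
    = ennreal (Gamma (1 - \<alpha>) / \<alpha> * ((c+1) powr \<alpha> - c powr \<alpha>))" if "0 \<le> c" for c
  proof -
    have "(\<integral>\<^sup>+z\<in>{0<..}. ennreal (z powr (-\<alpha>) * ((1 - exp (-z)) / z) * exp (- c * z)) \<partial>lborel)
      = (\<integral>\<^sup>+a\<in>{0..1}. (\<integral>\<^sup>+z\<in>{0<..}. ennreal (z powr (-\<alpha>) * exp (- (c + a) * z)) \<partial>lborel) \<partial>lborel)"
      by (rule nn_integral_difference_kernel) auto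
    also have "\<dots> = (\<integral>\<^sup>+a\<in>{0..1}. ennreal (Gamma (1 - \<alpha>) * (c + a) powr (\<alpha> - 1)) \<partial>lborel)"
    proof (rule nn_integral_cong_AE)
      have "AE a in lborel. a \<noteq> (0::real)" by (rule AE_lborel_singleton)
      then show "AE a in lborel. (\<integral>\<^sup>+z\<in>{0<..}. ennreal (z powr (-\<alpha>) * exp (- (c + a) * z)) \<partial>lborel) * indicator {0..1} a
        = ennreal (Gamma (1 - \<alpha>) * (c + a) powr (\<alpha> - 1)) * indicator {0..1} a"
      proof eventually_elim
        case (elim a)
        show ?case
        proof (cases "a \<in> {0..1}")
          case True
          then have "0 < c + a" using that elim by auto
          from nn_integral_gamma_kernel[OF assms(2) this] show ?thesis by simp
        qed simp
      qed
    qed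
    also have "\<dots> = ennreal (Gamma (1 - \<alpha>) * ((c + 1) powr \<alpha> - c powr \<alpha>) / \<alpha>)"
      by (rule nn_integral_shifted_powr) (use that assms G in auto)
    finally show ?thesis by (simp add: field_simps)
  qed
  have "(\<integral>\<^sup>+z\<in>{0<..}. ennreal (exp (- c * z) * (1 - exp (-z))\<^sup>2 * z powr (- (2 + \<alpha>))) \<partial>lborel)
    = (\<integral>\<^sup>+z\<in>{0<..}. ennreal ((z powr (-\<alpha>) * ((1 - exp (-z)) / z)) * ((1 - exp (-z)) / z) * exp (- c * z)) \<partial>lborel)"
  proof (intro nn_integral_cong)
    fix z :: real
    have "z powr (- (2 + \<alpha>)) = z powr (-\<alpha>) / (z * z)" if "0 < z"
      using that powr_diff[of z "-\<alpha>" 2]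
      by (simp add: power2_eq_square algebra_simps)
    then show "ennreal (exp (- c * z) * (1 - exp (-z))\<^sup>2 * z powr (- (2 + \<alpha>))) * indicator {0<..} z
      = ennreal ((z powr (-\<alpha>) * ((1 - exp (-z)) / z)) * ((1 - exp (-z)) / z) * exp (- c * z)) * indicator {0<..} z"
      by (simp add: indicator_def power2_eq_square mult_ac)
  qed
  also have "\<dots> = (\<integral>\<^sup>+a\<in>{0..1}. (\<integral>\<^sup>+z\<in>{0<..}. ennreal ((z powr (-\<alpha>) * ((1 - exp (-z)) / z)) * exp (- (c + a) * z)) \<partial>lborel) \<partial>lborel)"
    by (rule nn_integral_difference_kernel) auto
  also have "\<dots> = (\<integral>\<^sup>+a\<in>{0..1}. ennreal (Gamma (1 - \<alpha>) / \<alpha> * ((c+a+1) powr \<alpha> - (c+a) powr \<alpha>)) \<partial>lborel)"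
    by (intro nn_integral_cong) (use I1[of "c + _"] assms in \<open>auto simp: indicator_def\<close>)
  finally have "(\<integral>\<^sup>+z\<in>{0<..}. ennreal (exp (- c * z) * (1 - exp (-z))\<^sup>2 * z powr (- (2 + \<alpha>))) \<partial>lborel)
    = (\<integral>\<^sup>+a\<in>{0..1}. ennreal (Gamma (1 - \<alpha>) / \<alpha> * ((c+a+1) powr \<alpha> - (c+a) powr \<alpha>)) \<partial>lborel)" .
  \<comment> \<open>The integral of a difference is obtained by adding the subtracted integral on both sides, because
    subtraction of extended nonnegative reals is not linear.\<close>
  moreover have "(\<integral>\<^sup>+a\<in>{0..1}. ennreal (Gamma (1 - \<alpha>) / \<alpha> * ((c+a+1) powr \<alpha> - (c+a) powr \<alpha>)) \<partial>lborel)
     + ennreal (Gamma (1 - \<alpha>) / \<alpha> * ((c + 1) powr (1+\<alpha>) - c powr (1+\<alpha>)) / (1+\<alpha>))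
     = ennreal (Gamma (1 - \<alpha>) / \<alpha> * ((c+1 + 1) powr (1+\<alpha>) - (c+1) powr (1+\<alpha>)) / (1+\<alpha>))"
  proof -
    have "(\<integral>\<^sup>+a\<in>{0..1}. ennreal (Gamma (1 - \<alpha>) / \<alpha> * ((c+a+1) powr \<alpha> - (c+a) powr \<alpha>)) \<partial>lborel) +
       (\<integral>\<^sup>+a\<in>{0..1}. ennreal (Gamma (1 - \<alpha>) / \<alpha> * (c+a) powr (1+\<alpha>-1)) \<partial>lborel)
      = (\<integral>\<^sup>+a\<in>{0..1}. ennreal (Gamma (1 - \<alpha>) / \<alpha> * (c+1+a) powr (1+\<alpha>-1)) \<partial>lborel)"
    proof (subst nn_integral_add[symmetric])
      have "ennreal (Gamma (1 - \<alpha>) / \<alpha> * ((c+a+1) powr \<alpha> - (c+a) powr \<alpha>)) +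
          ennreal (Gamma (1 - \<alpha>) / \<alpha> * (c+a) powr (1+\<alpha>-1))
        = ennreal (Gamma (1 - \<alpha>) / \<alpha> * (c+1+a) powr (1+\<alpha>-1))" if "a \<in> {0..1}" for a
        using G assms that
        by (subst ennreal_plus[symmetric])
          (auto intro!: divide_right_mono mult_left_mono powr_mono2 arg_cong[where f=ennreal] simp: add_ac right_diff_distrib)
      then show "(\<integral>\<^sup>+a. ennreal (Gamma (1 - \<alpha>) / \<alpha> * ((c+a+1) powr \<alpha> - (c+a) powr \<alpha>)) * indicator {0..1} a
          + ennreal (Gamma (1 - \<alpha>) / \<alpha> * (c+a) powr (1+\<alpha>-1)) * indicator {0..1} a \<partial>lborel)
        = (\<integral>\<^sup>+a\<in>{0..1}. ennreal (Gamma (1 - \<alpha>) / \<alpha> * (c+1+a) powr (1+\<alpha>-1)) \<partial>lborel)"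
        by (intro nn_integral_cong) (auto simp: indicator_def)
    qed auto
    then show ?thesis
      using nn_integral_shifted_powr[of c "1+\<alpha>" "Gamma (1 - \<alpha>) / \<alpha>"]
        nn_integral_shifted_powr[of "c+1" "1+\<alpha>" "Gamma (1 - \<alpha>) / \<alpha>"] assms G by simp
  qed
  ultimately have "(\<integral>\<^sup>+z\<in>{0<..}. ennreal (exp (- c * z) * (1 - exp (-z))\<^sup>2 * z powr (- (2 + \<alpha>))) \<partial>lborel)
     + ennreal (Gamma (1 - \<alpha>) / \<alpha> * ((c + 1) powr (1+\<alpha>) - c powr (1+\<alpha>)) / (1+\<alpha>))
     = ennreal (Gamma (1 - \<alpha>) / \<alpha> * ((c+1 + 1) powr (1+\<alpha>) - (c+1) powr (1+\<alpha>)) / (1+\<alpha>))"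
    by simp
  moreover have "a = ennreal (v - u)" if "a + ennreal u = ennreal v" "0 \<le> u" for a u v
    using that by (metis ennreal_minus ennreal_add_diff_cancel_right ennreal_neq_top)
  ultimately have "(\<integral>\<^sup>+z\<in>{0<..}. ennreal (exp (- c * z) * (1 - exp (-z))\<^sup>2 * z powr (- (2 + \<alpha>))) \<partial>lborel)
    = ennreal (Gamma (1 - \<alpha>) / \<alpha> * ((c+1 + 1) powr (1+\<alpha>) - (c+1) powr (1+\<alpha>)) / (1+\<alpha>)
       - Gamma (1 - \<alpha>) / \<alpha> * ((c + 1) powr (1+\<alpha>) - c powr (1+\<alpha>)) / (1+\<alpha>))"
    using assms G by (simp add: powr_mono2)
  also have "Gamma (1 - \<alpha>) / \<alpha> * ((c+1 + 1) powr (1+\<alpha>) - (c+1) powr (1+\<alpha>)) / (1+\<alpha>)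
       - Gamma (1 - \<alpha>) / \<alpha> * ((c + 1) powr (1+\<alpha>) - c powr (1+\<alpha>)) / (1+\<alpha>)
     = Gamma (1 - \<alpha>) / (\<alpha> * (1 + \<alpha>)) *
        (c powr (1+\<alpha>) - 2 * (c+1) powr (1+\<alpha>) + (c+2) powr (1+\<alpha>))"
    using assms by (simp add: divide_simps) (simp add: algebra_simps)
  finally show ?thesis .
qed

section \<open>Tail asymptotics from the Laplace transform\<close>

lemma has_bochner_integral_powr_tail:
  fixes c \<beta> :: real
  assumes "0 < c" "0 < \<beta>"
  shows "has_bochner_integral lborel (\<lambda>z. indicator {c..} z * z powr (- 1 - \<beta>)) (c powr (-\<beta>) / \<beta>)"
proof (rule has_bochner_integral_nn_integral)
  have "((\<lambda>z. z powr (- 1 - \<beta>)) has_integral - (c powr (- 1 - \<beta> + 1)) / (- 1 - \<beta> + 1)) {c..}"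
    by (rule has_integral_powr_to_inf) (use assms in auto)
  from nn_integral_has_integral_lebesgue[OF _ this]
  show "(\<integral>\<^sup>+z. ennreal (indicator {c..} z * z powr (- 1 - \<beta>)) \<partial>lborel) = ennreal (c powr (-\<beta>) / \<beta>)"
    using assms by simp
qed (use assms in auto)

lemma integrable_weighted:
  fixes f v q :: "_ \<Rightarrow> real"
  assumes q: "integrable R q" and v[measurable]: "v \<in> borel_measurable R"
    and v_range: "\<And>x. q x \<noteq> 0 \<Longrightarrow> v x \<in> {0..1}"
    and f_cont: "continuous_on {0..1} f" and f[measurable]: "f \<in> borel_measurable borel"
  shows "integrable R (\<lambda>x. f (v x) * q x)"
proof -
  have "bounded (f ` {0..1})"
    using f_cont by (intro compact_imp_bounded compact_continuous_image) auto
  then obtain B where B: "\<And>x. x \<in> {0..1} \<Longrightarrow> \<bar>f x\<bar> \<le> B"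
    unfolding bounded_iff by fastforce
  have [measurable]: "q \<in> borel_measurable R"
    using q by auto
  show ?thesis
  proof (rule Bochner_Integration.integrable_bound)
    show "integrable R (\<lambda>x. B * q x)" using q by simp
    show "AE x in R. norm (f (v x) * q x) \<le> norm (B * q x)"
    proof (rule AE_I2)
      fix x
      show "norm (f (v x) * q x) \<le> norm (B * q x)"
      proof (cases "q x = 0")
        case False
        then have "\<bar>f (v x)\<bar> \<le> \<bar>B\<bar>" using v_range B by fastforce
        then show ?thesis by (simp add: abs_mult mult_right_mono)
      qed simp
    qed
  qed simp
qed

lemma weighted_integral_uniform_close:
  fixes g p v q :: "_ \<Rightarrow> real"
  assumes q: "integrable R q" "v \<in> borel_measurable R" "\<And>x. q x \<noteq> 0 \<Longrightarrow> v x \<in> {0..1}"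
    and q_pos: "\<And>x. 0 \<le> q x"
    and g: "continuous_on {0..1} g" "g \<in> borel_measurable borel"
    and p: "continuous_on {0..1} p" "p \<in> borel_measurable borel"
    and close: "\<And>x. x \<in> {0..1} \<Longrightarrow> \<bar>g x - p x\<bar> < \<delta>"
  shows "\<bar>(\<integral>x. g (v x) * q x \<partial>R) - (\<integral>x. p (v x) * q x \<partial>R)\<bar> \<le> \<delta> * (\<integral>x. q x \<partial>R)"
proof -
  note I = integrable_weighted[OF q g] integrable_weighted[OF q p]
  have "\<bar>(\<integral>x. g (v x) * q x \<partial>R) - (\<integral>x. p (v x) * q x \<partial>R)\<bar>
    = \<bar>\<integral>x. g (v x) * q x - p (v x) * q x \<partial>R\<bar>"
    using I by simp
  also have "\<dots> \<le> (\<integral>x. \<bar>g (v x) * q x - p (v x) * q x\<bar> \<partial>R)" by (rule integral_abs_bound)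
  also have "\<dots> \<le> (\<integral>x. \<delta> * q x \<partial>R)"
  proof (rule integral_mono)
    fix x
    show "\<bar>g (v x) * q x - p (v x) * q x\<bar> \<le> \<delta> * q x"
    proof (cases "q x = 0")
      case False
      then have "\<bar>g (v x) - p (v x)\<bar> \<le> \<delta>" using close[OF q(3)] by (simp add: less_imp_le)
      then have "\<bar>g (v x) - p (v x)\<bar> * q x \<le> \<delta> * q x" using q_pos by (rule mult_right_mono)
      then show ?thesis using q_pos[of x] by (simp add: abs_mult left_diff_distrib[symmetric])
    qed simp
  qed (use I q in auto)
  also have "\<dots> = \<delta> * (\<integral>x. q x \<partial>R)" by simp
  finally show ?thesis .
qed

text \<open>
  On \<open>[0, 1]\<close> polynomials are uniformly dense in the continuous functions, and the total masses
  converge (moment \<open>0\<close>), so convergence of the moments of positive weights carries over to all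
  continuous test functions.
\<close>

lemma weighted_moments_tendsto_imp_continuous:
  fixes u :: "'i \<Rightarrow> 'b \<Rightarrow> real" and w :: "'i \<Rightarrow> 'b \<Rightarrow> real" and v q :: "'c \<Rightarrow> real" and g :: "real \<Rightarrow> real"
  assumes u: "\<And>e. u e \<in> borel_measurable N" and v: "v \<in> borel_measurable Q"
    and w: "\<forall>\<^sub>F e in F. integrable N (w e)" and q: "integrable Q q"
    and w_pos: "\<And>e x. 0 \<le> w e x" and q_pos: "\<And>z. 0 \<le> q z"
    and u_range: "\<forall>\<^sub>F e in F. \<forall>x. w e x \<noteq> 0 \<longrightarrow> u e x \<in> {0..1}"
    and v_range: "\<And>z. q z \<noteq> 0 \<Longrightarrow> v z \<in> {0..1}"
    and moments: "\<And>k::nat. ((\<lambda>e. \<integral>x. u e x ^ k * w e x \<partial>N) \<longlongrightarrow> (\<integral>z. v z ^ k * q z \<partial>Q)) F"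
    and g: "continuous_on {0..1} g" "g \<in> borel_measurable borel"
  shows "((\<lambda>e. \<integral>x. g (u e x) * w e x \<partial>N) \<longlongrightarrow> (\<integral>z. g (v z) * q z \<partial>Q)) F"
proof (rule tendstoI)
  fix \<epsilon> :: real assume "0 < \<epsilon>"
  define m where "m = (\<integral>z. q z \<partial>Q)"
  have "0 \<le> m" unfolding m_def using q_pos by simp
  define \<delta> where "\<delta> = \<epsilon> / (2 * m + 3)"
  have "0 < \<delta>" unfolding \<delta>_def using \<open>0 < \<epsilon>\<close> \<open>0 \<le> m\<close> by simp
  obtain p where p: "real_polynomial_function p" "\<And>x. x \<in> {0..1} \<Longrightarrow> \<bar>g x - p x\<bar> < \<delta>"
    using Stone_Weierstrass_real_polynomial_function[OF _ g(1) \<open>0 < \<delta>\<close>] by auto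
  then obtain a n where pa: "p = (\<lambda>x. \<Sum>i\<le>n. a i * x ^ i)"
    by (auto simp: real_polynomial_function_iff_sum)
  have p_reg: "continuous_on {0..1} p" "p \<in> borel_measurable borel"
    unfolding pa by (auto intro!: continuous_intros)
  have limit_sum: "(\<integral>z. p (v z) * q z \<partial>Q) = (\<Sum>i\<le>n. a i * (\<integral>z. v z ^ i * q z \<partial>Q))"
  proof -
    have "integrable Q (\<lambda>x. v x ^ i * q x)" for i :: nat
      by (rule integrable_weighted[OF q v v_range]) (auto intro: continuous_intros)
    then show ?thesis unfolding pa by (simp add: sum_distrib_right mult.assoc)
  qed
  have sum: "\<forall>\<^sub>F e in F. (\<integral>x. p (u e x) * w e x \<partial>N) = (\<Sum>i\<le>n. a i * (\<integral>x. u e x ^ i * w e x \<partial>N))"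
    using w u_range
  proof eventually_elim
    case (elim e)
    have "integrable N (\<lambda>x. u e x ^ i * w e x)" for i :: nat
      by (rule integrable_weighted[OF elim(1) u]) (use elim(2) in \<open>auto intro: continuous_intros\<close>)
    then show ?case unfolding pa by (simp add: sum_distrib_right mult.assoc)
  qed
  have "((\<lambda>e. \<Sum>i\<le>n. a i * (\<integral>x. u e x ^ i * w e x \<partial>N)) \<longlongrightarrow> (\<integral>z. p (v z) * q z \<partial>Q)) F"
    unfolding limit_sum by (intro tendsto_intros moments)
  then have "\<forall>\<^sub>F e in F. dist (\<Sum>i\<le>n. a i * (\<integral>x. u e x ^ i * w e x \<partial>N)) (\<integral>z. p (v z) * q z \<partial>Q) < \<delta>"
    using \<open>0 < \<delta>\<close> by (rule tendstoD)
  moreover have "((\<lambda>e. \<integral>x. w e x \<partial>N) \<longlongrightarrow> m) F"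
    using moments[of 0] by (simp add: m_def)
  then have "\<forall>\<^sub>F e in F. (\<integral>x. w e x \<partial>N) < m + 1"
    by (rule order_tendstoD) simp
  ultimately show "\<forall>\<^sub>F e in F. dist (\<integral>x. g (u e x) * w e x \<partial>N) (\<integral>z. g (v z) * q z \<partial>Q) < \<epsilon>"
    using w u_range sum
  proof eventually_elim
    case (elim e)
    have "\<bar>(\<integral>x. g (u e x) * w e x \<partial>N) - (\<integral>x. p (u e x) * w e x \<partial>N)\<bar> \<le> \<delta> * (\<integral>x. w e x \<partial>N)"
      using elim(4) by (intro weighted_integral_uniform_close elim(3) u w_pos g p_reg p(2)) auto
    also have "\<dots> \<le> \<delta> * (m + 1)" using elim(2) \<open>0 < \<delta>\<close> by simp
    finally have 1: "\<bar>(\<integral>x. g (u e x) * w e x \<partial>N) - (\<integral>x. p (u e x) * w e x \<partial>N)\<bar> \<le> \<delta> * (m + 1)" .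
    have 2: "\<bar>(\<integral>z. g (v z) * q z \<partial>Q) - (\<integral>z. p (v z) * q z \<partial>Q)\<bar> \<le> \<delta> * m"
      unfolding m_def by (intro weighted_integral_uniform_close v q q_pos v_range g p_reg p(2))
    have "\<delta> * (m + 1) + \<delta> * m + \<delta> < \<delta> * (2 * m + 3)" using \<open>0 < \<delta>\<close> by (simp add: algebra_simps)
    also have "\<dots> = \<epsilon>" unfolding \<delta>_def using \<open>0 \<le> m\<close> by simp
    finally show ?case using 1 2 elim(1) elim(5) by (simp add: dist_real_def)
  qed
qed

text \<open>
  The law of the process at time \<open>1\<close>. Its left tail has all exponential moments, its right tail is heavy.
\<close>

locale stable_law = prob_space N for N :: "real measure" +
  fixes \<alpha> :: real
  assumes alpha: "0 < \<alpha>" "\<alpha> < 1"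
    and sets_N[measurable_cong]: "sets N = sets borel"
    and laplace: "\<And>\<eta>. 0 \<le> \<eta> \<Longrightarrow> (\<integral>x. exp (- \<eta> * x) \<partial>N) = exp (\<eta> powr (1 + \<alpha>))"
begin

lemma integrable_exp: "0 \<le> \<eta> \<Longrightarrow> integrable N (\<lambda>x. exp (- \<eta> * x))"
  by (rule ccontr) (use laplace[of \<eta>] in \<open>simp add: not_integrable_integral_eq\<close>)

abbreviation second_difference :: "real \<Rightarrow> real" where
  "second_difference c \<equiv> c powr (1+\<alpha>) - 2 * (c+1) powr (1+\<alpha>) + (c+2) powr (1+\<alpha>)"

lemma second_difference_expand:
  "exp (- (k * e) * x) * (1 - exp (- e * x))\<^sup>2 =
    exp (- (k * e) * x) - 2 * exp (- ((k + 1) * e) * x) + exp (- ((k + 2) * e) * x)"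
  for k e x :: real
  by (simp add: power2_eq_square algebra_simps exp_add[symmetric])

lemma integrable_second_difference:
  assumes "0 \<le> k" "0 \<le> e"
  shows "integrable N (\<lambda>x. exp (- (k * e) * x) * (1 - exp (- e * x))\<^sup>2)"
  unfolding second_difference_expand
  using assms by (intro Bochner_Integration.integrable_add Bochner_Integration.integrable_diff integrable_mult_right integrable_exp) auto

text \<open>
  The second difference removes the constant and linear terms of the Laplace transform at \<open>0\<close>, and
  leaves the term of order \<open>e powr (1 + \<alpha>)\<close> as the leading one.
\<close>

lemma second_difference_moment_tendsto:
  assumes "0 \<le> k"
  shows "((\<lambda>e. e powr (-(1+\<alpha>)) * (\<integral>x. exp (- (k * e) * x) * (1 - exp (- e * x))\<^sup>2 \<partial>N))
    \<longlongrightarrow> second_difference k) (at_right 0)"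
proof -
  have L: "((\<lambda>e. e powr (-(1+\<alpha>)) * (exp ((c * e) powr (1+\<alpha>)) - 1)) \<longlongrightarrow> c powr (1+\<alpha>)) (at_right 0)"
    if "0 \<le> c" for c :: real
  proof -
    define K where "K = c powr (1+\<alpha>)"
    have "((\<lambda>e. e powr (-(1+\<alpha>)) * (exp (K * e powr (1+\<alpha>)) - 1)) \<longlongrightarrow> K) (at_right 0)"
    proof (cases "K = 0")
      case False
      then have "0 < K" by (simp add: K_def)
      then show ?thesis using alpha by real_asymp
    qed simp
    then show ?thesis unfolding K_def[symmetric]
    proof (rule Lim_transform_eventually)
      show "\<forall>\<^sub>F e in at_right 0. e powr (-(1+\<alpha>)) * (exp (K * e powr (1+\<alpha>)) - 1) =
          e powr (-(1+\<alpha>)) * (exp ((c * e) powr (1+\<alpha>)) - 1)"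
        using eventually_at_right_less[of 0]
        by eventually_elim (use that in \<open>simp add: K_def powr_mult\<close>)
    qed
  qed
  have "((\<lambda>e. e powr (-(1+\<alpha>)) * (exp ((k * e) powr (1+\<alpha>)) - 1)
      - 2 * (e powr (-(1+\<alpha>)) * (exp (((k+1) * e) powr (1+\<alpha>)) - 1))
      + e powr (-(1+\<alpha>)) * (exp (((k+2) * e) powr (1+\<alpha>)) - 1)) \<longlongrightarrow> second_difference k) (at_right 0)"
    using assms by (intro tendsto_intros L) auto
  then show ?thesis
  proof (rule Lim_transform_eventually)
    show "\<forall>\<^sub>F e in at_right 0. e powr (-(1+\<alpha>)) * (exp ((k * e) powr (1+\<alpha>)) - 1)
      - 2 * (e powr (-(1+\<alpha>)) * (exp (((k+1) * e) powr (1+\<alpha>)) - 1))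
      + e powr (-(1+\<alpha>)) * (exp (((k+2) * e) powr (1+\<alpha>)) - 1)
      = e powr (-(1+\<alpha>)) * (\<integral>x. exp (- (k * e) * x) * (1 - exp (- e * x))\<^sup>2 \<partial>N)"
      using eventually_at_right_less[of 0]
    proof eventually_elim
      case (elim e)
      have i: "integrable N (\<lambda>x. exp (- (c * e) * x))" if "0 \<le> c" for c
        using elim that by (intro integrable_exp) simp
      have l: "(\<integral>x. exp (- (c * e) * x) \<partial>N) = exp ((c * e) powr (1+\<alpha>))" if "0 \<le> c" for c
        using elim that by (intro laplace) simp
      have eq: "(\<integral>x. exp (- (k * e) * x) * (1 - exp (- e * x))\<^sup>2 \<partial>N)
        = exp ((k * e) powr (1+\<alpha>)) - 2 * exp (((k+1) * e) powr (1+\<alpha>)) + exp (((k+2) * e) powr (1+\<alpha>))"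
        unfolding second_difference_expand
        using assms i[of k] i[of "k+1"] i[of "k+2"] l[of k] l[of "k+1"] l[of "k+2"]
        by (simp del: mult_minus_left)
      show ?case unfolding eq by (simp add: algebra_simps)
    qed
  qed
qed

text \<open>
  Exponential moments of all orders make the law light on the negative side. There the second
  difference is of order \<open>e\<^sup>2\<close>, which is negligible against \<open>e powr (1 + \<alpha>)\<close>.
\<close>

lemma negative_part_negligible:
  fixes k :: real
  assumes "0 \<le> k"
  shows "((\<lambda>e. e powr (-(1+\<alpha>)) * (\<integral>x. indicator {..<0} x * (exp (- (k * e) * x) * (1 - exp (- e * x))\<^sup>2) \<partial>N))
    \<longlongrightarrow> 0) (at_right 0)"
proof (rule tendsto_sandwich)
  define B where "B = exp ((k + 4) powr (1+\<alpha>))"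
  show "\<forall>\<^sub>F e in at_right 0. 0 \<le> e powr (-(1+\<alpha>)) * (\<integral>x. indicator {..<0} x * (exp (- (k * e) * x) * (1 - exp (- e * x))\<^sup>2) \<partial>N)"
    by simp
  have "\<forall>\<^sub>F e in at_right 0. e \<in> {0<..<1::real}" by (rule eventually_at_right_real) simp
  then show "\<forall>\<^sub>F e in at_right 0. e powr (-(1+\<alpha>)) * (\<integral>x. indicator {..<0} x * (exp (- (k * e) * x) * (1 - exp (- e * x))\<^sup>2) \<partial>N)
     \<le> e powr (-(1+\<alpha>)) * (e\<^sup>2 * B)"
  proof eventually_elim
    case (elim e)
    have "(\<integral>x. indicator {..<0} x * (exp (- (k * e) * x) * (1 - exp (- e * x))\<^sup>2) \<partial>N)
       \<le> (\<integral>x. e\<^sup>2 * exp (- (k + 4) * x) \<partial>N)"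
    proof (rule integral_mono)
      show "integrable N (\<lambda>x. indicator {..<0} x * (exp (- (k * e) * x) * (1 - exp (- e * x))\<^sup>2))"
        using integrable_real_mult_indicator[OF _ integrable_second_difference[of k e], of "{..<0}"] assms elim
        by (simp add: mult.commute)
      show "integrable N (\<lambda>x. e\<^sup>2 * exp (- (k + 4) * x))"
        using assms by (intro integrable_mult_right integrable_exp) auto
      fix x :: real
      show "indicator {..<0} x * (exp (- (k * e) * x) * (1 - exp (- e * x))\<^sup>2) \<le> e\<^sup>2 * exp (- (k + 4) * x)"
      proof (cases "x < 0")
        case True
        define y where "y = - x"
        have "0 < y" using True y_def by simp
        \<comment> \<open>With \<open>y = - x > 0\<close>, \<open>exp (e y) - 1\<close> is at most \<open>e y exp (e y)\<close>, hence at most \<open>e exp (2 y)\<close>.\<close>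
        have y_exp: "y \<le> exp y" using exp_ge_add_one_self[of y] by linarith
        have ey: "e * y \<le> y" using elim \<open>0 < y\<close> by (simp add: mult_le_cancel_right1)
        have "1 - exp (- (e * y)) \<le> e * y" using exp_ge_add_one_self[of "- (e * y)"] by simp
        then have "exp (e * y) * (1 - exp (- (e * y))) \<le> exp (e * y) * (e * y)" by (rule mult_left_mono) simp
        then have "exp (e * y) - 1 \<le> exp (e * y) * (e * y)"
          by (simp add: right_diff_distrib exp_add[symmetric])
        also have "\<dots> \<le> exp y * (e * exp y)"
          using ey elim \<open>0 < y\<close> y_exp by (intro mult_mono) auto
        also have "\<dots> = e * exp (2 * y)" by (simp add: exp_double power2_eq_square)
        finally have "exp (e * y) - 1 \<le> e * exp (2 * y)" .
        moreover have "0 \<le> exp (e * y) - 1" using elim \<open>0 < y\<close> by simp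
        ultimately have "(exp (e * y) - 1)\<^sup>2 \<le> (e * exp (2 * y))\<^sup>2" by (intro power_mono)
        then have sq: "(1 - exp (e * y))\<^sup>2 \<le> e\<^sup>2 * exp (4 * y)"
          by (simp add: power2_commute power_mult_distrib exp_double[symmetric])
        have "exp (k * e * y) * (1 - exp (e * y))\<^sup>2 \<le> exp (k * y) * (e\<^sup>2 * exp (4 * y))"
          using sq ey assms by (intro mult_mono) (auto simp: mult.assoc mult_left_mono)
        also have "\<dots> = e\<^sup>2 * exp ((k + 4) * y)" by (simp add: exp_add[symmetric] algebra_simps)
        finally show ?thesis using True by (simp add: y_def del: minus_add_distrib)
      qed simp
    qed
    also have "\<dots> = e\<^sup>2 * B" using laplace[of "k+4"] assms by (simp add: B_def)
    finally show ?case by (rule mult_left_mono) simp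
  qed
  show "((\<lambda>e. e powr (-(1+\<alpha>)) * (e\<^sup>2 * B)) \<longlongrightarrow> 0) (at_right 0)"
    using alpha by real_asymp
qed simp


abbreviation kernel_const :: real where
  "kernel_const \<equiv> \<alpha> * (1 + \<alpha>) / Gamma (1 - \<alpha>)"

lemma Gamma_pos: "0 < Gamma (1 - \<alpha>)"
  using alpha by (simp add: Gamma_real_pos)

lemma limit_moment:
  "has_bochner_integral lborel
     (\<lambda>z. exp (- z) ^ k * (kernel_const * (indicator {0<..} z * ((1 - exp (- z))\<^sup>2 * z powr (-(2+\<alpha>))))))
     (second_difference (real k))"
proof (rule has_bochner_integral_nn_integral)
  \<comment> \<open>The second difference is a limit of expectations of nonnegative variables.\<close>
  have pos: "0 \<le> second_difference (real k)"
    by (rule tendsto_lowerbound[OF second_difference_moment_tendsto]) auto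
  have "(\<integral>\<^sup>+z. ennreal (exp (- z) ^ k * (kernel_const * (indicator {0<..} z * ((1 - exp (- z))\<^sup>2 * z powr (-(2+\<alpha>)))))) \<partial>lborel)
    = (\<integral>\<^sup>+z. ennreal kernel_const * (ennreal (exp (- real k * z) * (1 - exp (-z))\<^sup>2 * z powr (- (2 + \<alpha>))) * indicator {0<..} z) \<partial>lborel)"
    using alpha Gamma_pos
    by (intro nn_integral_cong)
      (auto simp: indicator_def ennreal_mult'[symmetric] exp_of_nat_mult[symmetric] mult_ac)
  also have "\<dots> = ennreal kernel_const * ennreal (Gamma (1 - \<alpha>) / (\<alpha> * (1 + \<alpha>)) * second_difference (real k))"
    using nn_integral_second_difference_kernel[OF alpha, of "real k"]
    by (subst nn_integral_cmult) simp_all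
  also have "\<dots> = ennreal (second_difference (real k))"
    using alpha Gamma_pos less_imp_neq[OF Gamma_pos] by (subst ennreal_mult'[symmetric]) auto
  finally show "(\<integral>\<^sup>+z. ennreal (exp (- z) ^ k * (kernel_const * (indicator {0<..} z * ((1 - exp (- z))\<^sup>2 * z powr (-(2+\<alpha>)))))) \<partial>lborel)
    = ennreal (second_difference (real k))" .
  show "0 \<le> second_difference (real k)" by (rule pos)
qed (use alpha Gamma_pos in auto)

text \<open>
  Karamata's method: tested against powers of \<open>exp (- e x)\<close>, the rescaled law weighted by
  \<open>(1 - exp (- e x))\<^sup>2\<close> converges, because these moments are second differences of the Laplace
  transform. Hence it converges against every continuous function of \<open>exp (- e x)\<close>.
\<close>

lemma continuous_test_tendsto:
  assumes g: "continuous_on {0..1} g" "g \<in> borel_measurable borel"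
  shows "((\<lambda>e. \<integral>x. g (exp (- e * x)) * (e powr (-(1+\<alpha>)) * (indicator {0..} x * (1 - exp (- e * x))\<^sup>2)) \<partial>N)
    \<longlongrightarrow> (\<integral>z. g (exp (- z)) * (kernel_const * (indicator {0<..} z * ((1 - exp (- z))\<^sup>2 * z powr (-(2+\<alpha>))))) \<partial>lborel))
    (at_right 0)"
proof (rule weighted_moments_tendsto_imp_continuous[where
    u = "\<lambda>e x. exp (- e * x)" and v = "\<lambda>z. exp (- z)"
    and w = "\<lambda>e x. e powr (-(1+\<alpha>)) * (indicator {0..} x * (1 - exp (- e * x))\<^sup>2)"
    and q = "\<lambda>z. kernel_const * (indicator {0<..} z * ((1 - exp (- z))\<^sup>2 * z powr (-(2+\<alpha>))))"])
  have int: "integrable N (\<lambda>x. indicator A x * (exp (- (k * e) * x) * (1 - exp (- e * x))\<^sup>2))"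
    if "0 \<le> k" "0 \<le> e" "A \<in> sets borel" for k e :: real and A
    using integrable_real_mult_indicator[OF _ integrable_second_difference[of k e], of A] that
    by (simp add: mult.commute sets_N)
  show "\<forall>\<^sub>F e in at_right 0. integrable N (\<lambda>x. e powr (-(1+\<alpha>)) * (indicator {0..} x * (1 - exp (- e * x))\<^sup>2))"
    using eventually_at_right_less[of 0]
  proof eventually_elim
    case (elim e)
    then show ?case using int[of 0 e "{0..}"] by simp
  qed
  show "integrable lborel (\<lambda>z. kernel_const * (indicator {0<..} z * ((1 - exp (- z))\<^sup>2 * z powr (-(2+\<alpha>)))))"
    using has_bochner_integral_iff[THEN iffD1, OF limit_moment[of 0]] by simp
  show "\<forall>\<^sub>F e in at_right 0. \<forall>x. e powr (-(1+\<alpha>)) * (indicator {0..} x * (1 - exp (- e * x))\<^sup>2) \<noteq> 0 \<longrightarrow>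
      exp (- e * x) \<in> {0..1}"
    using eventually_at_right_less[of 0] by eventually_elim (auto simp: indicator_def)
  show "((\<lambda>e. \<integral>x. exp (- e * x) ^ k * (e powr (-(1+\<alpha>)) * (indicator {0..} x * (1 - exp (- e * x))\<^sup>2)) \<partial>N)
    \<longlongrightarrow> (\<integral>z. exp (- z) ^ k * (kernel_const * (indicator {0<..} z * ((1 - exp (- z))\<^sup>2 * z powr (-(2+\<alpha>))))) \<partial>lborel))
    (at_right 0)" for k :: nat
  proof -
    have "((\<lambda>e. e powr (-(1+\<alpha>)) * (\<integral>x. exp (- (real k * e) * x) * (1 - exp (- e * x))\<^sup>2 \<partial>N)
       - e powr (-(1+\<alpha>)) * (\<integral>x. indicator {..<0} x * (exp (- (real k * e) * x) * (1 - exp (- e * x))\<^sup>2) \<partial>N))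
       \<longlongrightarrow> second_difference (real k) - 0) (at_right 0)"
      by (intro tendsto_diff second_difference_moment_tendsto negative_part_negligible) auto
    then have "((\<lambda>e. e powr (-(1+\<alpha>)) * (\<integral>x. exp (- (real k * e) * x) * (1 - exp (- e * x))\<^sup>2 \<partial>N)
       - e powr (-(1+\<alpha>)) * (\<integral>x. indicator {..<0} x * (exp (- (real k * e) * x) * (1 - exp (- e * x))\<^sup>2) \<partial>N))
       \<longlongrightarrow> (\<integral>z. exp (- z) ^ k * (kernel_const * (indicator {0<..} z * ((1 - exp (- z))\<^sup>2 * z powr (-(2+\<alpha>))))) \<partial>lborel)) (at_right 0)"
      using has_bochner_integral_iff[THEN iffD1, OF limit_moment[of k]] by simp
    then show ?thesis
    proof (rule Lim_transform_eventually)
      show "\<forall>\<^sub>F e in at_right 0. e powr (-(1+\<alpha>)) * (\<integral>x. exp (- (real k * e) * x) * (1 - exp (- e * x))\<^sup>2 \<partial>N)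
       - e powr (-(1+\<alpha>)) * (\<integral>x. indicator {..<0} x * (exp (- (real k * e) * x) * (1 - exp (- e * x))\<^sup>2) \<partial>N)
       = (\<integral>x. exp (- e * x) ^ k * (e powr (-(1+\<alpha>)) * (indicator {0..} x * (1 - exp (- e * x))\<^sup>2)) \<partial>N)"
        using eventually_at_right_less[of 0]
      proof eventually_elim
        case (elim e)
        have "(\<integral>x. exp (- e * x) ^ k * (e powr (-(1+\<alpha>)) * (indicator {0..} x * (1 - exp (- e * x))\<^sup>2)) \<partial>N)
          = (\<integral>x. e powr (-(1+\<alpha>)) * (exp (- (real k * e) * x) * (1 - exp (- e * x))\<^sup>2
              - indicator {..<0} x * (exp (- (real k * e) * x) * (1 - exp (- e * x))\<^sup>2)) \<partial>N)"
          by (intro Bochner_Integration.integral_cong)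
            (auto simp: indicator_def exp_of_nat_mult[symmetric] mult_ac)
        also have "\<dots> = e powr (-(1+\<alpha>)) * ((\<integral>x. exp (- (real k * e) * x) * (1 - exp (- e * x))\<^sup>2 \<partial>N)
          - (\<integral>x. indicator {..<0} x * (exp (- (real k * e) * x) * (1 - exp (- e * x))\<^sup>2) \<partial>N))"
          using elim int[of "real k" e "{..<0}"] integrable_second_difference[of "real k" e]
          by (subst integral_mult_right_zero) (subst Bochner_Integration.integral_diff, auto)
        finally show ?case by (simp add: right_diff_distrib)
      qed
    qed
  qed
qed (use alpha Gamma_pos g in \<open>auto simp: indicator_def\<close>)

definition ramp :: "real \<Rightarrow> real \<Rightarrow> real \<Rightarrow> real" where
  "ramp a b w = min 1 (max 0 ((b - w) / (b - a)))"

lemma ramp_eq_0: "a < b \<Longrightarrow> b \<le> w \<Longrightarrow> ramp a b w = 0"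
  and ramp_eq_1: "a < b \<Longrightarrow> w \<le> a \<Longrightarrow> ramp a b w = 1"
  and ramp_range: "ramp a b w \<in> {0..1}"
  by (auto simp: ramp_def min_def max_def field_simps)

lemma ramp_measurable[measurable]: "ramp a b \<in> borel_measurable borel"
  unfolding ramp_def by measurable

lemma ramp_test_tendsto:
  assumes ab: "0 < a" "a < b" "b < 1"
  shows "((\<lambda>e. e powr (-(1+\<alpha>)) * (\<integral>x. ramp a b (exp (- e * x)) \<partial>N))
    \<longlongrightarrow> kernel_const * (\<integral>z. indicator {0<..} z * (ramp a b (exp (- z)) * z powr (-(2+\<alpha>))) \<partial>lborel)) (at_right 0)"
proof -
  \<comment> \<open>The ramp vanishes near \<open>1\<close>, so the weight \<open>(1 - w)\<^sup>2\<close> can be divided out.\<close>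
  define g where "g w = ramp a b w / (max (1 - w) (1 - b))\<^sup>2" for w
  have g1: "g w * (1 - w)\<^sup>2 = ramp a b w" for w
    using ab ramp_eq_0[of a b w] by (cases "b \<le> w") (auto simp: g_def max_def)
  have m: "g \<in> borel_measurable borel" unfolding g_def by measurable
  have c: "continuous_on {0..1} g"
    unfolding g_def ramp_def using ab by (intro continuous_intros) (auto simp: max_def)
  have limit_eq: "kernel_const * (\<integral>z. indicator {0<..} z * (ramp a b (exp (- z)) * z powr (-(2+\<alpha>))) \<partial>lborel)
    = (\<integral>z. g (exp (- z)) * (kernel_const * (indicator {0<..} z * ((1 - exp (- z))\<^sup>2 * z powr (-(2+\<alpha>))))) \<partial>lborel)"
    unfolding g1[symmetric] by (subst integral_mult_right_zero[symmetric]) (simp add: mult_ac)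
  have "\<forall>\<^sub>F e in at_right 0.
      (\<integral>x. g (exp (- e * x)) * (e powr (-(1+\<alpha>)) * (indicator {0..} x * (1 - exp (- e * x))\<^sup>2)) \<partial>N)
      = e powr (-(1+\<alpha>)) * (\<integral>x. ramp a b (exp (- e * x)) \<partial>N)"
    using eventually_at_right_less[of 0]
  proof eventually_elim
    case (elim e)
    have "ramp a b (exp (- e * x)) = indicator {0..} x * ramp a b (exp (- e * x))" for x
    proof (cases "0 \<le> x")
      case False
      then have "1 \<le> exp (- e * x)" using elim by (simp add: mult_pos_neg less_imp_le)
      then have "ramp a b (exp (- e * x)) = 0" using ab by (intro ramp_eq_0) linarith+
      then show ?thesis by simp
    qed simp
    then have r: "g (exp (- e * x)) * (indicator {0..} x * (1 - exp (- e * x))\<^sup>2) = ramp a b (exp (- e * x))" for x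
      using g1[of "exp (- e * x)"] by (simp only: mult.left_commute)
    have eq: "g (exp (- e * x)) * (e powr (-(1+\<alpha>)) * (indicator {0..} x * (1 - exp (- e * x))\<^sup>2))
      = e powr (-(1+\<alpha>)) * ramp a b (exp (- e * x))" for x
      using r[of x] by (simp only: mult.left_commute[of "g _"])
    show ?case unfolding eq by simp
  qed
  from Lim_transform_eventually[OF continuous_test_tendsto[OF c m] this]
  show ?thesis unfolding limit_eq .
qed

text \<open>
  The tail of the law is trapped between ramps, whose rescaled integrals converge to integrals of the
  Levy density; letting the ramps steepen gives its tail \<open>\<alpha> / Gamma (1 - \<alpha>)\<close> at level \<open>1\<close>.
\<close>

theorem tail_asymptotics:
  "((\<lambda>v. v powr (1+\<alpha>) * measure N {v..}) \<longlongrightarrow> \<alpha> / Gamma (1 - \<alpha>)) at_top"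
proof -
  define C where "C = \<alpha> / Gamma (1 - \<alpha>)"
  have "0 < C" using alpha Gamma_pos by (simp add: C_def)
  define R where "R a b = kernel_const * (\<integral>z. indicator {0<..} z * (ramp a b (exp (- z)) * z powr (-(2+\<alpha>))) \<partial>lborel)" for a b
  have CC: "kernel_const * (c powr (-(1+\<alpha>)) / (1+\<alpha>)) = C * c powr (-(1+\<alpha>))" for c
    using alpha by (simp add: C_def)
  have tail: "has_bochner_integral lborel (\<lambda>z. indicator {c..} z * z powr (-(2+\<alpha>))) (c powr (-(1+\<alpha>)) / (1+\<alpha>))"
    if "0 < c" for c
    using has_bochner_integral_powr_tail[of c "1+\<alpha>"] that alpha by (simp add: algebra_simps)
  have ramp_int: "integrable lborel (\<lambda>z. indicator {0<..} z * (ramp a b (exp (- z)) * z powr (-(2+\<alpha>))))"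
    if "0 < a" "a < b" "b < 1" for a b
  proof (rule Bochner_Integration.integrable_bound)
    show "integrable lborel (\<lambda>z. indicator {- ln b..} z * z powr (-(2+\<alpha>)))"
      using tail[of "- ln b"] that by (auto simp: has_bochner_integral_iff)
    have "ramp a b (exp (- z)) = 0" if "z < - ln b" for z
    proof (rule ramp_eq_0)
      have "ln b < - z" using that by simp
      then have "exp (ln b) < exp (- z)" by (simp only: exp_less_cancel_iff)
      then show "b \<le> exp (- z)" using \<open>0 < a\<close> \<open>a < b\<close> by simp
    qed fact
    then show "AE z in lborel. norm (indicator {0<..} z * (ramp a b (exp (- z)) * z powr (-(2+\<alpha>)))) \<le>
      norm (indicator {- ln b..} z * z powr (-(2+\<alpha>)))"
      using ramp_range[of a b] by (intro AE_I2) (auto simp: indicator_def abs_mult mult_le_cancel_right1 not_le)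
  qed simp
  have int_ramp: "integrable N (\<lambda>x. ramp a b (exp (- e * x)))" for a b e
    using ramp_range[of a b] by (intro integrable_const_bound[where B=1]) auto
  have int_ind: "integrable N (indicator {c..} :: real \<Rightarrow> real)" for c
    by (intro integrable_real_indicator) (auto simp: sets_N emeasure_eq_measure)
  have lower: "C * (1 + \<delta>) powr (-(1+\<alpha>)) \<le> R (exp (-(1+\<delta>))) (exp (-1))" if "0 < \<delta>" for \<delta>
  proof -
    have "(\<integral>z. indicator {1+\<delta>..} z * z powr (-(2+\<alpha>)) \<partial>lborel)
       \<le> (\<integral>z. indicator {0<..} z * (ramp (exp (-(1+\<delta>))) (exp (-1)) (exp (- z)) * z powr (-(2+\<alpha>))) \<partial>lborel)"
    proof (rule integral_mono)
      fix z
      show "indicator {1+\<delta>..} z * z powr (-(2+\<alpha>)) \<le> indicator {0<..} z * (ramp (exp (-(1+\<delta>))) (exp (-1)) (exp (- z)) * z powr (-(2+\<alpha>)))"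
        using that ramp_range[of "exp (-(1+\<delta>))" "exp (-1)" "exp (-z)"]
        by (cases "1 + \<delta> \<le> z") (auto simp: indicator_def ramp_eq_1)
    qed (use ramp_int tail[of "1+\<delta>"] that in \<open>auto simp: has_bochner_integral_iff\<close>)
    then have "kernel_const * (\<integral>z. indicator {1+\<delta>..} z * z powr (-(2+\<alpha>)) \<partial>lborel) \<le> R (exp (-(1+\<delta>))) (exp (-1))"
      unfolding R_def using alpha Gamma_pos by (intro mult_left_mono) auto
    then show ?thesis
      using tail[of "1+\<delta>"] that CC[of "1+\<delta>"] by (simp only: has_bochner_integral_iff)
  qed
  have upper: "R (exp (-1)) (exp (-(1-\<delta>))) \<le> C * (1 - \<delta>) powr (-(1+\<alpha>))" if "0 < \<delta>" "\<delta> < 1" for \<delta>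
  proof -
    have "(\<integral>z. indicator {0<..} z * (ramp (exp (-1)) (exp (-(1-\<delta>))) (exp (- z)) * z powr (-(2+\<alpha>))) \<partial>lborel)
      \<le> (\<integral>z. indicator {1-\<delta>..} z * z powr (-(2+\<alpha>)) \<partial>lborel)"
    proof (rule integral_mono)
      fix z
      show "indicator {0<..} z * (ramp (exp (-1)) (exp (-(1-\<delta>))) (exp (- z)) * z powr (-(2+\<alpha>))) \<le> indicator {1-\<delta>..} z * z powr (-(2+\<alpha>))"
        using that ramp_range[of "exp (-1)" "exp (-(1-\<delta>))" "exp (-z)"]
        by (cases "1 - \<delta> \<le> z") (auto simp: indicator_def ramp_eq_0 mult_le_cancel_right1)
    qed (use ramp_int tail[of "1-\<delta>"] that in \<open>auto simp: has_bochner_integral_iff\<close>)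
    then have "R (exp (-1)) (exp (-(1-\<delta>))) \<le> kernel_const * (\<integral>z. indicator {1-\<delta>..} z * z powr (-(2+\<alpha>)) \<partial>lborel)"
      unfolding R_def using alpha Gamma_pos by (intro mult_left_mono) auto
    then show ?thesis
      using tail[of "1-\<delta>"] that CC[of "1-\<delta>"] by (simp only: has_bochner_integral_iff)
  qed
  have R_lim: "((\<lambda>e. e powr (-(1+\<alpha>)) * (\<integral>x. ramp a b (exp (- e * x)) \<partial>N)) \<longlongrightarrow> R a b) (at_right 0)"
    if "0 < a" "a < b" "b < 1" for a b
    unfolding R_def using ramp_test_tendsto[OF that] .
  have "((\<lambda>e. e powr (-(1+\<alpha>)) * measure N {1/e..}) \<longlongrightarrow> C) (at_right 0)"
  proof (rule order_tendstoI)
    fix l assume "l < C"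
    have "((\<lambda>\<delta>. C * (1 + \<delta>) powr (-(1+\<alpha>))) \<longlongrightarrow> C * (1 + 0) powr (-(1+\<alpha>))) (at_right 0)"
      by (intro tendsto_intros) auto
    then have "\<forall>\<^sub>F \<delta> in at_right 0. l < C * (1 + \<delta>) powr (-(1+\<alpha>))"
      by (rule order_tendstoD) (use \<open>l < C\<close> in simp)
    with eventually_at_right_less[of 0] have "\<forall>\<^sub>F \<delta> in at_right 0. 0 < \<delta> \<and> l < C * (1 + \<delta>) powr (-(1+\<alpha>))"
      by eventually_elim simp
    then obtain \<delta> where \<delta>: "0 < \<delta>" "l < C * (1 + \<delta>) powr (-(1+\<alpha>))"
      using eventually_happens'[of "at_right (0::real)"] by auto
    have "\<forall>\<^sub>F e in at_right 0. l < e powr (-(1+\<alpha>)) * (\<integral>x. ramp (exp (-(1+\<delta>))) (exp (-1)) (exp (- e * x)) \<partial>N)"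
      using R_lim[of "exp (-(1+\<delta>))" "exp (-1)"] lower[OF \<delta>(1)] \<delta>
      by (intro order_tendstoD(1)[where y="R (exp (-(1+\<delta>))) (exp (-1))"]) auto
    then show "\<forall>\<^sub>F e in at_right 0. l < e powr (-(1+\<alpha>)) * measure N {1/e..}"
      using eventually_at_right_less[of 0]
    proof eventually_elim
      case (elim e)
      have "(\<integral>x. ramp (exp (-(1+\<delta>))) (exp (-1)) (exp (- e * x)) \<partial>N) \<le> (\<integral>x. indicator {1/e..} x \<partial>N)"
      proof (rule integral_mono)
        fix x
        show "ramp (exp (-(1+\<delta>))) (exp (-1)) (exp (- e * x)) \<le> indicator {1/e..} x"
          using elim(2) \<delta>(1) ramp_range[of "exp (-(1+\<delta>))" "exp (-1)" "exp (- e * x)"]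
          by (cases "1/e \<le> x") (auto simp: indicator_def ramp_eq_0 field_simps)
      qed (use int_ramp int_ind in auto)
      also have "\<dots> = measure N {1/e..}" by (simp add: sets_N)
      finally have "e powr (-(1+\<alpha>)) * (\<integral>x. ramp (exp (-(1+\<delta>))) (exp (-1)) (exp (- e * x)) \<partial>N) \<le> e powr (-(1+\<alpha>)) * measure N {1/e..}"
        by (rule mult_left_mono) simp
      then show ?case using elim(1) by simp
    qed
  next
    fix l assume "C < l"
    have "((\<lambda>\<delta>. C * (1 - \<delta>) powr (-(1+\<alpha>))) \<longlongrightarrow> C * (1 - 0) powr (-(1+\<alpha>))) (at_right 0)"
      by (intro tendsto_intros) auto
    then have "\<forall>\<^sub>F \<delta> in at_right 0. C * (1 - \<delta>) powr (-(1+\<alpha>)) < l"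
      by (rule order_tendstoD) (use \<open>C < l\<close> in simp)
    moreover have "\<forall>\<^sub>F \<delta> in at_right 0. \<delta> \<in> {0<..<1::real}" by (rule eventually_at_right_real) simp
    ultimately have "\<forall>\<^sub>F \<delta> in at_right 0. \<delta> \<in> {0<..<1} \<and> C * (1 - \<delta>) powr (-(1+\<alpha>)) < l"
      by eventually_elim simp
    then obtain \<delta> where \<delta>: "0 < \<delta>" "\<delta> < 1" "C * (1 - \<delta>) powr (-(1+\<alpha>)) < l"
      using eventually_happens'[of "at_right (0::real)"] by auto
    have "\<forall>\<^sub>F e in at_right 0. e powr (-(1+\<alpha>)) * (\<integral>x. ramp (exp (-1)) (exp (-(1-\<delta>))) (exp (- e * x)) \<partial>N) < l"
      using R_lim[of "exp (-1)" "exp (-(1-\<delta>))"] upper[OF \<delta>(1,2)] \<delta>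
      by (intro order_tendstoD(2)[where y="R (exp (-1)) (exp (-(1-\<delta>)))"]) auto
    then show "\<forall>\<^sub>F e in at_right 0. e powr (-(1+\<alpha>)) * measure N {1/e..} < l"
      using eventually_at_right_less[of 0]
    proof eventually_elim
      case (elim e)
      have "measure N {1/e..} = (\<integral>x. indicator {1/e..} x \<partial>N)" by (simp add: sets_N)
      also have "\<dots> \<le> (\<integral>x. ramp (exp (-1)) (exp (-(1-\<delta>))) (exp (- e * x)) \<partial>N)"
      proof (rule integral_mono)
        fix x
        show "indicator {1/e..} x \<le> ramp (exp (-1)) (exp (-(1-\<delta>))) (exp (- e * x))"
          using elim(2) \<delta>(1) ramp_range[of "exp (-1)" "exp (-(1-\<delta>))" "exp (- e * x)"]
          by (cases "1/e \<le> x") (auto simp: indicator_def ramp_eq_1 field_simps)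
      qed (use int_ramp int_ind in auto)
      finally have "e powr (-(1+\<alpha>)) * measure N {1/e..} \<le> e powr (-(1+\<alpha>)) * (\<integral>x. ramp (exp (-1)) (exp (-(1-\<delta>))) (exp (- e * x)) \<partial>N)"
        by (rule mult_left_mono) simp
      then show ?case using elim(1) by simp
    qed
  qed
  then have "((\<lambda>v. inverse v powr (-(1+\<alpha>)) * measure N {1/inverse v..}) \<longlongrightarrow> C) at_top"
    by (rule filterlim_compose[OF _ filterlim_inverse_at_right_top])
  then show ?thesis unfolding C_def[symmetric]
  proof (rule Lim_transform_eventually)
    show "\<forall>\<^sub>F v in at_top. inverse v powr (-(1+\<alpha>)) * measure N {1/inverse v..} = v powr (1+\<alpha>) * measure N {v..}"
      using eventually_gt_at_top[of 0]
      by eventually_elim (simp add: powr_minus inverse_powr divide_inverse del: minus_add_distrib)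
  qed
qed

end

section \<open>Exponential supermartingales of random walks\<close>

text \<open>
  Multiplying by one more factor whose conditional expectation given the past is at most \<open>1\<close> cannot
  increase the expectation. The increments of the walk are independent, so conditioning
  is integration over one coordinate.
\<close>

lemma exp_supermartingale_product:
  fixes \<mu> :: "real measure" and G :: "real \<Rightarrow> real \<Rightarrow> real"
  assumes "prob_space \<mu>" and sets_mu[measurable_cong]: "sets \<mu> = sets borel"
    and G[measurable]: "(\<lambda>(s, x). G s x) \<in> borel_measurable (borel \<Otimes>\<^sub>M borel)"
    and step: "\<And>s. (\<integral>\<^sup>+x. ennreal (exp (G s x)) \<partial>\<mu>) \<le> 1"
  shows "(\<integral>\<^sup>+x. ennreal (exp (\<Sum>k<n. G (\<Sum>i<k. x i) (x k))) \<partial>Pi\<^sub>M {..<n::nat} (\<lambda>_. \<mu>)) \<le> 1"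
proof (induction n)
  case 0
  then show ?case by (simp add: PiM_empty nn_integral_count_space_finite)
next
  case (Suc n)
  interpret \<mu>: prob_space \<mu> by fact
  interpret product_sigma_finite "\<lambda>_::nat. \<mu>" by standard
  have "(\<integral>\<^sup>+x. ennreal (exp (\<Sum>k<Suc n. G (\<Sum>i<k. x i) (x k))) \<partial>Pi\<^sub>M {..<Suc n} (\<lambda>_. \<mu>))
    = (\<integral>\<^sup>+x. ennreal (exp (\<Sum>k<Suc n. G (\<Sum>i<k. x i) (x k))) \<partial>Pi\<^sub>M (insert n {..<n}) (\<lambda>_. \<mu>))"
    by (simp add: lessThan_Suc)
  also have "\<dots> = (\<integral>\<^sup>+x. (\<integral>\<^sup>+z. ennreal (exp (\<Sum>k<Suc n. G (\<Sum>i<k. (x(n := z)) i) ((x(n := z)) k))) \<partial>\<mu>) \<partial>Pi\<^sub>M {..<n} (\<lambda>_. \<mu>))"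
  proof (rule product_nn_integral_insert)
    have "(\<lambda>x. x k) \<in> borel_measurable (Pi\<^sub>M (insert n {..<n}) (\<lambda>_. \<mu>))" if "k < Suc n" for k
      using that by (auto intro!: measurable_component_singleton[THEN measurable_compose] simp: less_Suc_eq)
    then have [measurable]: "(\<lambda>x. G (\<Sum>i<k. x i) (x k)) \<in> borel_measurable (Pi\<^sub>M (insert n {..<n}) (\<lambda>_. \<mu>))"
      if "k < Suc n" for k
      using that
      by (intro measurable_compose[OF _ G, of "\<lambda>x. (\<Sum>i<k. x i, x k)", simplified] measurable_Pair borel_measurable_sum) auto
    show "(\<lambda>x. ennreal (exp (\<Sum>k<Suc n. G (\<Sum>i<k. x i) (x k)))) \<in> borel_measurable (Pi\<^sub>M (insert n {..<n}) (\<lambda>_. \<mu>))"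
      by (intro measurable_compose[OF _ measurable_ennreal] measurable_compose[OF _ borel_measurable_exp] borel_measurable_sum) simp
  qed auto
  also have "\<dots> = (\<integral>\<^sup>+x. (\<integral>\<^sup>+z. ennreal (exp (\<Sum>k<n. G (\<Sum>i<k. x i) (x k))) * ennreal (exp (G (\<Sum>i<n. x i) z)) \<partial>\<mu>) \<partial>Pi\<^sub>M {..<n} (\<lambda>_. \<mu>))"
  proof (intro nn_integral_cong)
    fix x :: "nat \<Rightarrow> real" and z :: real
    have "(\<Sum>i<k. (x(n := z)) i) = (\<Sum>i<k. x i)" if "k \<le> n" for k
      using that by (intro sum.cong) auto
    then show "ennreal (exp (\<Sum>k<Suc n. G (\<Sum>i<k. (x(n := z)) i) ((x(n := z)) k)))
      = ennreal (exp (\<Sum>k<n. G (\<Sum>i<k. x i) (x k))) * ennreal (exp (G (\<Sum>i<n. x i) z))"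
      by (simp add: exp_add ennreal_mult'')
  qed
  also have "\<dots> = (\<integral>\<^sup>+x. ennreal (exp (\<Sum>k<n. G (\<Sum>i<k. x i) (x k))) * (\<integral>\<^sup>+z. ennreal (exp (G (\<Sum>i<n. x i) z)) \<partial>\<mu>) \<partial>Pi\<^sub>M {..<n} (\<lambda>_. \<mu>))"
    by (intro nn_integral_cong nn_integral_cmult) measurable
  also have "\<dots> \<le> (\<integral>\<^sup>+x. ennreal (exp (\<Sum>k<n. G (\<Sum>i<k. x i) (x k))) \<partial>Pi\<^sub>M {..<n} (\<lambda>_. \<mu>))"
    by (intro nn_integral_mono) (use mult_left_mono[OF step] in \<open>fastforce\<close>)
  also have "\<dots> \<le> 1" by (rule Suc.IH)
  finally show ?case .
qed

text \<open>
  The half-line has probability \<open>q\<close>, and \<open>1 + (exp \<theta> - 1) q \<le> exp ((exp \<theta> - 1) q)\<close>. The bound holds for both signs of \<open>\<theta>\<close>, so it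
  controls the counts from above and from below.
\<close>

lemma exp_crossing_step:
  fixes \<mu> :: "real measure"
  assumes "prob_space \<mu>" and [measurable_cong]: "sets \<mu> = sets borel"
  shows "(\<integral>\<^sup>+x. ennreal (exp (\<theta> * indicator {c..} x - (exp \<theta> - 1) * measure \<mu> {c..})) \<partial>\<mu>) \<le> 1"
proof -
  interpret prob_space \<mu> by fact
  define q where "q = measure \<mu> {c..}"
  have "exp (\<theta> * indicator {c..} x - (exp \<theta> - 1) * q)
      = exp (- ((exp \<theta> - 1) * q)) * (1 + (exp \<theta> - 1) * indicator {c..} x)" for x :: real
    by (auto simp: indicator_def exp_diff exp_minus exp_add field_simps)
  moreover have "integrable \<mu> (\<lambda>x. exp (- ((exp \<theta> - 1) * q)) * (1 + (exp \<theta> - 1) * indicator {c..} x))"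
    by (simp add: emeasure_eq_measure)
  moreover have "(\<integral>x. exp (- ((exp \<theta> - 1) * q)) * (1 + (exp \<theta> - 1) * indicator {c..} x) \<partial>\<mu>)
      = exp (- ((exp \<theta> - 1) * q)) * (1 + (exp \<theta> - 1) * q)"
    by (simp add: q_def emeasure_eq_measure prob_space)
  moreover have "exp (- ((exp \<theta> - 1) * q)) * (1 + (exp \<theta> - 1) * q) \<le> 1"
  proof -
    have "exp (- ((exp \<theta> - 1) * q)) * (1 + (exp \<theta> - 1) * q)
        \<le> exp (- ((exp \<theta> - 1) * q)) * exp ((exp \<theta> - 1) * q)"
      by (intro mult_left_mono exp_ge_add_one_self) simp
    then show ?thesis by (simp add: exp_minus)
  qed
  ultimately have "integrable \<mu> (\<lambda>x. exp (\<theta> * indicator {c..} x - (exp \<theta> - 1) * q))"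
    "(\<integral>x. exp (\<theta> * indicator {c..} x - (exp \<theta> - 1) * q) \<partial>\<mu>) \<le> 1"
    by simp_all
  then show ?thesis
    unfolding q_def[symmetric] by (subst nn_integral_eq_integral) auto
qed

context levy_process
begin

definition tail_prob :: "real \<Rightarrow> real \<Rightarrow> real" where
  "tail_prob s u = prob {\<omega> \<in> space M. u \<le> X s \<omega>}"

lemma tail_prob_eq_distr: "0 \<le> s \<Longrightarrow> tail_prob s u = measure (distr M borel (X s)) {u..}"
  using measurable_X[of s] unfolding tail_prob_def
  by (subst measure_distr) (auto intro!: arg_cong[where f=prob])

lemma tail_prob_antimono: "0 \<le> s \<Longrightarrow> u \<le> v \<Longrightarrow> tail_prob s v \<le> tail_prob s u"
  unfolding tail_prob_def using measurable_X[of s]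
  by (intro finite_measure_mono) auto

lemma tail_prob_measurable:
  assumes "0 \<le> s"
  shows "tail_prob s \<in> borel_measurable borel"
proof -
  have "mono (\<lambda>u. - tail_prob s u)"
    using tail_prob_antimono[OF assms] by (auto intro!: monoI)
  from borel_measurable_uminus[OF borel_measurable_mono[OF this]] show ?thesis by simp
qed

text \<open>
  Sampled along a grid, the process is a random walk. The \<open>tail_prob\<close> term compensates the indicator of
  a step of the walk that climbs from below \<open>y - h\<close> to above \<open>y + h\<close>.
\<close>

definition crossing_exponent :: "real \<Rightarrow> real \<Rightarrow> real \<Rightarrow> real \<Rightarrow> nat \<Rightarrow> 'a \<Rightarrow> real" where
  "crossing_exponent \<theta> h y t n \<omega> = (\<Sum>k<n. if X (t * real k / real n) \<omega> \<le> y - h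
     then \<theta> * of_bool (y + h \<le> X (t * real (Suc k) / real n) \<omega>)
        - (exp \<theta> - 1) * tail_prob (t / real n) (y + h - X (t * real k / real n) \<omega>)
     else 0)"

lemma crossing_exponent_measurable:
  assumes "0 \<le> t"
  shows "crossing_exponent \<theta> h y t n \<in> borel_measurable M"
proof -
  have [measurable]: "X (t * real k / real n) \<in> borel_measurable M" for k
    using assms by (intro measurable_X) simp
  have [measurable]: "tail_prob (t / real n) \<in> borel_measurable borel"
    using assms by (intro tail_prob_measurable) simp
  show ?thesis unfolding crossing_exponent_def by measurable
qed

lemma exp_crossing_exponent_le_1:
  assumes "0 < t"
  shows "(\<integral>\<^sup>+\<omega>. ennreal (exp (crossing_exponent \<theta> h y t n \<omega>)) \<partial>M) \<le> 1"
proof (cases "n = 0")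
  case True
  then show ?thesis by (simp add: crossing_exponent_def emeasure_space_1)
next
  case False
  define \<Delta> where "\<Delta> = t / real n"
  have "0 < \<Delta>" using False assms by (simp add: \<Delta>_def)
  define s where "s k = \<Delta> * real k" for k
  define \<xi> where "\<xi> k \<omega> = X (s (Suc k)) \<omega> - X (s k) \<omega>" for k \<omega>
  define \<mu> where "\<mu> = distr M borel (X \<Delta>)"
  have Xm[measurable]: "X (s k) \<in> borel_measurable M" for k
    using \<open>0 < \<Delta>\<close> by (intro measurable_X) (simp add: s_def)
  have X\<Delta>[measurable]: "X \<Delta> \<in> borel_measurable M" using \<open>0 < \<Delta>\<close> by (intro measurable_X) simp
  have \<xi>m[measurable]: "\<xi> k \<in> borel_measurable M" for k unfolding \<xi>_def by measurable
  have mu: "prob_space \<mu>" "sets \<mu> = sets borel" unfolding \<mu>_def by (auto intro: prob_space_distr)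
  have "indep_vars (\<lambda>_. borel) \<xi> {..<n}"
    unfolding \<xi>_def using \<open>0 < \<Delta>\<close> by (intro indep_increments) (auto simp: s_def mono_def mult_left_mono)
  moreover have "distr M borel (\<xi> k) = \<mu>" for k
    using stationary_increments[of "s k" \<Delta>] \<open>0 < \<Delta>\<close>
    by (simp add: \<mu>_def \<xi>_def[abs_def] s_def algebra_simps)
  moreover have "{..<n} \<noteq> {}" using False by auto
  ultimately have law: "distr M (Pi\<^sub>M {..<n} (\<lambda>_. borel)) (\<lambda>\<omega>. \<lambda>k\<in>{..<n}. \<xi> k \<omega>) = Pi\<^sub>M {..<n} (\<lambda>_. \<mu>)"
    using indep_vars_iff_distr_eq_PiM[where M' = "\<lambda>_. borel" and X = \<xi> and I = "{..<n}"] \<xi>m by simp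
  define G where "G a x = (if a \<le> y - h then \<theta> * indicator {y + h - a..} x - (exp \<theta> - 1) * measure \<mu> {y + h - a..} else 0)"
    for a x :: real
  have q: "measure \<mu> {u..} = tail_prob \<Delta> u" for u
    using \<open>0 < \<Delta>\<close> by (simp add: \<mu>_def tail_prob_eq_distr)
  have [measurable]: "tail_prob \<Delta> \<in> borel_measurable borel"
    using \<open>0 < \<Delta>\<close> by (intro tail_prob_measurable) simp
  have ind: "indicator {y + h - a..} x = (if y + h \<le> a + x then 1 else 0 :: real)" for a x
    by (auto simp: indicator_def)
  have Gm[measurable]: "(\<lambda>(a, x). G a x) \<in> borel_measurable (borel \<Otimes>\<^sub>M borel)"
    unfolding G_def q ind by measurable
  have step: "(\<integral>\<^sup>+x. ennreal (exp (G a x)) \<partial>\<mu>) \<le> 1" for a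
  proof (cases "a \<le> y - h")
    case True
    then show ?thesis unfolding G_def using exp_crossing_step[OF mu] by simp
  next
    case False
    interpret mu: prob_space \<mu> by fact
    show ?thesis using False by (simp add: G_def mu.emeasure_space_1)
  qed
  have walk: "(\<Sum>i<k. \<xi> i \<omega>) = X (s k) \<omega> - X 0 \<omega>" for k \<omega>
    by (induction k) (auto simp: \<xi>_def s_def)
  have meas: "(\<lambda>x. \<Sum>k<n. G (\<Sum>i<k. x i) (x k)) \<in> borel_measurable (Pi\<^sub>M {..<n} (\<lambda>_. borel))"
  proof (rule borel_measurable_sum)
    fix k assume "k \<in> {..<n}"
    then show "(\<lambda>x. G (\<Sum>i<k. x i) (x k)) \<in> borel_measurable (Pi\<^sub>M {..<n} (\<lambda>_. borel))"
      by (intro measurable_compose[OF _ Gm, of "\<lambda>x. (\<Sum>i<k. x i, x k)", simplified] measurable_Pair borel_measurable_sum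
          measurable_component_singleton) auto
  qed
  have "(\<integral>\<^sup>+\<omega>. ennreal (exp (crossing_exponent \<theta> h y t n \<omega>)) \<partial>M)
     = (\<integral>\<^sup>+\<omega>. ennreal (exp (\<Sum>k<n. G (\<Sum>i<k. (\<lambda>k\<in>{..<n}. \<xi> k \<omega>) i) ((\<lambda>k\<in>{..<n}. \<xi> k \<omega>) k))) \<partial>M)"
  proof (rule nn_integral_cong_AE)
    show "AE \<omega> in M. ennreal (exp (crossing_exponent \<theta> h y t n \<omega>))
     = ennreal (exp (\<Sum>k<n. G (\<Sum>i<k. (\<lambda>k\<in>{..<n}. \<xi> k \<omega>) i) ((\<lambda>k\<in>{..<n}. \<xi> k \<omega>) k)))"
      using start_0
    proof eventually_elim
      case (elim \<omega>)
      have "(\<Sum>k<n. G (\<Sum>i<k. (\<lambda>k\<in>{..<n}. \<xi> k \<omega>) i) ((\<lambda>k\<in>{..<n}. \<xi> k \<omega>) k))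
         = (\<Sum>k<n. G (\<Sum>i<k. \<xi> i \<omega>) (\<xi> k \<omega>))"
        by (intro sum.cong arg_cong2[where f=G] refl) auto
      also have "\<dots> = (\<Sum>k<n. G (X (s k) \<omega>) (\<xi> k \<omega>))" using elim by (simp add: walk)
      also have "\<dots> = crossing_exponent \<theta> h y t n \<omega>"
        unfolding crossing_exponent_def G_def q
        by (intro sum.cong) (auto simp: s_def \<Delta>_def \<xi>_def indicator_def)
      finally show ?case by simp
    qed
  qed
  also have "\<dots> = (\<integral>\<^sup>+x. ennreal (exp (\<Sum>k<n. G (\<Sum>i<k. x i) (x k)))
       \<partial>distr M (Pi\<^sub>M {..<n} (\<lambda>_. borel)) (\<lambda>\<omega>. \<lambda>k\<in>{..<n}. \<xi> k \<omega>))"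
    by (subst nn_integral_distr) (use meas in \<open>auto intro!: measurable_restrict\<close>)
  also have "\<dots> \<le> 1"
    unfolding law by (rule exp_supermartingale_product[OF mu Gm step])
  finally show ?thesis .
qed

end

section \<open>Crossings and jumps of cadlag paths\<close>

lemma left_limit_tendsto:
  assumes "cadlag x" "0 < s"
  shows "(x \<longlongrightarrow> left_limit x s) (at_left s)"
proof -
  obtain l where "(x \<longlongrightarrow> l) (at_left s)" using assms unfolding cadlag_def by blast
  moreover from this have "Lim (at_left s) x = l" by (intro tendsto_Lim) auto
  ultimately show ?thesis using assms by (simp add: left_limit_def)
qed

lemma cadlag_local_oscillation:
  assumes "cadlag x" "0 \<le> s" "0 < \<epsilon>"
  obtains \<delta> where "0 < \<delta>"
    "\<And>u. s \<le> u \<Longrightarrow> u < s + \<delta> \<Longrightarrow> \<bar>x u - x s\<bar> < \<epsilon>"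
    "\<And>u. 0 \<le> u \<Longrightarrow> s - \<delta> < u \<Longrightarrow> u < s \<Longrightarrow> \<bar>x u - left_limit x s\<bar> < \<epsilon>"
proof -
  have "(x \<longlongrightarrow> x s) (at_right s)" using assms unfolding cadlag_def by blast
  from tendstoD[OF this \<open>0 < \<epsilon>\<close>]
  obtain b where b: "s < b" "\<And>u. s < u \<Longrightarrow> u < b \<Longrightarrow> \<bar>x u - x s\<bar> < \<epsilon>"
    unfolding eventually_at_right_field by (auto simp: dist_real_def)
  obtain a where a: "a < s" "\<And>u. 0 \<le> u \<Longrightarrow> a < u \<Longrightarrow> u < s \<Longrightarrow> \<bar>x u - left_limit x s\<bar> < \<epsilon>"
  proof (cases "s = 0")
    case True
    then show ?thesis by (intro that[of "-1"]) auto
  next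
    case False
    then have "0 < s" using assms by simp
    from tendstoD[OF left_limit_tendsto[OF assms(1) this] \<open>0 < \<epsilon>\<close>]
    show ?thesis unfolding eventually_at_left_field by (auto simp: dist_real_def intro: that)
  qed
  show ?thesis
  proof (rule that[of "min (b - s) (s - a)"])
    fix u assume "s \<le> u" "u < s + min (b - s) (s - a)"
    then show "\<bar>x u - x s\<bar> < \<epsilon>" using b(2)[of u] \<open>0 < \<epsilon>\<close> by (cases "u = s") auto
  qed (use a b in auto)
qed

lemma left_limit_approximable:
  assumes "cadlag x" "0 < s" "r < s" "0 < \<epsilon>"
  obtains u where "0 \<le> u" "r < u" "u < s" "\<bar>x u - left_limit x s\<bar> < \<epsilon>"
proof -
  obtain \<delta> where \<delta>: "0 < \<delta>" "\<And>u. 0 \<le> u \<Longrightarrow> s - \<delta> < u \<Longrightarrow> u < s \<Longrightarrow> \<bar>x u - left_limit x s\<bar> < \<epsilon>"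
    using cadlag_local_oscillation[OF assms(1) _ assms(4), of s] assms(2) by (metis less_imp_le)
  define u where "u = (max 0 (max r (s - \<delta>)) + s) / 2"
  have "max 0 (max r (s - \<delta>)) < s" using assms \<delta>(1) by simp
  then have "max 0 (max r (s - \<delta>)) < u" "u < s" unfolding u_def by simp_all
  then show ?thesis using \<delta>(2)[of u] by (intro that[of u]) auto
qed

lemma cadlag_bounded:
  assumes "cadlag x" "0 \<le> T"
  obtains R where "\<And>s. 0 \<le> s \<Longrightarrow> s \<le> T \<Longrightarrow> \<bar>x s\<bar> \<le> R" "\<And>s. 0 \<le> s \<Longrightarrow> s \<le> T \<Longrightarrow> \<bar>left_limit x s\<bar> \<le> R"
proof -
  define A :: "real set" where "A = {0..}"
  have "bounded (x ` (A \<inter> {0..T}))" using \<open>0 \<le> T\<close>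
  proof (induction rule: Bolzano)
    case (trans a b c)
    then have "A \<inter> {a..c} = (A \<inter> {a..b}) \<union> (A \<inter> {b..c})" by auto
    with trans show ?case by (simp add: image_Un)
  next
    case (local s)
    obtain \<delta> where \<delta>: "0 < \<delta>" "\<And>u. s \<le> u \<Longrightarrow> u < s + \<delta> \<Longrightarrow> \<bar>x u - x s\<bar> < 1"
      "\<And>u. 0 \<le> u \<Longrightarrow> s - \<delta> < u \<Longrightarrow> u < s \<Longrightarrow> \<bar>x u - left_limit x s\<bar> < 1"
      by (rule cadlag_local_oscillation[OF assms(1) local(1) zero_less_one]) blast
    have near: "\<bar>x u\<bar> \<le> max (\<bar>x s\<bar> + 1) (\<bar>left_limit x s\<bar> + 1)" if "0 \<le> u" "s - \<delta> < u" "u < s + \<delta>" for u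
      using \<delta>(2)[of u] \<delta>(3)[of u] that by (cases "s \<le> u") auto
    have "bounded (x ` (A \<inter> {a..b}))" if "a \<le> s \<and> s \<le> b \<and> b - a < \<delta>" for a b
    proof (rule boundedI[of _ "max (\<bar>x s\<bar> + 1) (\<bar>left_limit x s\<bar> + 1)"])
      fix z assume "z \<in> x ` (A \<inter> {a..b})"
      then obtain u where u: "z = x u" "0 \<le> u" "a \<le> u" "u \<le> b" by (auto simp: A_def)
      then have "\<bar>x u\<bar> \<le> max (\<bar>x s\<bar> + 1) (\<bar>left_limit x s\<bar> + 1)" using that by (intro near) auto
      then show "norm z \<le> max (\<bar>x s\<bar> + 1) (\<bar>left_limit x s\<bar> + 1)" using u by simp
    qed
    then show ?case by (intro exI[of _ \<delta>] conjI \<delta>(1) allI impI) simp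
  qed
  then obtain R where R: "\<And>s. 0 \<le> s \<Longrightarrow> s \<le> T \<Longrightarrow> \<bar>x s\<bar> \<le> R"
    unfolding bounded_iff A_def by fastforce
  have "\<bar>left_limit x s\<bar> \<le> R" if "0 \<le> s" "s \<le> T" for s
  proof (cases "s = 0")
    case True
    then show ?thesis using R[of 0] that by (simp add: left_limit_def)
  next
    case False
    then have "0 < s" using that by simp
    show ?thesis
    proof (rule field_le_epsilon)
      fix e :: real assume "0 < e"
      obtain u where "0 \<le> u" "u < s" "\<bar>x u - left_limit x s\<bar> < e"
        using left_limit_approximable[OF assms(1) \<open>0 < s\<close> _ \<open>0 < e\<close>, of "-1"] \<open>0 < s\<close> by auto
      then show "\<bar>left_limit x s\<bar> \<le> R + e" using R[of u] that by auto
    qed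
  qed
  with R show ?thesis by (rule that)
qed

definition jump_set :: "(real \<Rightarrow> real) \<Rightarrow> real \<Rightarrow> real \<Rightarrow> real \<Rightarrow> real set" where
  "jump_set x h y T = {t. 0 \<le> t \<and> t \<le> T \<and> left_limit x t + h \<le> y \<and> y \<le> x t - h}"

lemma jump_count_eq_card: "jump_count x h y T = card (jump_set x h y T)"
  by (simp add: jump_count_def jump_set_def)

lemma jump_set_pos: "0 < h \<Longrightarrow> s \<in> jump_set x h y T \<Longrightarrow> 0 < s"
  by (cases "s = 0") (auto simp: jump_set_def left_limit_def)

text \<open>
  Near any time the path is close to one of its two one-sided limits there, so no other nearby time
  can carry a jump of size \<open>2 h\<close>.
\<close>

lemma jump_set_finite:
  assumes "cadlag x" "0 < h" "0 \<le> T"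
  shows "finite (jump_set x h y T)"
proof -
  define J where "J = jump_set x h y T"
  have "finite (J \<inter> {0..T})" using \<open>0 \<le> T\<close>
  proof (induction rule: Bolzano)
    case (trans a b c)
    then have "{a..c} = {a..b} \<union> {b..c}" by auto
    with trans show ?case by (auto simp: Int_Un_distrib)
  next
    case (local s)
    from cadlag_local_oscillation[OF assms(1) this(1), of "h/2"] assms(2)
    obtain \<delta> where \<delta>: "0 < \<delta>" "\<And>u. s \<le> u \<Longrightarrow> u < s + \<delta> \<Longrightarrow> \<bar>x u - x s\<bar> < h/2"
      "\<And>u. 0 \<le> u \<Longrightarrow> s - \<delta> < u \<Longrightarrow> u < s \<Longrightarrow> \<bar>x u - left_limit x s\<bar> < h/2"
      by (metis half_gt_zero)
    have "r = s" if r: "r \<in> J" "s - \<delta> < r" "r < s + \<delta>" for r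
    proof (rule ccontr)
      assume "r \<noteq> s"
      have "0 < r" using jump_set_pos[OF assms(2)] r(1) unfolding J_def by blast
      have gap: "2 * h \<le> x r - left_limit x r" using r(1) by (auto simp: jump_set_def J_def)
      show False
      proof (cases "r < s")
        case True
        obtain u where "0 \<le> u" "s - \<delta> < u" "u < r" "\<bar>x u - left_limit x r\<bar> < h/2"
          using left_limit_approximable[OF assms(1) \<open>0 < r\<close> r(2), of "h/2"] assms(2) by auto
        then have "\<bar>x u - left_limit x s\<bar> < h/2" "\<bar>x r - left_limit x s\<bar> < h/2" "\<bar>x u - left_limit x r\<bar> < h/2"
          using \<delta>(3)[of u] \<delta>(3)[of r] r(2) True \<open>0 < r\<close> by simp_all
        then show False using gap assms(2) by linarith
      next
        case False
        then have "s < r" using \<open>r \<noteq> s\<close> by simp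
        obtain u where "0 \<le> u" "s < u" "u < r" "\<bar>x u - left_limit x r\<bar> < h/2"
          using left_limit_approximable[OF assms(1) \<open>0 < r\<close> \<open>s < r\<close>, of "h/2"] assms(2) by auto
        then have "\<bar>x u - x s\<bar> < h/2" "\<bar>x r - x s\<bar> < h/2" "\<bar>x u - left_limit x r\<bar> < h/2"
          using \<delta>(2)[of u] \<delta>(2)[of r] r(3) \<open>s < r\<close> by simp_all
        then show False using gap assms(2) by linarith
      qed
    qed
    then have "J \<inter> {a..b} \<subseteq> {s}" if "a \<le> s \<and> s \<le> b \<and> b - a < \<delta>" for a b
      using that by force
    then show ?case
      by (intro exI[of _ \<delta>] conjI \<delta>(1) allI impI) (meson finite.emptyI finite_insert finite_subset)
  qed
  moreover have "J \<inter> {0..T} = J" by (auto simp: J_def jump_set_def)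
  ultimately show ?thesis unfolding J_def by simp
qed

definition grid_crossings :: "(real \<Rightarrow> real) \<Rightarrow> real \<Rightarrow> real \<Rightarrow> real \<Rightarrow> nat \<Rightarrow> nat set" where
  "grid_crossings x h y t n =
     {k\<in>{..<n}. x (t * real k / real n) \<le> y - h \<and> y + h \<le> x (t * real (Suc k) / real n)}"

lemma grid_cell_exists:
  assumes "0 < s" "s \<le> t" "0 < n"
  obtains k where "k < n" "t * real k / real n < s" "s \<le> t * real (Suc k) / real n"
proof -
  have "0 < t" using assms by simp
  define z where "z = s * real n / t"
  have z: "0 < z" "z \<le> real n" using assms \<open>0 < t\<close> by (auto simp: z_def divide_simps)
  define k where "k = nat \<lceil>z\<rceil> - 1"
  have c: "0 < \<lceil>z\<rceil>" using z by simp
  then have "real (Suc k) = of_int \<lceil>z\<rceil>" by (simp add: k_def Suc_diff_1)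
  then have k: "real k < z" "z \<le> real (Suc k)" using ceiling_correct[of z] by linarith+
  have "k < n" using k(1) z(2) by linarith
  moreover have "t * real k / real n < s" "s \<le> t * real (Suc k) / real n"
    using k assms \<open>0 < t\<close> unfolding z_def by (simp_all add: field_simps)
  ultimately show ?thesis by (rule that)
qed

lemma grid_cell_unique:
  assumes "0 < t" "t * real k / real n < s" "s \<le> t * real (Suc k) / real n"
    "t * real l / real n < s" "s \<le> t * real (Suc l) / real n"
  shows "k = l"
proof -
  have "0 < n" using assms by (cases n) auto
  have "t * real k / real n < t * real (Suc l) / real n" "t * real l / real n < t * real (Suc k) / real n"
    using assms by linarith+
  then have "real k < real (Suc l)" "real l < real (Suc k)"
    using assms(1) \<open>0 < n\<close> by (simp_all add: divide_less_cancel del: of_nat_Suc)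
  then show ?thesis by linarith
qed

lemma grid_mesh: "t * real (Suc k) / real n = t * real k / real n + t / real n"
  by (simp add: algebra_simps add_divide_distrib)

lemma eventually_mesh_less:
  fixes t \<delta> :: real
  assumes "0 < \<delta>"
  shows "\<forall>\<^sub>F n in sequentially. 0 < n \<and> t / real n < \<delta>"
proof -
  have "(\<lambda>n. t / real n) \<longlonglongrightarrow> 0" by (rule lim_const_over_n)
  from order_tendstoD(2)[OF this assms] eventually_gt_at_top[of 0]
  show ?thesis by eventually_elim simp
qed

text \<open>
  The cell that contains a jump time eventually has its end points just before and after the jump,
  where the path takes approximately the values of its one-sided limits. The approximation is why \<open>h\<close> has to be
  strictly smaller than \<open>h'\<close>.
\<close>

lemma jump_count_le_grid_crossings:
  assumes x: "cadlag x" and "0 < t" "0 < h" "h < h'"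
  shows "\<forall>\<^sub>F n in sequentially. jump_count x h' y t \<le> card (grid_crossings x h y t n)"
proof -
  define S where "S = jump_set x h' y t"
  have fin: "finite S" unfolding S_def using assms by (intro jump_set_finite) auto
  have S: "0 < s" "s \<le> t" "left_limit x s + h' \<le> y" "y \<le> x s - h'" if "s \<in> S" for s
    using that jump_set_pos[of h' s x y t] assms by (auto simp: S_def jump_set_def)
  have "\<exists>\<delta>>0. (\<forall>u. s \<le> u \<and> u < s + \<delta> \<longrightarrow> \<bar>x u - x s\<bar> < h' - h) \<and>
      (\<forall>u. 0 \<le> u \<and> s - \<delta> < u \<and> u < s \<longrightarrow> \<bar>x u - left_limit x s\<bar> < h' - h)" if "s \<in> S" for s
    using cadlag_local_oscillation[OF x less_imp_le[OF S(1)[OF that]], of "h' - h"] \<open>h < h'\<close>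
    by (metis diff_gt_0_iff_gt)
  then obtain \<delta> where \<delta>: "\<And>s. s \<in> S \<Longrightarrow> 0 < \<delta> s"
    "\<And>s u. s \<in> S \<Longrightarrow> s \<le> u \<Longrightarrow> u < s + \<delta> s \<Longrightarrow> \<bar>x u - x s\<bar> < h' - h"
    "\<And>s u. s \<in> S \<Longrightarrow> 0 \<le> u \<Longrightarrow> s - \<delta> s < u \<Longrightarrow> u < s \<Longrightarrow> \<bar>x u - left_limit x s\<bar> < h' - h"
    by metis
  have "\<forall>\<^sub>F n in sequentially. \<forall>s\<in>S. 0 < n \<and> t / real n < \<delta> s"
    using fin \<delta>(1) by (intro eventually_ball_finite eventually_mesh_less ballI) auto
  with eventually_gt_at_top[of 0] show ?thesis
  proof eventually_elim
    case (elim n)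
    have "\<exists>k. k < n \<and> t * real k / real n < s \<and> s \<le> t * real (Suc k) / real n" if "s \<in> S" for s
      using grid_cell_exists[OF S(1,2)[OF that] elim(1)] by metis
    then obtain c where c: "\<And>s. s \<in> S \<Longrightarrow> c s < n" "\<And>s. s \<in> S \<Longrightarrow> t * real (c s) / real n < s"
      "\<And>s. s \<in> S \<Longrightarrow> s \<le> t * real (Suc (c s)) / real n" by metis
    \<comment> \<open>Two jumps in one cell are impossible: just before the second one the path would be low again,
      although the first one left it high.\<close>
    have "inj_on c S"
    proof (rule linorder_inj_onI')
      fix r s assume rs: "r \<in> S" "s \<in> S" "r < s"
      show "c r \<noteq> c s"
      proof
        assume eq: "c r = c s"
        then have "s - \<delta> s < r"
          using c(2)[OF rs(1)] c(3)[OF rs(2)] elim(2) rs(2) grid_mesh[of t "c s" n] by fastforce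
        then have "\<bar>x r - left_limit x s\<bar> < h' - h" using \<delta>(3)[OF rs(2)] S(1)[OF rs(1)] rs(3) by simp
        then show False using S(3)[OF rs(2)] S(4)[OF rs(1)] assms by linarith
      qed
    qed
    moreover have "c ` S \<subseteq> grid_crossings x h y t n"
    proof
      fix k assume "k \<in> c ` S"
      then obtain s where s: "s \<in> S" "k = c s" by auto
      have m: "t * real (Suc k) / real n < t * real k / real n + \<delta> s"
        using elim(2) s grid_mesh[of t k n] by simp
      have "\<bar>x (t * real k / real n) - left_limit x s\<bar> < h' - h"
        using \<delta>(3)[OF s(1), of "t * real k / real n"] c(2,3)[OF s(1)] m s(2) assms by simp
      moreover have "\<bar>x (t * real (Suc k) / real n) - x s\<bar> < h' - h"
        using \<delta>(2)[OF s(1), of "t * real (Suc k) / real n"] c(2,3)[OF s(1)] m s(2) by simp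
      ultimately show "k \<in> grid_crossings x h y t n"
        using c(1)[OF s(1)] S(3,4)[OF s(1)] s(2) by (auto simp: grid_crossings_def)
    qed
    ultimately show ?case
      unfolding jump_count_eq_card S_def[symmetric]
      by (intro card_inj_on_le[of c]) (auto simp: grid_crossings_def)
  qed
qed

text \<open>
  A short interval over which the path climbs from below \<open>y - h\<close> to above \<open>y + h\<close> contains a jump
  of the kind that is counted: otherwise such intervals would accumulate at a point where the
  one-sided limits forbid them.
\<close>

lemma short_crossing_contains_jump:
  assumes x: "cadlag x" and "0 < h" "0 \<le> t"
  obtains \<delta> where "0 < \<delta>"
    "\<And>u v. 0 \<le> u \<Longrightarrow> u \<le> v \<Longrightarrow> v \<le> t \<Longrightarrow> v - u < \<delta> \<Longrightarrow> x u \<le> y - h \<Longrightarrow> y + h \<le> x v \<Longrightarrow>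
      \<exists>s\<in>jump_set x h y t. u < s \<and> s \<le> v"
proof -
  have "\<exists>\<delta>>0. \<forall>u v. 0 \<le> u \<and> u \<le> v \<and> {u..v} \<subseteq> ball s \<delta> \<and> x u \<le> y - h \<and> y + h \<le> x v \<longrightarrow>
      s \<in> jump_set x h y t \<and> u < s \<and> s \<le> v" if s: "s \<in> {0..t}" for s
  proof -
    \<comment> \<open>So small that nearby values stay on the same side of \<open>y - h\<close> and \<open>y + h\<close> as the one-sided
      limits, unless \<open>s\<close> is itself one of the jumps counted.\<close>
    define \<epsilon> where "\<epsilon> = min h (min (if y - h < left_limit x s then left_limit x s - (y - h) else 1)
      (if x s < y + h then (y + h) - x s else 1))"
    have \<epsilon>: "0 < \<epsilon>" "\<epsilon> \<le> h" "y - h < left_limit x s \<Longrightarrow> \<epsilon> \<le> left_limit x s - (y - h)"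
      "x s < y + h \<Longrightarrow> \<epsilon> \<le> (y + h) - x s"
      using \<open>0 < h\<close> by (auto simp: \<epsilon>_def)
    obtain \<delta> where \<delta>: "0 < \<delta>" "\<And>u. s \<le> u \<Longrightarrow> u < s + \<delta> \<Longrightarrow> \<bar>x u - x s\<bar> < \<epsilon>"
      "\<And>u. 0 \<le> u \<Longrightarrow> s - \<delta> < u \<Longrightarrow> u < s \<Longrightarrow> \<bar>x u - left_limit x s\<bar> < \<epsilon>"
      using cadlag_local_oscillation[OF x _ \<epsilon>(1)] s by (metis atLeastAtMost_iff)
    show ?thesis
    proof (intro exI[of _ \<delta>] conjI \<delta>(1) allI impI; elim conjE)
      fix u v assume uv: "0 \<le> u" "u \<le> v" "{u..v} \<subseteq> ball s \<delta>" "x u \<le> y - h" "y + h \<le> x v"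
      have "u \<in> ball s \<delta>" "v \<in> ball s \<delta>" using uv by auto
      then have b: "s - \<delta> < u" "u < s + \<delta>" "s - \<delta> < v" "v < s + \<delta>" by (auto simp: dist_real_def)
      show "u < s"
      proof (rule ccontr)
        assume "\<not> u < s"
        then show False using \<delta>(2)[of u] \<delta>(2)[of v] b uv \<epsilon>(1,2) by auto
      qed
      show "s \<le> v"
      proof (rule ccontr)
        assume "\<not> s \<le> v"
        then show False using \<delta>(3)[of u] \<delta>(3)[of v] b uv \<epsilon>(1,2) by auto
      qed
      have "left_limit x s \<le> y - h"
        using \<delta>(3)[of u] \<epsilon>(3) b uv \<open>u < s\<close> by (cases "y - h < left_limit x s") auto
      moreover have "y + h \<le> x s"
        using \<delta>(2)[of v] \<epsilon>(4) b uv \<open>s \<le> v\<close> by (cases "x s < y + h") auto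
      ultimately show "s \<in> jump_set x h y t" using s by (auto simp: jump_set_def)
    qed
  qed
  then obtain \<delta> where \<delta>: "\<And>s. s \<in> {0..t} \<Longrightarrow> 0 < \<delta> s"
    "\<And>s u v. s \<in> {0..t} \<Longrightarrow> 0 \<le> u \<Longrightarrow> u \<le> v \<Longrightarrow> {u..v} \<subseteq> ball s (\<delta> s) \<Longrightarrow> x u \<le> y - h \<Longrightarrow> y + h \<le> x v \<Longrightarrow>
      s \<in> jump_set x h y t \<and> u < s \<and> s \<le> v"
    by metis
  define \<C> where "\<C> = (\<lambda>s. ball s (\<delta> s)) ` {0..t}"
  have "\<C> \<noteq> {}" using \<open>0 \<le> t\<close> by (auto simp: \<C>_def)
  moreover have "{0..t} \<subseteq> \<Union>\<C>" using \<delta>(1) by (auto simp: \<C>_def)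
  moreover have "open B" if "B \<in> \<C>" for B using that by (auto simp: \<C>_def)
  ultimately obtain d where d: "0 < d" "\<And>T. T \<subseteq> {0..t} \<Longrightarrow> diameter T < d \<Longrightarrow> \<exists>B\<in>\<C>. T \<subseteq> B"
    using Lebesgue_number_lemma[of "{0..t}" \<C>] by (metis compact_Icc)
  show ?thesis
  proof (rule that[OF d(1)])
    fix u v assume uv: "0 \<le> u" "u \<le> v" "v \<le> t" "v - u < d" "x u \<le> y - h" "y + h \<le> x v"
    have "\<exists>B\<in>\<C>. {u..v} \<subseteq> B" using uv by (intro d(2)) (auto simp: diameter_closed_interval)
    then obtain s where "s \<in> {0..t}" "{u..v} \<subseteq> ball s (\<delta> s)" by (auto simp: \<C>_def)
    with \<delta>(2)[of s u v] uv show "\<exists>s\<in>jump_set x h y t. u < s \<and> s \<le> v" by blast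
  qed
qed

lemma grid_crossings_le_jump_count:
  assumes x: "cadlag x" and "0 < t" "0 < h"
  shows "\<forall>\<^sub>F n in sequentially. card (grid_crossings x h y t n) \<le> jump_count x h y t"
proof -
  obtain \<delta> where \<delta>: "0 < \<delta>"
    "\<And>u v. 0 \<le> u \<Longrightarrow> u \<le> v \<Longrightarrow> v \<le> t \<Longrightarrow> v - u < \<delta> \<Longrightarrow> x u \<le> y - h \<Longrightarrow> y + h \<le> x v \<Longrightarrow>
      \<exists>s\<in>jump_set x h y t. u < s \<and> s \<le> v"
    using short_crossing_contains_jump[OF x \<open>0 < h\<close>, of t y] \<open>0 < t\<close> by (metis less_imp_le)
  from eventually_mesh_less[OF \<delta>(1), of t] show ?thesis
  proof eventually_elim
    case (elim n)
    have "\<exists>s\<in>jump_set x h y t. t * real k / real n < s \<and> s \<le> t * real (Suc k) / real n"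
      if "k \<in> grid_crossings x h y t n" for k
    proof (rule \<delta>(2))
      have "real (Suc k) \<le> real n" using that by (auto simp: grid_crossings_def)
      then show "t * real (Suc k) / real n \<le> t" using elim \<open>0 < t\<close> by (simp add: divide_le_eq)
    qed (use that elim \<open>0 < t\<close> grid_mesh[of t k n] in \<open>auto simp: grid_crossings_def\<close>)
    then obtain f where f: "\<And>k. k \<in> grid_crossings x h y t n \<Longrightarrow> f k \<in> jump_set x h y t"
      "\<And>k. k \<in> grid_crossings x h y t n \<Longrightarrow> t * real k / real n < f k"
      "\<And>k. k \<in> grid_crossings x h y t n \<Longrightarrow> f k \<le> t * real (Suc k) / real n"
      by metis
    have "inj_on f (grid_crossings x h y t n)"
      using f(2,3) grid_cell_unique[OF \<open>0 < t\<close>] by (intro inj_onI) metis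
    moreover have "finite (jump_set x h y t)" using assms by (intro jump_set_finite) auto
    ultimately show ?case unfolding jump_count_eq_card
      using f(1) by (intro card_inj_on_le[of f]) auto
  qed
qed

section \<open>Riemann sums along a path\<close>

text \<open>
  Sampling at the right end point of each cell makes the step functions converge at every time,
  because the path is continuous from the right; left end points would fail at the jumps.
\<close>

definition right_sample :: "(real \<Rightarrow> real) \<Rightarrow> real \<Rightarrow> nat \<Rightarrow> real \<Rightarrow> real" where
  "right_sample f t n s =
     (\<Sum>k<n. f (t * real (Suc k) / real n) * indicator {t * real k / real n<..t * real (Suc k) / real n} s)"

lemma right_sample_measurable[measurable]: "right_sample f t n \<in> borel_measurable borel"
  unfolding right_sample_def by measurable

lemma right_sample_inside:
  assumes "0 < s" "s \<le> t" "0 < n"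
  obtains r where "s \<le> r" "r < s + t / real n" "right_sample f t n s = f r"
proof -
  obtain k where k: "k < n" "t * real k / real n < s" "s \<le> t * real (Suc k) / real n"
    by (rule grid_cell_exists[OF assms])
  have "right_sample f t n s = (\<Sum>l<n. if l = k then f (t * real (Suc k) / real n) else 0)"
    unfolding right_sample_def
  proof (rule sum.cong)
    fix l assume "l \<in> {..<n}"
    show "f (t * real (Suc l) / real n) * indicator {t * real l / real n<..t * real (Suc l) / real n} s
        = (if l = k then f (t * real (Suc k) / real n) else 0)"
    proof (cases "l = k")
      case True
      then show ?thesis using k by (simp del: of_nat_Suc)
    next
      case False
      have "s \<notin> {t * real l / real n<..t * real (Suc l) / real n}"
      proof
        assume s: "s \<in> {t * real l / real n<..t * real (Suc l) / real n}"
        have "l = k"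
          by (rule grid_cell_unique[OF _ _ _ k(2,3)]) (use s assms in \<open>simp_all del: of_nat_Suc\<close>)
        with False show False by simp
      qed
      then show ?thesis using False by (simp del: of_nat_Suc)
    qed
  qed simp
  also have "\<dots> = f (t * real (Suc k) / real n)" using k(1) by simp
  finally show ?thesis using k grid_mesh[of t k n] by (intro that[of "t * real (Suc k) / real n"]) auto
qed

lemma right_sample_outside:
  assumes "s \<notin> {0<..t}" "0 < t"
  shows "right_sample f t n s = 0"
  unfolding right_sample_def
proof (intro sum.neutral ballI)
  fix k assume k: "k \<in> {..<n}"
  then have "real (Suc k) \<le> real n" by simp
  then have "t * real (Suc k) / real n \<le> t" using k \<open>0 < t\<close> by (simp add: divide_le_eq)
  moreover have "0 \<le> t * real k / real n" using \<open>0 < t\<close> by simp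
  ultimately have "s \<notin> {t * real k / real n<..t * real (Suc k) / real n}" using assms(1) by force
  then show "f (t * real (Suc k) / real n) * indicator {t * real k / real n<..t * real (Suc k) / real n} s = 0"
    by simp
qed

lemma right_sample_tendsto:
  assumes x: "cadlag x" and "0 < t" and g: "0 < s \<Longrightarrow> s \<le> t \<Longrightarrow> isCont g (x s)"
  shows "(\<lambda>n. right_sample (\<lambda>r. g (x r)) t n s) \<longlonglongrightarrow> indicator {0<..t} s * g (x s)"
proof (cases "s \<in> {0<..t}")
  case True
  then have s: "0 < s" "s \<le> t" by auto
  show ?thesis
  proof (rule LIMSEQ_I)
    fix e :: real assume "0 < e"
    then obtain d where d: "0 < d" "\<And>z. \<bar>z - x s\<bar> < d \<Longrightarrow> \<bar>g z - g (x s)\<bar> < e"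
      using g[OF s] unfolding isCont_def LIM_def by (metis dist_real_def abs_zero diff_self)
    obtain \<delta> where \<delta>: "0 < \<delta>" "\<And>u. s \<le> u \<Longrightarrow> u < s + \<delta> \<Longrightarrow> \<bar>x u - x s\<bar> < d"
      by (rule cadlag_local_oscillation[OF x less_imp_le[OF s(1)] d(1)]) blast
    obtain n0 where n0: "\<And>n. n0 \<le> n \<Longrightarrow> 0 < n \<and> t / real n < \<delta>"
      using eventually_mesh_less[OF \<delta>(1), of t] unfolding eventually_sequentially by blast
    show "\<exists>no. \<forall>n\<ge>no. norm (right_sample (\<lambda>r. g (x r)) t n s - indicator {0<..t} s * g (x s)) < e"
    proof (intro exI[of _ n0] allI impI)
      fix n assume "n0 \<le> n"
      obtain r where "s \<le> r" "r < s + t / real n" "right_sample (\<lambda>r. g (x r)) t n s = g (x r)"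
        using right_sample_inside[OF s, of n "\<lambda>r. g (x r)"] n0[OF \<open>n0 \<le> n\<close>] by blast
      then show "norm (right_sample (\<lambda>r. g (x r)) t n s - indicator {0<..t} s * g (x s)) < e"
        using d(2)[of "x r"] \<delta>(2)[of r] n0[OF \<open>n0 \<le> n\<close>] True by simp
    qed
  qed
qed (simp add: right_sample_outside[OF _ \<open>0 < t\<close>])

lemma cadlag_measurable:
  assumes "cadlag x" "0 < t"
  shows "(\<lambda>s. indicator {0<..t} s * x s) \<in> borel_measurable borel"
proof (rule borel_measurable_LIMSEQ_real)
  show "(\<lambda>n. right_sample x t n s) \<longlonglongrightarrow> indicator {0<..t} s * x s" for s
    using right_sample_tendsto[OF assms, of s "\<lambda>z. z"] by simp
qed measurable

text \<open>
  The step functions of the right samples are bounded and converge almost everywhere, so dominated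
  convergence applies to their integrals.
\<close>

lemma riemann_sum_tendsto:
  assumes x: "cadlag x" and "0 < t" and g[measurable]: "g \<in> borel_measurable borel"
    and B: "\<And>z. \<bar>g z\<bar> \<le> B"
    and cont: "AE s in lborel. 0 < s \<and> s \<le> t \<longrightarrow> isCont g (x s)"
  shows "(\<lambda>n. t / real n * (\<Sum>k<n. g (x (t * real k / real n)))) \<longlonglongrightarrow> (LINT s:{0..t}|lborel. g (x s))"
proof -
  have [measurable]: "(\<lambda>s. indicator {0<..t} s * x s) \<in> borel_measurable borel"
    by (rule cadlag_measurable[OF x \<open>0 < t\<close>])
  have eq: "indicator {0<..t} s * g (x s) = indicator {0<..t} s * g (indicator {0<..t} s * x s)" for s
    by (simp add: indicator_def)
  have m[measurable]: "(\<lambda>s. indicator {0<..t} s * g (x s)) \<in> borel_measurable borel"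
    unfolding eq by measurable
  have eq0: "indicator {0..t} s *\<^sub>R g (x s) = indicator {0<..t} s * g (x s) + indicator {0} s * g (x 0)" for s
    using \<open>0 < t\<close> by (auto simp: indicator_def)
  have "(LINT s:{0..t}|lborel. g (x s)) = (\<integral>s. indicator {0<..t} s * g (x s) \<partial>lborel)"
    unfolding set_lebesgue_integral_def eq0
  proof (rule integral_cong_AE)
    show "AE s in lborel. indicator {0<..t} s * g (x s) + indicator {0} s * g (x 0) = indicator {0<..t} s * g (x s)"
      using AE_lborel_singleton[of "0::real"] by eventually_elim simp
  qed simp_all
  moreover have "(\<lambda>n. \<integral>s. right_sample (\<lambda>r. g (x r)) t n s \<partial>lborel) \<longlonglongrightarrow> (\<integral>s. indicator {0<..t} s * g (x s) \<partial>lborel)"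
  proof (rule integral_dominated_convergence)
    show "integrable lborel (\<lambda>s. B * indicator {0<..t} s)"
      using \<open>0 < t\<close> by (intro integrable_mult_right integrable_real_indicator) auto
    show "AE s in lborel. (\<lambda>n. right_sample (\<lambda>r. g (x r)) t n s) \<longlonglongrightarrow> indicator {0<..t} s * g (x s)"
      using cont by eventually_elim (rule right_sample_tendsto[OF x \<open>0 < t\<close>], simp)
    show "AE s in lborel. norm (right_sample (\<lambda>r. g (x r)) t n s) \<le> B * indicator {0<..t} s" for n
    proof (rule AE_I2)
      fix s
      show "norm (right_sample (\<lambda>r. g (x r)) t n s) \<le> B * indicator {0<..t} s"
      proof (cases "s \<in> {0<..t} \<and> 0 < n")
        case True
        then have s: "0 < s" "s \<le> t" "0 < n" by auto
        obtain r where "right_sample (\<lambda>r. g (x r)) t n s = g (x r)"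
          by (rule right_sample_inside[OF s, of "\<lambda>r. g (x r)"])
        then show ?thesis using B[of "x r"] True by simp
      next
        case False
        have "0 \<le> B" using B[of 0] by simp
        then show ?thesis using False right_sample_outside[OF _ \<open>0 < t\<close>, of s "\<lambda>r. g (x r)" n]
          by (cases "n = 0") (auto simp: right_sample_def)
      qed
    qed
  qed (simp_all add: m)
  moreover have "(\<integral>s. right_sample (\<lambda>r. g (x r)) t n s \<partial>lborel) = t / real n * (\<Sum>k<n. g (x (t * real (Suc k) / real n)))" for n
  proof -
    have "(\<integral>s. right_sample (\<lambda>r. g (x r)) t n s \<partial>lborel) = (\<Sum>k<n. g (x (t * real (Suc k) / real n)) * (t / real n))"
      unfolding right_sample_def
    proof (subst Bochner_Integration.integral_sum)
      show "(\<Sum>k<n. \<integral>s. g (x (t * real (Suc k) / real n)) * indicator {t * real k / real n<..t * real (Suc k) / real n} s \<partial>lborel)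
        = (\<Sum>k<n. g (x (t * real (Suc k) / real n)) * (t / real n))"
      proof (rule sum.cong[OF refl])
        fix k
        have I: "(\<integral>s. c * indicator {a<..b} s \<partial>lborel) = c * (b - a)" if "a \<le> b" for a b c :: real
          using that by simp
        show "(\<integral>s. g (x (t * real (Suc k) / real n)) * indicator {t * real k / real n<..t * real (Suc k) / real n} s \<partial>lborel)
          = g (x (t * real (Suc k) / real n)) * (t / real n)"
          unfolding grid_mesh by (subst I) (use \<open>0 < t\<close> in simp_all)
      qed
      show "integrable lborel (\<lambda>s. g (x (t * real (Suc k) / real n)) * indicator {t * real k / real n<..t * real (Suc k) / real n} s)" for k
        using \<open>0 < t\<close> unfolding grid_mesh by (intro integrable_mult_right integrable_real_indicator) simp_all
    qed
    then show ?thesis by (metis sum_distrib_left sum_distrib_right mult.commute)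
  qed
  ultimately have right: "(\<lambda>n. t / real n * (\<Sum>k<n. g (x (t * real (Suc k) / real n)))) \<longlonglongrightarrow> (LINT s:{0..t}|lborel. g (x s))"
    by simp
  \<comment> \<open>Left and right Riemann sums differ by two boundary terms.\<close>
  have "(\<lambda>n. t / real n * (g (x t) - g (x 0))) \<longlonglongrightarrow> 0 * (g (x t) - g (x 0))"
    by (intro tendsto_mult tendsto_const lim_const_over_n)
  from tendsto_diff[OF right this]
  have "(\<lambda>n. t / real n * (\<Sum>k<n. g (x (t * real (Suc k) / real n))) - t / real n * (g (x t) - g (x 0)))
    \<longlonglongrightarrow> (LINT s:{0..t}|lborel. g (x s))" by simp
  then show ?thesis
  proof (rule Lim_transform_eventually)
    show "\<forall>\<^sub>F n in sequentially. t / real n * (\<Sum>k<n. g (x (t * real (Suc k) / real n))) - t / real n * (g (x t) - g (x 0))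
      = t / real n * (\<Sum>k<n. g (x (t * real k / real n)))"
      using eventually_gt_at_top[of 0]
    proof eventually_elim
      case (elim n)
      have "(\<Sum>k<n. g (x (t * real (Suc k) / real n)) - g (x (t * real k / real n)))
        = g (x (t * real n / real n)) - g (x (t * real 0 / real n))"
        by (rule sum_lessThan_telescope)
      then have "(\<Sum>k<n. g (x (t * real (Suc k) / real n))) - (g (x t) - g (x 0))
        = (\<Sum>k<n. g (x (t * real k / real n)))"
        using elim by (simp add: sum_subtractf)
      then show ?case by (simp only: right_diff_distrib[symmetric])
    qed
  qed
qed

section \<open>Deviation of the jump count from its compensator\<close>

locale stable_local_time = spectrally_positive_stable_process M X "1 + \<alpha>"
  for M :: "'a measure" and X :: "real \<Rightarrow> 'a \<Rightarrow> real" and \<alpha> :: real +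
  fixes L :: "real \<Rightarrow> real \<Rightarrow> 'a \<Rightarrow> real"
  assumes alpha: "0 < \<alpha>" "\<alpha> < 1"
    and laplace_exponent: "has_laplace_exponent M X (\<lambda>\<eta>. \<eta> powr (1 + \<alpha>))"
    and local_times: "jointly_continuous_local_times M X L"
begin

definition tail_const :: real where
  "tail_const = \<alpha> / Gamma (1 - \<alpha>)"

lemma tail_const_pos: "0 < tail_const"
  using alpha by (simp add: tail_const_def Gamma_real_pos)

lemma stable_law_X1: "stable_law (distr M borel (X 1)) \<alpha>"
proof -
  have [measurable]: "X 1 \<in> borel_measurable M" by (rule measurable_X) simp
  interpret N: prob_space "distr M borel (X 1)" by (rule prob_space_distr) simp
  show ?thesis
  proof
    fix \<eta> :: real assume "0 \<le> \<eta>"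
    then show "(\<integral>x. exp (- \<eta> * x) \<partial>distr M borel (X 1)) = exp (\<eta> powr (1 + \<alpha>))"
      using laplace_exponent unfolding has_laplace_exponent_def by (simp add: integral_distr)
  qed (use alpha in auto)
qed

lemma tail_prob_scaling:
  assumes "0 < s"
  shows "tail_prob s u = measure (distr M borel (X 1)) {u * s powr (- 1 / (1 + \<alpha>))..}"
proof -
  let ?P = "Pi\<^sub>M {1::real} (\<lambda>_. borel :: real measure)"
  define c where "c = s powr (1 / (1 + \<alpha>))"
  have "0 < c" using assms by (simp add: c_def)
  have [measurable]: "X 1 \<in> borel_measurable M" "X s \<in> borel_measurable M"
    using assms by (auto intro: measurable_X)
  define A where "A = (\<lambda>f. f (1::real)) -` {u..} \<inter> space ?P"
  have [measurable]: "A \<in> sets ?P" unfolding A_def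
    by (rule measurable_sets[OF measurable_component_singleton]) auto
  have "measure (distr M ?P (\<lambda>\<omega>. \<lambda>t\<in>{1}. X (s * t) \<omega>)) A = measure (distr M ?P (\<lambda>\<omega>. \<lambda>t\<in>{1}. c * X t \<omega>)) A"
    using scaling[of s "{1}"] assms by (simp add: c_def)
  moreover have "measure (distr M ?P (\<lambda>\<omega>. \<lambda>t\<in>{1}. X (s * t) \<omega>)) A = prob {\<omega>\<in>space M. u \<le> X s \<omega>}"
    by (subst measure_distr) (auto intro!: measurable_restrict arg_cong[where f=prob] simp: A_def space_PiM)
  moreover have "measure (distr M ?P (\<lambda>\<omega>. \<lambda>t\<in>{1}. c * X t \<omega>)) A = prob {\<omega>\<in>space M. u \<le> c * X 1 \<omega>}"
    by (subst measure_distr) (auto intro!: measurable_restrict arg_cong[where f=prob] simp: A_def space_PiM)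
  moreover have "{\<omega>\<in>space M. u \<le> c * X 1 \<omega>} = {\<omega>\<in>space M. u / c \<le> X 1 \<omega>}"
    using \<open>0 < c\<close> by (simp add: field_simps)
  ultimately have "tail_prob s u = measure (distr M borel (X 1)) {u / c..}"
    using tail_prob_eq_distr[of 1 "u / c"] unfolding tail_prob_def by simp
  then show ?thesis by (simp add: c_def powr_minus divide_inverse)
qed

text \<open>
  Scaling turns the tail asymptotics of \<open>X 1\<close> at infinity into the rate of jumps over short times,
  uniformly over jump sizes bounded away from \<open>0\<close>.
\<close>

lemma tail_prob_rate_uniform:
  assumes "0 < c" "0 < e"
  shows "\<forall>\<^sub>F s in at_right 0. \<forall>u\<ge>c. \<bar>tail_prob s u - s * (tail_const * u powr (-(1+\<alpha>)))\<bar> \<le> s * e"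
proof -
  interpret N: stable_law "distr M borel (X 1)" \<alpha> by (rule stable_law_X1)
  define e' where "e' = e * c powr (1+\<alpha>)"
  have "0 < e'" using assms by (simp add: e'_def)
  have "\<forall>\<^sub>F v in at_top. dist (v powr (1+\<alpha>) * measure (distr M borel (X 1)) {v..}) tail_const < e'"
    by (rule tendstoD[OF N.tail_asymptotics[folded tail_const_def] \<open>0 < e'\<close>])
  then obtain v0 where v0: "\<And>v. v0 \<le> v \<Longrightarrow> \<bar>v powr (1+\<alpha>) * measure (distr M borel (X 1)) {v..} - tail_const\<bar> < e'"
    unfolding eventually_at_top_linorder by (auto simp: dist_real_def)
  have "filterlim (\<lambda>s. c * s powr (- 1 / (1+\<alpha>))) at_top (at_right 0)"
    using alpha assms by real_asymp
  then have "\<forall>\<^sub>F s in at_right 0. v0 \<le> c * s powr (- 1 / (1+\<alpha>))"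
    unfolding filterlim_at_top by blast
  then show ?thesis using eventually_at_right_less[of 0]
  proof eventually_elim
    case (elim s)
    show ?case
    proof (intro allI impI)
      fix u assume "c \<le> u"
      then have "0 < u" using assms by simp
      define v where "v = u * s powr (- 1 / (1+\<alpha>))"
      define m where "m = measure (distr M borel (X 1)) {v..}"
      have "c * s powr (- 1 / (1+\<alpha>)) \<le> v" unfolding v_def using \<open>c \<le> u\<close> by (intro mult_right_mono) auto
      then have m: "\<bar>v powr (1+\<alpha>) * m - tail_const\<bar> < e'" unfolding m_def using elim(1) by (intro v0) simp
      have "v powr (1+\<alpha>) = u powr (1+\<alpha>) * s powr (- 1 / (1+\<alpha>) * (1+\<alpha>))"
        unfolding v_def using \<open>0 < u\<close> by (simp only: powr_mult powr_powr)
      also have "- 1 / (1+\<alpha>) * (1+\<alpha>) = -1" using alpha by simp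
      finally have v: "v powr (1+\<alpha>) = u powr (1+\<alpha>) / s" using elim(2) by (simp add: powr_minus divide_inverse)
      have uu: "u powr (1+\<alpha>) * u powr (-(1+\<alpha>)) = 1" using \<open>0 < u\<close> by (simp add: powr_add[symmetric])
      have "m = s * u powr (-(1+\<alpha>)) * (v powr (1+\<alpha>) * m)"
        unfolding v using uu elim(2) by (simp add: field_simps)
      then have "tail_prob s u - s * (tail_const * u powr (-(1+\<alpha>))) = s * u powr (-(1+\<alpha>)) * (v powr (1+\<alpha>) * m - tail_const)"
        using tail_prob_scaling[OF elim(2), of u] unfolding v_def[symmetric] m_def[symmetric]
        by (simp add: right_diff_distrib mult_ac)
      then have "\<bar>tail_prob s u - s * (tail_const * u powr (-(1+\<alpha>)))\<bar> = s * u powr (-(1+\<alpha>)) * \<bar>v powr (1+\<alpha>) * m - tail_const\<bar>"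
        using elim(2) by (simp add: abs_mult)
      also have "\<dots> \<le> s * c powr (-(1+\<alpha>)) * e'"
        using m \<open>c \<le> u\<close> assms elim(2) alpha by (intro mult_mono powr_mono2') auto
      also have "\<dots> = s * e" unfolding e'_def using assms by (simp add: powr_add[symmetric])
      finally show "\<bar>tail_prob s u - s * (tail_const * u powr (-(1+\<alpha>)))\<bar> \<le> s * e" .
    qed
  qed
qed

text \<open>
  The rate at which jumps over both \<open>y - h\<close> and \<open>y + h\<close> occur while the path is at \<open>z\<close>: the tail of the
  Levy measure beyond \<open>y + h - z\<close>.
\<close>

definition jump_rate :: "real \<Rightarrow> real \<Rightarrow> real \<Rightarrow> real" where
  "jump_rate h y z = (if z \<le> y - h then tail_const * (y + h - z) powr (-(1+\<alpha>)) else 0)"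

lemma jump_rate_measurable[measurable]: "jump_rate h y \<in> borel_measurable borel"
  unfolding jump_rate_def by measurable

lemma jump_rate_bounded:
  assumes "0 < h"
  shows "\<bar>jump_rate h y z\<bar> \<le> tail_const * (2 * h) powr (-(1+\<alpha>))"
proof -
  have "(y + h - z) powr (-(1+\<alpha>)) \<le> (2 * h) powr (-(1+\<alpha>))" if "z \<le> y - h"
    using that assms alpha by (intro powr_mono2') auto
  then show ?thesis using tail_const_pos by (auto simp: jump_rate_def abs_mult intro!: mult_left_mono simp del: minus_add_distrib)
qed

lemma jump_rate_isCont:
  assumes "0 < h" "z \<noteq> y - h"
  shows "isCont (jump_rate h y) z"
proof (cases "z < y - h")
  case True
  have "\<forall>\<^sub>F w in nhds z. jump_rate h y w = tail_const * (y + h - w) powr (-(1+\<alpha>))"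
    using eventually_nhds_in_open[of "{..<y-h}" z] True by (auto elim!: eventually_mono simp: jump_rate_def)
  moreover have "isCont (\<lambda>w. tail_const * (y + h - w) powr (-(1+\<alpha>))) z"
    using True assms by (intro continuous_intros) auto
  ultimately show ?thesis 
    using isCont_cong[of "jump_rate h y" "\<lambda>w. tail_const * (y + h - w) powr (-(1+\<alpha>))" z] by blast
next
  case False
  then have "y - h < z" using assms by simp
  then have const: "\<forall>\<^sub>F w in nhds z. jump_rate h y w = 0"
    using eventually_nhds_in_open[of "{y-h<..}" z] by (auto elim!: eventually_mono simp: jump_rate_def)
  show ?thesis unfolding isCont_cong[OF const] by (rule continuous_const)
qed

text \<open>
  The time integral of the jump rate along the path, written as a space integral against the local time.
\<close>

definition compensator :: "real \<Rightarrow> real \<Rightarrow> real \<Rightarrow> 'a \<Rightarrow> real" where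
  "compensator h y t \<omega> = (LINT z|lborel. jump_rate h y z * L z t \<omega>)"

definition occupation_formula :: "'a \<Rightarrow> bool" where
  "occupation_formula \<omega> \<longleftrightarrow> (\<forall>f :: real \<Rightarrow> real. f \<in> borel_measurable borel \<longrightarrow> bounded (range f) \<longrightarrow>
        (\<forall>T\<ge>0. (LINT t:{0..T}|lborel. f (X t \<omega>)) = (LINT y|lborel. f y * L y T \<omega>)))"

lemma AE_occupation_formula: "AE \<omega> in M. occupation_formula \<omega>"
  using local_times unfolding jointly_continuous_local_times_def occupation_formula_def by (elim conjE)

text \<open>
  By the occupation density formula a single level has zero occupation time, so the discontinuity of
  the jump rate does not disturb the Riemann sums.
\<close>

lemma level_visited_null:
  assumes "occupation_formula \<omega>" "cadlag (\<lambda>s. X s \<omega>)" "0 < t"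
  shows "AE s in lborel. 0 < s \<and> s \<le> t \<longrightarrow> X s \<omega> \<noteq> b"
proof -
  have Y[measurable]: "(\<lambda>s. indicator {0<..t} s * X s \<omega>) \<in> borel_measurable borel"
    by (rule cadlag_measurable[OF assms(2,3)])
  define f :: "real \<Rightarrow> real" where "f s = indicator {0<..t} s * indicator {b} (X s \<omega>)" for s
  have f_eq: "f s = indicator {0<..t} s * indicator {b} (indicator {0<..t} s * X s \<omega>)" for s
    by (cases "s \<in> {0<..t}") (simp_all add: f_def)
  have [measurable]: "f \<in> borel_measurable borel" unfolding f_eq by measurable
  have "integrable lborel (indicator {0<..t} :: real \<Rightarrow> real)"
    using assms(3) by (intro integrable_real_indicator) auto
  then have int: "integrable lborel f"
    by (rule Bochner_Integration.integrable_bound) (auto simp: f_def indicator_def)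
  have eq0: "indicator {0..t} s *\<^sub>R indicator {b} (X s \<omega>) = f s + indicator {0} s * indicator {b} (X 0 \<omega>)" for s :: real
    using assms(3) by (auto simp: indicator_def f_def)
  have "(LINT s:{0..t}|lborel. indicator {b} (X s \<omega>)) = (LINT z|lborel. indicator {b} z * L z t \<omega>)"
  proof -
    have "bounded (range (indicator {b} :: real \<Rightarrow> real))"
      by (auto simp: bounded_iff indicator_def intro!: exI[of _ 1])
    moreover have "(indicator {b} :: real \<Rightarrow> real) \<in> borel_measurable borel" by simp
    ultimately show ?thesis
      using assms(1,3) unfolding occupation_formula_def by (meson less_imp_le)
  qed
  also have "\<dots> = 0"
    by (rule integral_eq_zero_AE) (use AE_lborel_singleton[of b] in \<open>auto elim!: eventually_mono\<close>)
  finally have "(LINT s|lborel. f s + indicator {0} s * indicator {b} (X 0 \<omega>)) = 0"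
    unfolding set_lebesgue_integral_def eq0 by simp
  moreover have "(LINT s|lborel. f s + indicator {0} s * indicator {b} (X 0 \<omega>)) = (LINT s|lborel. f s)"
    by (rule integral_cong_AE) (use AE_lborel_singleton[of "0::real"] in \<open>auto elim!: eventually_mono\<close>)
  ultimately have "(LINT s|lborel. f s) = 0" by simp
  moreover have "AE s in lborel. 0 \<le> f s" by (simp add: f_def)
  ultimately have "AE s in lborel. f s = 0"
    using integral_nonneg_eq_0_iff_AE[OF int] by simp
  then show ?thesis by eventually_elim (auto simp: f_def indicator_def split: if_splits)
qed

text \<open>
  For short steps the transition probabilities are the step length times the jump rate, uniformly, so
  the discrete compensators are Riemann sums up to a vanishing error.
\<close>

lemma compensator_limit:
  assumes occ: "occupation_formula \<omega>" and x: "cadlag (\<lambda>s. X s \<omega>)" and "0 < t" "0 < h"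
  shows "(\<lambda>n. \<Sum>k<n. if X (t * real k / real n) \<omega> \<le> y - h
      then tail_prob (t / real n) (y + h - X (t * real k / real n) \<omega>) else 0) \<longlonglongrightarrow> compensator h y t \<omega>"
    (is "?S \<longlonglongrightarrow> _")
proof -
  let ?R = "\<lambda>n. t / real n * (\<Sum>k<n. jump_rate h y (X (t * real k / real n) \<omega>))"
  have "?R \<longlonglongrightarrow> (LINT s:{0..t}|lborel. jump_rate h y (X s \<omega>))"
  proof (rule riemann_sum_tendsto[OF x \<open>0 < t\<close> _ jump_rate_bounded[OF \<open>0 < h\<close>]])
    show "AE s in lborel. 0 < s \<and> s \<le> t \<longrightarrow> isCont (jump_rate h y) (X s \<omega>)"
      using level_visited_null[OF occ x \<open>0 < t\<close>, of "y - h"]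
      by eventually_elim (auto intro: jump_rate_isCont[OF \<open>0 < h\<close>])
  qed simp
  moreover have "bounded (range (jump_rate h y))"
    unfolding bounded_iff using jump_rate_bounded[OF \<open>0 < h\<close>, of y] by auto
  then have "(LINT s:{0..t}|lborel. jump_rate h y (X s \<omega>)) = compensator h y t \<omega>"
    using occ \<open>0 < t\<close> jump_rate_measurable[of h y]
    unfolding occupation_formula_def compensator_def by simp
  ultimately have R: "?R \<longlonglongrightarrow> compensator h y t \<omega>" by simp
  have "(\<lambda>n. ?S n - ?R n) \<longlonglongrightarrow> 0"
  proof (rule LIMSEQ_I)
    fix e :: real assume "0 < e"
    define e' where "e' = e / (2 * t)"
    have "0 < e'" using \<open>0 < e\<close> \<open>0 < t\<close> by (simp add: e'_def)
    have "\<forall>\<^sub>F s in at_right 0. \<forall>u\<ge>2*h. \<bar>tail_prob s u - s * (tail_const * u powr (-(1+\<alpha>)))\<bar> \<le> s * e'"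
      using \<open>0 < h\<close> \<open>0 < e'\<close> by (intro tail_prob_rate_uniform) auto
    then obtain d where d: "0 < d" "\<And>s u. 0 < s \<Longrightarrow> s < d \<Longrightarrow> 2 * h \<le> u \<Longrightarrow>
        \<bar>tail_prob s u - s * (tail_const * u powr (-(1+\<alpha>)))\<bar> \<le> s * e'"
      unfolding eventually_at_right_field by auto
    obtain n0 where n0: "\<And>n. n0 \<le> n \<Longrightarrow> 0 < n \<and> t / real n < d"
      using eventually_mesh_less[OF d(1), of t] unfolding eventually_sequentially by blast
    show "\<exists>no. \<forall>n\<ge>no. norm (?S n - ?R n - 0) < e"
    proof (intro exI[of _ n0] allI impI)
      fix n assume "n0 \<le> n"
      note n = n0[OF this]
      have diff: "?S n - ?R n = (\<Sum>k<n. (if X (t * real k / real n) \<omega> \<le> y - h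
        then tail_prob (t / real n) (y + h - X (t * real k / real n) \<omega>) else 0)
         - t / real n * jump_rate h y (X (t * real k / real n) \<omega>))"
        by (simp add: sum_subtractf sum_distrib_left)
      have "\<bar>?S n - ?R n\<bar> \<le> (\<Sum>k<n. t / real n * e')"
        unfolding diff
      proof (rule order_trans[OF sum_abs], rule sum_mono)
        fix k
        show "\<bar>(if X (t * real k / real n) \<omega> \<le> y - h
          then tail_prob (t / real n) (y + h - X (t * real k / real n) \<omega>) else 0)
           - t / real n * jump_rate h y (X (t * real k / real n) \<omega>)\<bar> \<le> t / real n * e'"
        proof (cases "X (t * real k / real n) \<omega> \<le> y - h")
          case True
          have "0 < t / real n" using n \<open>0 < t\<close> by simp
          with True d(2)[of "t / real n" "y + h - X (t * real k / real n) \<omega>"] n show ?thesis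
            by (simp add: jump_rate_def)
        next
          case False
          then show ?thesis using \<open>0 < t\<close> \<open>0 < e'\<close> by (simp add: jump_rate_def)
        qed
      qed
      moreover have "(\<Sum>k<n. t / real n * e') = e / 2"
        using conjunct1[OF n] \<open>0 < t\<close> by (simp add: e'_def)
      moreover have "r < e" if "r \<le> q" "q = e / 2" for r q :: real using that \<open>0 < e\<close> by linarith
      ultimately show "norm (?S n - ?R n - 0) < e"
        unfolding real_norm_def diff_zero by blast
    qed
  qed
  from tendsto_add[OF this R] show ?thesis by simp
qed

text \<open>
  Along a fixed path the discrete compensators converge and the numbers of crossings compare with the
  jump counts in the required direction. Fatou's lemma transfers the exponential bound from the grids to the process, and Markov's
  inequality turns it into a deviation estimate.
\<close>

lemma deviation_bound:
  assumes "0 < t" "0 < h" and \<theta>: "\<theta> \<le> 0 \<and> h' = h \<or> 0 \<le> \<theta> \<and> h < h'"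
  shows "\<exists>B\<in>events. prob B \<le> exp (- a) \<and>
    (AE \<omega> in M. \<omega> \<notin> B \<longrightarrow>
      \<theta> * real (jump_count (\<lambda>s. X s \<omega>) h' y t) - (exp \<theta> - 1) * compensator h y t \<omega> \<le> a)"
proof -
  define W where "W n \<omega> = ennreal (exp (crossing_exponent \<theta> h y t n \<omega>))" for n \<omega>
  define Z where "Z \<omega> = liminf (\<lambda>n. W n \<omega>)" for \<omega>
  have [measurable]: "crossing_exponent \<theta> h y t n \<in> borel_measurable M" for n
    using \<open>0 < t\<close> by (intro crossing_exponent_measurable) simp
  have [measurable]: "W n \<in> borel_measurable M" for n unfolding W_def by measurable
  have [measurable]: "Z \<in> borel_measurable M" unfolding Z_def by measurable
  have "(\<integral>\<^sup>+\<omega>. Z \<omega> \<partial>M) \<le> liminf (\<lambda>n. \<integral>\<^sup>+\<omega>. W n \<omega> \<partial>M)"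
    unfolding Z_def by (rule nn_integral_liminf) simp
  also have "\<dots> \<le> liminf (\<lambda>n::nat. 1)"
    unfolding W_def by (intro Liminf_mono always_eventually allI exp_crossing_exponent_le_1 \<open>0 < t\<close>)
  also have "\<dots> = 1" by (simp add: Liminf_const)
  finally have Z1: "(\<integral>\<^sup>+\<omega>. Z \<omega> \<partial>M) \<le> 1" .
  define B where "B = {\<omega>\<in>space M. 1 \<le> ennreal (exp (- a)) * Z \<omega>}"
  have B: "B \<in> events" unfolding B_def by measurable
  have "emeasure M {\<omega>\<in>space M. 1 \<le> ennreal (exp (- a)) * Z \<omega>}
      \<le> ennreal (exp (- a)) * (\<integral>\<^sup>+\<omega>. Z \<omega> * indicator (space M) \<omega> \<partial>M)"
    by (rule nn_integral_Markov_inequality) auto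
  also have "(\<integral>\<^sup>+\<omega>. Z \<omega> * indicator (space M) \<omega> \<partial>M) = (\<integral>\<^sup>+\<omega>. Z \<omega> \<partial>M)"
    by (intro nn_integral_cong) simp
  also have "ennreal (exp (- a)) * (\<integral>\<^sup>+\<omega>. Z \<omega> \<partial>M) \<le> ennreal (exp (- a)) * 1"
    by (intro mult_left_mono Z1) simp
  finally have "emeasure M B \<le> ennreal (exp (- a))" by (simp add: B_def)
  then have probB: "prob B \<le> exp (- a)" by (simp add: emeasure_eq_measure)
  have "AE \<omega> in M. \<omega> \<notin> B \<longrightarrow>
      \<theta> * real (jump_count (\<lambda>s. X s \<omega>) h' y t) - (exp \<theta> - 1) * compensator h y t \<omega> \<le> a"
    using AE_occupation_formula cadlag_paths AE_space
  proof eventually_elim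
    case (elim \<omega>)
    let ?x = "\<lambda>s. X s \<omega>"
    define S where "S n = (\<Sum>k<n. if ?x (t * real k / real n) \<le> y - h
      then tail_prob (t / real n) (y + h - ?x (t * real k / real n)) else 0)" for n
    define b where "b n = \<theta> * real (jump_count ?x h' y t) - (exp \<theta> - 1) * S n" for n
    have split: "crossing_exponent \<theta> h y t n \<omega> = \<theta> * real (card (grid_crossings ?x h y t n)) - (exp \<theta> - 1) * S n" for n
    proof -
      have "real (card (grid_crossings ?x h y t n)) =
        (\<Sum>k<n. if ?x (t * real k / real n) \<le> y - h \<and> y + h \<le> ?x (t * real (Suc k) / real n) then 1 else 0)"
        unfolding grid_crossings_def by (subst sum.If_cases) (auto simp: Int_def conj_commute)
      then show ?thesis
        unfolding crossing_exponent_def S_def sum_distrib_left sum_subtractf[symmetric]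
        by (simp only: sum_distrib_left sum_subtractf[symmetric]) (auto intro!: sum.cong)
    qed
    have "\<forall>\<^sub>F n in sequentially. \<theta> * real (jump_count ?x h' y t) \<le> \<theta> * real (card (grid_crossings ?x h y t n))"
      using \<theta>
    proof
      assume "\<theta> \<le> 0 \<and> h' = h"
      then show ?thesis using grid_crossings_le_jump_count[OF elim(2) \<open>0 < t\<close> \<open>0 < h\<close>, of y]
        by (auto elim!: eventually_mono intro!: mult_left_mono_neg)
    next
      assume "0 \<le> \<theta> \<and> h < h'"
      then show ?thesis using jump_count_le_grid_crossings[OF elim(2) \<open>0 < t\<close> \<open>0 < h\<close>, of h' y]
        by (auto elim!: eventually_mono intro!: mult_left_mono)
    qed
    then have "\<forall>\<^sub>F n in sequentially. ennreal (exp (b n)) \<le> W n \<omega>"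
      by eventually_elim (simp add: W_def split b_def)
    then have le: "liminf (\<lambda>n. ennreal (exp (b n))) \<le> Z \<omega>"
      unfolding Z_def by (rule Liminf_mono)
    define b' where "b' = \<theta> * real (jump_count ?x h' y t) - (exp \<theta> - 1) * compensator h y t \<omega>"
    have "b \<longlonglongrightarrow> b'"
      unfolding b_def b'_def S_def
      by (intro tendsto_intros compensator_limit[OF elim(1,2) \<open>0 < t\<close> \<open>0 < h\<close>])
    then have "(\<lambda>n. ennreal (exp (b n))) \<longlonglongrightarrow> ennreal (exp b')"
      by (intro tendsto_ennrealI tendsto_exp)
    then have "liminf (\<lambda>n. ennreal (exp (b n))) = ennreal (exp b')"
      by (intro lim_imp_Liminf) auto
    with le have Zb: "ennreal (exp b') \<le> Z \<omega>" by simp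
    show ?case
    proof
      assume "\<omega> \<notin> B"
      then have "ennreal (exp (- a)) * Z \<omega> < 1" using elim(3) by (auto simp: B_def not_le)
      moreover have "ennreal (exp (- a)) * ennreal (exp b') \<le> ennreal (exp (- a)) * Z \<omega>"
        by (intro mult_left_mono Zb) simp
      ultimately have "ennreal (exp (- a)) * ennreal (exp b') < 1" by (rule le_less_trans[rotated])
      then have "exp (b' - a) < 1" by (simp add: ennreal_mult'[symmetric] exp_add[symmetric] del: ennreal_mult)
      then have "b' \<le> a" by simp
      then show "\<theta> * real (jump_count ?x h' y t) - (exp \<theta> - 1) * compensator h y t \<omega> \<le> a"
        by (simp only: b'_def)
    qed
  qed
  with probB show ?thesis by (intro bexI[OF _ B] conjI)
qed

end

section \<open>Local times and the limit of the compensator\<close>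

lemma jump_count_mono:
  assumes "cadlag x" "0 < h'" "h' + \<bar>y - y'\<bar> \<le> h" "t \<le> t'" "0 \<le> t'"
  shows "jump_count x h y t \<le> jump_count x h' y' t'"
  unfolding jump_count_eq_card
proof (rule card_mono)
  show "finite (jump_set x h' y' t')" using assms by (intro jump_set_finite)
  show "jump_set x h y t \<subseteq> jump_set x h' y' t'" using assms by (auto simp: jump_set_def)
qed

lemma jump_count_time_0: "0 < h \<Longrightarrow> jump_count x h y 0 = 0"
proof -
  assume "0 < h"
  then have "jump_set x h y 0 = {}" using jump_set_pos[of h _ x y 0] by (force simp: jump_set_def)
  then show ?thesis by (simp add: jump_count_eq_card)
qed

lemma jump_count_outside_range:
  assumes "0 < h" "\<And>s. 0 \<le> s \<Longrightarrow> s \<le> t \<Longrightarrow> \<bar>x s\<bar> \<le> R" "\<And>s. 0 \<le> s \<Longrightarrow> s \<le> t \<Longrightarrow> \<bar>left_limit x s\<bar> \<le> R"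
    and "R < \<bar>y\<bar>"
  shows "jump_count x h y t = 0"
proof -
  have "s \<notin> jump_set x h y t" for s
  proof
    assume s: "s \<in> jump_set x h y t"
    then have "\<bar>x s\<bar> \<le> R" "\<bar>left_limit x s\<bar> \<le> R" using assms(2,3)[of s] by (auto simp: jump_set_def)
    then show False using s assms(1,4) unfolding jump_set_def by (auto split: abs_split)
  qed
  then have "jump_set x h y t = {}" by blast
  then show ?thesis by (simp add: jump_count_eq_card)
qed

context stable_local_time
begin

definition regular_path :: "'a \<Rightarrow> bool" where
  "regular_path \<omega> \<longleftrightarrow> occupation_formula \<omega> \<and> cadlag (\<lambda>s. X s \<omega>) \<and>
     continuous_on (UNIV \<times> {0..}) (\<lambda>(y, t). L y t \<omega>)"

lemma AE_regular_path: "AE \<omega> in M. regular_path \<omega>"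
proof -
  have "AE \<omega> in M. continuous_on (UNIV \<times> {0..}) (\<lambda>(y, t). L y t \<omega>)"
    using local_times unfolding jointly_continuous_local_times_def by (elim conjE)
  with AE_occupation_formula cadlag_paths show ?thesis
    by eventually_elim (simp add: regular_path_def)
qed

lemma local_time_continuous_in_level:
  assumes "regular_path \<omega>" "0 \<le> t"
  shows "continuous_on A (\<lambda>z. L z t \<omega>)"
proof -
  have "continuous_on A ((\<lambda>(y, t). L y t \<omega>) \<circ> (\<lambda>z. (z, t)))"
  proof (rule continuous_on_compose)
    show "continuous_on A (\<lambda>z. (z, t))" by (intro continuous_intros)
    show "continuous_on ((\<lambda>z. (z, t)) ` A) (\<lambda>(y, t). L y t \<omega>)"
      by (rule continuous_on_subset[of "UNIV \<times> {0..}"]) (use assms in \<open>auto simp: regular_path_def\<close>)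
  qed
  then show ?thesis by (simp add: o_def)
qed

lemma local_time_measurable_in_level:
  assumes "regular_path \<omega>" "0 \<le> t"
  shows "(\<lambda>z. L z t \<omega>) \<in> borel_measurable borel"
  using local_time_continuous_in_level[OF assms, of UNIV] by (rule borel_measurable_continuous_onI)

lemma occupation_interval:
  assumes "regular_path \<omega>" "0 \<le> t"
  shows "(LINT s:{0..t}|lborel. indicator {a..b} (X s \<omega>)) = (LINT z:{a..b}|lborel. L z t \<omega>)"
proof -
  have "bounded (range (indicator {a..b} :: real \<Rightarrow> real))"
    by (auto simp: bounded_iff indicator_def intro!: exI[of _ 1])
  moreover have "(indicator {a..b} :: real \<Rightarrow> real) \<in> borel_measurable borel" by simp
  ultimately show ?thesis
    using assms unfolding occupation_formula_def regular_path_def set_lebesgue_integral_def real_scaleR_def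
    by simp
qed

text \<open>
  Continuity of the local time passes its sign at a level to its integral over a small interval, which
  is an occupation time.
\<close>

lemma local_time_small_interval:
  assumes "regular_path \<omega>" "0 \<le> t" "L z t \<omega> \<noteq> 0" "0 < d"
  obtains a b where "a < b" "{a..b} \<subseteq> {z - d<..<z + d}"
    "0 < L z t \<omega> \<Longrightarrow> 0 < (LINT z:{a..b}|lborel. L z t \<omega>)"
    "L z t \<omega> < 0 \<Longrightarrow> (LINT z:{a..b}|lborel. L z t \<omega>) < 0"
proof -
  define c where "c = \<bar>L z t \<omega>\<bar> / 2"
  have "0 < c" using assms(3) by (simp add: c_def)
  have "isCont (\<lambda>z. L z t \<omega>) z"
    using local_time_continuous_in_level[OF assms(1,2), of UNIV] by (simp add: continuous_on_eq_continuous_at)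
  from this[unfolded isCont_def, THEN tendstoD, OF \<open>0 < c\<close>]
  obtain e where e: "0 < e" "\<And>w. w \<noteq> z \<Longrightarrow> dist w z < e \<Longrightarrow> dist (L w t \<omega>) (L z t \<omega>) < c"
    unfolding eventually_at by auto
  define r where "r = min d e / 2"
  have r: "0 < r" "r < d" "r < e" using \<open>0 < d\<close> e(1) by (auto simp: r_def min_def)
  have near: "\<bar>L w t \<omega> - L z t \<omega>\<bar> \<le> c" if "w \<in> {z - r..z + r}" for w
  proof (cases "w = z")
    case False
    have "\<bar>w - z\<bar> \<le> r" using that by (simp add: abs_le_iff)
    then show ?thesis using e(2)[OF False] r(3) by (simp add: dist_real_def less_imp_le)
  qed (use \<open>0 < c\<close> in simp)
  have int: "set_integrable lborel {z - r..z + r} (\<lambda>w. L w t \<omega>)"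
    by (intro borel_integrable_atLeastAtMost' local_time_continuous_in_level assms)
  have intc: "set_integrable lborel {z - r..z + r} (\<lambda>w. k)" for k :: real
    by (intro borel_integrable_atLeastAtMost' continuous_intros)
  have const: "(LINT w:{z - r..z + r}|lborel. k) = k * (2 * r)" for k :: real
    using r by (simp add: set_lebesgue_integral_def)
  have "0 < (LINT w:{z - r..z + r}|lborel. L w t \<omega>)" if "0 < L z t \<omega>"
  proof -
    have "c \<le> L w t \<omega>" if "w \<in> {z - r..z + r}" for w
      using near[OF that] \<open>0 < L z t \<omega>\<close> unfolding c_def by linarith
    then have "(LINT w:{z - r..z + r}|lborel. c) \<le> (LINT w:{z - r..z + r}|lborel. L w t \<omega>)"
      by (intro set_integral_mono intc int)
    moreover have "0 < c * (2 * r)" using r \<open>0 < c\<close> by simp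
    ultimately show ?thesis by (simp add: const)
  qed
  moreover have "(LINT w:{z - r..z + r}|lborel. L w t \<omega>) < 0" if "L z t \<omega> < 0"
  proof -
    have "L w t \<omega> \<le> - c" if "w \<in> {z - r..z + r}" for w
      using near[OF that] \<open>L z t \<omega> < 0\<close> unfolding c_def by linarith
    then have "(LINT w:{z - r..z + r}|lborel. L w t \<omega>) \<le> (LINT w:{z - r..z + r}|lborel. - c)"
      by (intro set_integral_mono intc int)
    moreover have "0 < c * (2 * r)" using r \<open>0 < c\<close> by simp
    ultimately show ?thesis using const[of "- c"] by simp
  qed
  ultimately show ?thesis using r by (intro that[of "z - r" "z + r"]) auto
qed

lemma local_time_nonneg:
  assumes "regular_path \<omega>" "0 \<le> t"
  shows "0 \<le> L z t \<omega>"
proof (rule ccontr)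
  assume neg: "\<not> 0 \<le> L z t \<omega>"
  then obtain a b where "(LINT z:{a..b}|lborel. L z t \<omega>) < 0"
    using local_time_small_interval[OF assms, of z 1] by (metis not_le less_irrefl zero_less_one)
  moreover have "0 \<le> (LINT s:{0..t}|lborel. indicator {a..b} (X s \<omega>) :: real)"
    unfolding set_lebesgue_integral_def by (intro integral_nonneg_AE AE_I2) simp
  ultimately show False using occupation_interval[OF assms, of a b] by simp
qed

lemma local_time_outside_range:
  assumes "regular_path \<omega>" "0 \<le> t" "\<And>s. 0 \<le> s \<Longrightarrow> s \<le> t \<Longrightarrow> \<bar>X s \<omega>\<bar> \<le> R" "R < \<bar>z\<bar>"
  shows "L z t \<omega> = 0"
proof (rule ccontr)
  assume nz: "L z t \<omega> \<noteq> 0"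
  obtain a b where ab: "{a..b} \<subseteq> {z - (\<bar>z\<bar> - R)<..<z + (\<bar>z\<bar> - R)}" "0 < L z t \<omega> \<Longrightarrow> 0 < (LINT z:{a..b}|lborel. L z t \<omega>)"
    by (rule local_time_small_interval[OF assms(1,2) nz, of "\<bar>z\<bar> - R"]) (use assms(4) in auto)
  have "X s \<omega> \<notin> {a..b}" if "0 \<le> s" "s \<le> t" for s
  proof
    assume "X s \<omega> \<in> {a..b}"
    then have "X s \<omega> \<in> {z - (\<bar>z\<bar> - R)<..<z + (\<bar>z\<bar> - R)}" using ab(1) by blast
    then have "\<bar>X s \<omega> - z\<bar> < \<bar>z\<bar> - R" by (simp add: abs_less_iff)
    then show False using assms(3)[OF that] by linarith
  qed
  then have z: "indicator {0..t} s *\<^sub>R (indicator {a..b} (X s \<omega>) :: real) = 0" for s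
    by (auto simp: indicator_def)
  have "(LINT s:{0..t}|lborel. indicator {a..b} (X s \<omega>) :: real) = 0"
    unfolding set_lebesgue_integral_def z by simp
  then show False
    using occupation_interval[OF assms(1,2), of a b] ab(2) local_time_nonneg[OF assms(1,2), of z] nz by simp
qed

lemma compensator_time_0:
  assumes "occupation_formula \<omega>" "0 < h"
  shows "compensator h y 0 \<omega> = 0"
proof -
  have "bounded (range (jump_rate h y))"
    unfolding bounded_iff using jump_rate_bounded[OF \<open>0 < h\<close>, of y] by auto
  from assms(1)[unfolded occupation_formula_def, rule_format, OF jump_rate_measurable this order_refl]
  have "compensator h y 0 \<omega> = (LINT s:{0..0}|lborel. jump_rate h y (X s \<omega>))"
    unfolding compensator_def by (rule sym)
  also have "\<dots> = 0"
    unfolding set_lebesgue_integral_def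
    by (rule integral_eq_zero_AE) (use AE_lborel_singleton[of "0::real"] in \<open>auto elim!: eventually_mono\<close>)
  finally show ?thesis .
qed

text \<open>
  Outside the range of the path the local time vanishes, so uniform continuity on a compact strip
  extends to all levels.
\<close>

lemma local_time_uniformly_continuous:
  assumes reg: "regular_path \<omega>" and R: "\<And>s. 0 \<le> s \<Longrightarrow> s \<le> T \<Longrightarrow> \<bar>X s \<omega>\<bar> \<le> R" and "0 < e"
  obtains d where "0 < d" "d \<le> 1"
    "\<And>y z s t. \<bar>y - z\<bar> < d \<Longrightarrow> \<bar>s - t\<bar> < d \<Longrightarrow> s \<in> {0..T} \<Longrightarrow> t \<in> {0..T} \<Longrightarrow> \<bar>L y s \<omega> - L z t \<omega>\<bar> < e"
proof -
  define K where "K = {- (R + 1)..R + 1} \<times> {0..T}"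
  have "uniformly_continuous_on K (\<lambda>(y, t). L y t \<omega>)"
  proof (rule compact_uniformly_continuous)
    show "continuous_on K (\<lambda>(y, t). L y t \<omega>)"
      by (rule continuous_on_subset[of "UNIV \<times> {0..}"]) (use reg in \<open>auto simp: regular_path_def K_def\<close>)
    show "compact K" unfolding K_def by (intro compact_Times compact_Icc)
  qed
  then obtain d0 where d0: "0 < d0" "\<And>p q. p \<in> K \<Longrightarrow> q \<in> K \<Longrightarrow> dist q p < d0 \<Longrightarrow>
      dist ((\<lambda>(y, t). L y t \<omega>) q) ((\<lambda>(y, t). L y t \<omega>) p) < e"
    unfolding uniformly_continuous_on_def using \<open>0 < e\<close> by metis
  define d where "d = min 1 (d0 / 2)"
  have d: "0 < d" "d \<le> 1" "d \<le> d0 / 2" using d0(1) by (auto simp: d_def)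
  show ?thesis
  proof (rule that[OF d(1,2)])
    fix y z s t assume yz: "\<bar>y - z\<bar> < d" "\<bar>s - t\<bar> < d" and st: "s \<in> {0..T}" "t \<in> {0..T}"
    have out: "L w r \<omega> = 0" if "R < \<bar>w\<bar>" "r \<in> {0..T}" for w r
      using that R by (intro local_time_outside_range[OF reg]) auto
    show "\<bar>L y s \<omega> - L z t \<omega>\<bar> < e"
    proof (cases "(y, s) \<in> K \<and> (z, t) \<in> K")
      case True
      have "dist (y, s) (z, t) \<le> \<bar>y - z\<bar> + \<bar>s - t\<bar>"
        unfolding dist_Pair_Pair dist_real_def using sqrt_sum_squares_le_sum_abs[of "\<bar>y - z\<bar>" "\<bar>s - t\<bar>"] by simp
      also have "\<dots> < d0" using yz d(3) by simp
      finally show ?thesis using d0(2)[of "(z, t)" "(y, s)"] True by (simp add: dist_real_def)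
    next
      case False
      then have "R + 1 < \<bar>y\<bar> \<or> R + 1 < \<bar>z\<bar>" using st by (auto simp: K_def)
      then have "R < \<bar>y\<bar>" "R < \<bar>z\<bar>" using yz(1) d(2) by linarith+
      then show ?thesis using out[of y s] out[of z t] st \<open>0 < e\<close> by simp
    qed
  qed
qed

lemma local_time_bounded:
  assumes reg: "regular_path \<omega>" and R: "\<And>s. 0 \<le> s \<Longrightarrow> s \<le> T \<Longrightarrow> \<bar>X s \<omega>\<bar> \<le> R"
  obtains S where "0 \<le> S" "\<And>z t. t \<in> {0..T} \<Longrightarrow> L z t \<omega> \<le> S"
proof -
  define K where "K = {- R..R} \<times> {0..T}"
  have "compact ((\<lambda>(y, t). L y t \<omega>) ` K)"
  proof (rule compact_continuous_image)
    show "continuous_on K (\<lambda>(y, t). L y t \<omega>)"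
      by (rule continuous_on_subset[of "UNIV \<times> {0..}"]) (use reg in \<open>auto simp: regular_path_def K_def\<close>)
    show "compact K" unfolding K_def by (intro compact_Times compact_Icc)
  qed
  then have "bounded ((\<lambda>(y, t). L y t \<omega>) ` K)" by (rule compact_imp_bounded)
  then obtain S where "\<forall>q\<in>(\<lambda>(y, t). L y t \<omega>) ` K. norm q \<le> S" unfolding bounded_iff by (elim exE)
  then have S: "\<bar>(\<lambda>(y, t). L y t \<omega>) p\<bar> \<le> S" if "p \<in> K" for p using that by fastforce
  show ?thesis
  proof (rule that[of "max 0 S"])
    fix z t assume t: "t \<in> {0..T}"
    show "L z t \<omega> \<le> max 0 S"
    proof (cases "\<bar>z\<bar> \<le> R")
      case True
      then have "(z, t) \<in> K" using t by (auto simp: K_def)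
      from S[OF this] show ?thesis by auto
    next
      case False
      then have "L z t \<omega> = 0" using t R by (intro local_time_outside_range[OF reg, of t R]) auto
      then show ?thesis by simp
    qed
  qed simp
qed

definition norm_const :: real where
  "norm_const = 2 powr \<alpha> * Gamma (1 - \<alpha>)"

lemma norm_const_pos: "0 < norm_const"
  using alpha by (simp add: norm_const_def Gamma_real_pos)

text \<open>
  The normalised compensator is an average of the local time over levels below \<open>y\<close>, with respect to
  the probability density \<open>\<alpha> (2 h) powr \<alpha> u powr (- 1 - \<alpha>)\<close> on \<open>u \<ge> 2 h\<close>; this is where the
  constant comes from. As \<open>h\<close> tends to \<open>0\<close> the density concentrates at \<open>0\<close>, and the local time is uniformly continuous.
\<close>

lemma normalised_compensator_uniform_limit:
  assumes reg: "regular_path \<omega>" and R: "\<And>s. 0 \<le> s \<Longrightarrow> s \<le> T \<Longrightarrow> \<bar>X s \<omega>\<bar> \<le> R" and "0 < e"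
  shows "\<forall>\<^sub>F h in at_right 0. \<forall>y. \<forall>t\<in>{0..T}. \<bar>norm_const * h powr \<alpha> * compensator h y t \<omega> - L y t \<omega>\<bar> \<le> e"
proof -
  obtain d where d: "0 < d" "\<And>y z s t. \<bar>y - z\<bar> < d \<Longrightarrow> \<bar>s - t\<bar> < d \<Longrightarrow> s \<in> {0..T} \<Longrightarrow> t \<in> {0..T} \<Longrightarrow> \<bar>L y s \<omega> - L z t \<omega>\<bar> < e / 2"
    using local_time_uniformly_continuous[OF reg R, of T "e / 2"] \<open>0 < e\<close> by (metis half_gt_zero)
  obtain S where S: "0 \<le> S" "\<And>z t. t \<in> {0..T} \<Longrightarrow> L z t \<omega> \<le> S"
    using local_time_bounded[OF reg R] by metis
  have "((\<lambda>h. S * ((2 * h) powr \<alpha> * d powr (-\<alpha>))) \<longlongrightarrow> 0) (at_right 0)"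
  proof -
    have "((\<lambda>h. (2 * h) powr \<alpha>) \<longlongrightarrow> 0) (at_right 0)" using alpha by real_asymp
    from tendsto_mult_right[OF tendsto_mult_left[OF this], of S "d powr (-\<alpha>)"] show ?thesis
      by (simp add: mult_ac)
  qed
  then have "\<forall>\<^sub>F h in at_right 0. S * ((2 * h) powr \<alpha> * d powr (-\<alpha>)) < e / 2"
    by (rule order_tendstoD) (use \<open>0 < e\<close> in simp)
  then show ?thesis using eventually_at_right_less[of 0]
  proof eventually_elim
    case (elim h)
    show ?case
    proof (intro allI ballI)
      fix y t assume t: "t \<in> {0..T}"
      then have "0 \<le> t" by simp
      define k where "k u = \<alpha> * (2 * h) powr \<alpha> * (indicator {2 * h..} u * u powr (- 1 - \<alpha>))" for u :: real
      have k_pos: "0 \<le> k u" for u using alpha by (simp add: k_def)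
      have k1: "has_bochner_integral lborel k 1"
      proof -
        have "has_bochner_integral lborel k (\<alpha> * (2 * h) powr \<alpha> * ((2 * h) powr (-\<alpha>) / \<alpha>))"
          unfolding k_def using elim(2) alpha
          by (intro has_bochner_integral_mult_right has_bochner_integral_powr_tail) auto
        then show ?thesis using alpha elim(2) by (simp add: powr_minus)
      qed
      have k2: "has_bochner_integral lborel (\<lambda>u. \<alpha> * (2 * h) powr \<alpha> * (indicator {d..} u * u powr (- 1 - \<alpha>)))
          (\<alpha> * (2 * h) powr \<alpha> * (d powr (-\<alpha>) / \<alpha>))"
        using d(1) alpha by (intro has_bochner_integral_mult_right has_bochner_integral_powr_tail) auto
      have Lm[measurable]: "(\<lambda>z. L z t \<omega>) \<in> borel_measurable borel"
        by (rule local_time_measurable_in_level[OF reg \<open>0 \<le> t\<close>])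
      have Lb: "0 \<le> L z t \<omega>" "L z t \<omega> \<le> S" for z
        using local_time_nonneg[OF reg \<open>0 \<le> t\<close>] S(2)[OF t] by auto
      have kL: "integrable lborel (\<lambda>u. k u * L (y + h - u) t \<omega>)"
      proof (rule Bochner_Integration.integrable_bound)
        show "integrable lborel (\<lambda>u. k u * S)" using k1 by (auto simp: has_bochner_integral_iff)
        show "AE u in lborel. norm (k u * L (y + h - u) t \<omega>) \<le> norm (k u * S)"
          using k_pos Lb S(1) by (intro AE_I2) (auto simp: abs_mult intro!: mult_left_mono)
        show "(\<lambda>u. k u * L (y + h - u) t \<omega>) \<in> borel_measurable lborel"
          using borel_measurable_has_bochner_integral[OF k1] by simp
      qed
      have "compensator h y t \<omega> = \<bar>- 1\<bar> *\<^sub>R (\<integral>u. jump_rate h y ((y + h) + (- 1) * u) * L ((y + h) + (- 1) * u) t \<omega> \<partial>lborel)"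
        unfolding compensator_def by (rule lborel_integral_real_affine) simp
      also have "\<dots> = (\<integral>u. tail_const * (indicator {2 * h..} u * u powr (- 1 - \<alpha>)) * L (y + h - u) t \<omega> \<partial>lborel)"
        by (simp, intro Bochner_Integration.integral_cong) (auto simp: jump_rate_def indicator_def)
      finally have "norm_const * h powr \<alpha> * compensator h y t \<omega>
         = (\<integral>u. norm_const * h powr \<alpha> * (tail_const * (indicator {2 * h..} u * u powr (- 1 - \<alpha>)) * L (y + h - u) t \<omega>) \<partial>lborel)"
        by simp
      also have "\<dots> = (\<integral>u. k u * L (y + h - u) t \<omega> \<partial>lborel)"
      proof -
        have "norm_const * h powr \<alpha> * tail_const = \<alpha> * (2 * h) powr \<alpha>"
          using alpha elim(2) less_imp_neq[OF Gamma_real_pos[of "1 - \<alpha>"]]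
          by (simp add: norm_const_def tail_const_def powr_mult)
        then show ?thesis unfolding k_def
          by (intro Bochner_Integration.integral_cong refl) (metis (no_types, opaque_lifting) mult.assoc)
      qed
      finally have "norm_const * h powr \<alpha> * compensator h y t \<omega> - L y t \<omega>
         = (\<integral>u. k u * L (y + h - u) t \<omega> \<partial>lborel) - (\<integral>u. k u * L y t \<omega> \<partial>lborel)"
        using k1 by (simp add: has_bochner_integral_iff)
      also have "\<dots> = (\<integral>u. k u * L (y + h - u) t \<omega> - k u * L y t \<omega> \<partial>lborel)"
        using k1 kL by (intro Bochner_Integration.integral_diff[symmetric]) (auto simp: has_bochner_integral_iff)
      finally have eq: "norm_const * h powr \<alpha> * compensator h y t \<omega> - L y t \<omega>
         = (\<integral>u. k u * L (y + h - u) t \<omega> - k u * L y t \<omega> \<partial>lborel)" .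
      have "\<bar>norm_const * h powr \<alpha> * compensator h y t \<omega> - L y t \<omega>\<bar>
         \<le> (\<integral>u. \<bar>k u * L (y + h - u) t \<omega> - k u * L y t \<omega>\<bar> \<partial>lborel)"
        unfolding eq by (rule integral_abs_bound)
      also have "\<dots> \<le> (\<integral>u. e / 2 * k u + S * (\<alpha> * (2 * h) powr \<alpha> * (indicator {d..} u * u powr (- 1 - \<alpha>))) \<partial>lborel)"
      proof (rule integral_mono)
        show "integrable lborel (\<lambda>u. \<bar>k u * L (y + h - u) t \<omega> - k u * L y t \<omega>\<bar>)"
          using k1 kL by (auto simp: has_bochner_integral_iff)
        show "integrable lborel (\<lambda>u. e / 2 * k u + S * (\<alpha> * (2 * h) powr \<alpha> * (indicator {d..} u * u powr (- 1 - \<alpha>))))"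
          using k1 k2 by (auto simp: has_bochner_integral_iff)
        fix u
        have ab: "\<bar>k u * L (y + h - u) t \<omega> - k u * L y t \<omega>\<bar> = k u * \<bar>L (y + h - u) t \<omega> - L y t \<omega>\<bar>"
          using k_pos[of u] by (simp add: right_diff_distrib[symmetric] abs_mult)
        show "\<bar>k u * L (y + h - u) t \<omega> - k u * L y t \<omega>\<bar>
            \<le> e / 2 * k u + S * (\<alpha> * (2 * h) powr \<alpha> * (indicator {d..} u * u powr (- 1 - \<alpha>)))"
        proof (cases "u < 2 * h")
          case True
          then show ?thesis using alpha S(1) by (simp add: k_def)
        next
          case False
          show ?thesis
          proof (cases "u < d")
            case True
            have "\<bar>L (y + h - u) t \<omega> - L y t \<omega>\<bar> \<le> e / 2"
              using d(2)[of "y + h - u" y t t] True False elim(2) t d(1) by (simp add: less_imp_le)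
            then have "k u * \<bar>L (y + h - u) t \<omega> - L y t \<omega>\<bar> \<le> k u * (e / 2)"
              using k_pos by (rule mult_left_mono)
            then show ?thesis unfolding ab using True by (simp add: mult.commute[of _ "k u"])
          next
            case False
            have "\<bar>L (y + h - u) t \<omega> - L y t \<omega>\<bar> \<le> S"
              using Lb[of "y + h - u"] Lb[of y] by linarith
            then have "k u * \<bar>L (y + h - u) t \<omega> - L y t \<omega>\<bar> \<le> k u * S"
              using k_pos by (rule mult_left_mono)
            also have "\<dots> = S * (\<alpha> * (2 * h) powr \<alpha> * (indicator {d..} u * u powr (- 1 - \<alpha>)))"
              using False \<open>\<not> u < 2 * h\<close> by (simp add: k_def)
            also have "\<dots> \<le> e / 2 * k u + \<dots>" using k_pos[of u] \<open>0 < e\<close> by simp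
            finally show ?thesis unfolding ab .
          qed
        qed
      qed
      also have "\<dots> = e / 2 * 1 + S * (\<alpha> * (2 * h) powr \<alpha> * (d powr (-\<alpha>) / \<alpha>))"
        using k1 k2 by (auto simp: has_bochner_integral_iff)
      also have "\<dots> = e / 2 + S * ((2 * h) powr \<alpha> * d powr (-\<alpha>))"
        using alpha by simp
      also have "\<dots> \<le> e" using elim(1) by simp
      finally show "\<bar>norm_const * h powr \<alpha> * compensator h y t \<omega> - L y t \<omega>\<bar> \<le> e" .
    qed
  qed
qed

end

section \<open>Uniform convergence\<close>

context stable_local_time
begin

text \<open>
  The tilt tends to \<open>0\<close>, which makes the factors \<open>(exp \<theta> - 1) / \<theta>\<close> tend to \<open>1\<close>, but so slowly that the
  error \<open>j powr (\<alpha> / 2) / \<theta>\<close> stays small compared with the order \<open>j powr \<alpha>\<close> of the counts.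
\<close>

definition tilt :: "nat \<Rightarrow> real" where
  "tilt j = real j powr (- \<alpha> / 4)"

text \<open>
  Levels have mesh \<open>1 / j\<^sup>2\<close>, which is negligible against the scale \<open>h = 1 / j\<close> at which they are used.
\<close>

definition level :: "nat \<Rightarrow> int \<Rightarrow> real" where
  "level j i = real_of_int i / (real j)\<^sup>2"

definition time :: "nat \<Rightarrow> nat \<Rightarrow> real" where
  "time j k = real k / real j"

text \<open>
  The conclusion of the deviation estimate for both signs of the tilt. In the upper bound the compensator
  belongs to the slightly smaller scale \<open>1 / (j + 1)\<close>, since a positive tilt requires a gap.
\<close>

definition grid_estimate :: "nat \<Rightarrow> int \<Rightarrow> nat \<Rightarrow> 'a \<Rightarrow> bool" where
  "grid_estimate j i k \<omega> \<longleftrightarrow>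
     tilt j * real (jump_count (\<lambda>s. X s \<omega>) (1 / real j) (level j i) (time j k))
       - (exp (tilt j) - 1) * compensator (1 / (real j + 1)) (level j i) (time j k) \<omega> \<le> real j powr (\<alpha> / 2) \<and>
     - tilt j * real (jump_count (\<lambda>s. X s \<omega>) (1 / real j) (level j i) (time j k))
       - (exp (- tilt j) - 1) * compensator (1 / real j) (level j i) (time j k) \<omega> \<le> real j powr (\<alpha> / 2)"

lemma grid_estimate_bad_event:
  assumes "0 < j"
  shows "\<exists>B\<in>events. prob B \<le> 2 * exp (- (real j powr (\<alpha> / 2))) \<and> (AE \<omega> in M. \<omega> \<notin> B \<longrightarrow> grid_estimate j i k \<omega>)"
proof (cases "k = 0")
  case True
  have "AE \<omega> in M. \<omega> \<notin> {} \<longrightarrow> grid_estimate j i k \<omega>"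
    using AE_occupation_formula
  proof eventually_elim
    case (elim \<omega>)
    then show ?case using True assms
      by (simp add: grid_estimate_def time_def jump_count_time_0 compensator_time_0)
  qed
  then show ?thesis by (intro bexI[of _ "{}"]) auto
next
  case False
  have t: "0 < time j k" using False assms by (simp add: time_def)
  have tilt: "0 < tilt j" using assms by (simp add: tilt_def)
  have h: "0 < 1 / (real j + 1)" "1 / (real j + 1) < 1 / real j" "0 < 1 / real j"
    using assms by (auto simp: field_simps)
  from deviation_bound[OF t h(1), of "tilt j" "1 / real j" "real j powr (\<alpha> / 2)" "level j i"] tilt h(2)
  obtain B1 where B1: "B1 \<in> events" "prob B1 \<le> exp (- (real j powr (\<alpha> / 2)))"
    "AE \<omega> in M. \<omega> \<notin> B1 \<longrightarrow> tilt j * real (jump_count (\<lambda>s. X s \<omega>) (1 / real j) (level j i) (time j k))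
       - (exp (tilt j) - 1) * compensator (1 / (real j + 1)) (level j i) (time j k) \<omega> \<le> real j powr (\<alpha> / 2)"
    by auto
  from deviation_bound[OF t h(3), of "- tilt j" "1 / real j" "real j powr (\<alpha> / 2)" "level j i"] tilt
  obtain B2 where B2: "B2 \<in> events" "prob B2 \<le> exp (- (real j powr (\<alpha> / 2)))"
    "AE \<omega> in M. \<omega> \<notin> B2 \<longrightarrow> - tilt j * real (jump_count (\<lambda>s. X s \<omega>) (1 / real j) (level j i) (time j k))
       - (exp (- tilt j) - 1) * compensator (1 / real j) (level j i) (time j k) \<omega> \<le> real j powr (\<alpha> / 2)"
    by auto
  have "prob (B1 \<union> B2) \<le> prob B1 + prob B2"
    using B1(1) B2(1) by (rule measure_subadditive) auto
  then have "prob (B1 \<union> B2) \<le> 2 * exp (- (real j powr (\<alpha> / 2)))"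
    using B1(2) B2(2) by simp
  moreover have "AE \<omega> in M. \<omega> \<notin> B1 \<union> B2 \<longrightarrow> grid_estimate j i k \<omega>"
    using B1(3) B2(3) by eventually_elim (simp add: grid_estimate_def)
  ultimately show ?thesis using B1(1) B2(1) by (intro bexI[of _ "B1 \<union> B2"]) auto
qed

text \<open>
  Level \<open>j\<close> of the grid has polynomially many points, each of which fails with a probability that
  decays faster than every power of \<open>j\<close>.
\<close>

lemma AE_eventually_grid_estimate:
  "AE \<omega> in M. \<forall>\<^sub>F j in sequentially. \<forall>i\<in>{- int (j ^ 3)..int (j ^ 3)}. \<forall>k\<le>j\<^sup>2. grid_estimate j i k \<omega>"
proof -
  define bad where "bad j i k A \<longleftrightarrow> A \<in> events \<and> (0 < j \<longrightarrow> prob A \<le> 2 * exp (- (real j powr (\<alpha> / 2))) \<and>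
      (AE \<omega> in M. \<omega> \<notin> A \<longrightarrow> grid_estimate j i k \<omega>))" for j i k A
  define B where "B j i k = (SOME A. bad j i k A)" for j i k
  have "bad j i k (B j i k)" for j i k
  proof -
    have "\<exists>A. bad j i k A"
    proof (cases "0 < j")
      case True
      from grid_estimate_bad_event[OF this, of i k] show ?thesis by (auto simp: bad_def)
    next
      case False
      then show ?thesis by (intro exI[of _ "{}"]) (simp add: bad_def)
    qed
    then show ?thesis unfolding B_def by (rule someI_ex)
  qed
  then have B: "B j i k \<in> events"
    "0 < j \<Longrightarrow> prob (B j i k) \<le> 2 * exp (- (real j powr (\<alpha> / 2)))"
    "0 < j \<Longrightarrow> AE \<omega> in M. \<omega> \<notin> B j i k \<longrightarrow> grid_estimate j i k \<omega>" for j i k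
    by (auto simp: bad_def)
  define I where "I j = {- int (j ^ 3)..int (j ^ 3)} \<times> {..j\<^sup>2}" for j
  have fin: "finite (I j)" for j by (simp add: I_def)
  have card: "real (card (I j)) = (2 * real j ^ 3 + 1) * ((real j)\<^sup>2 + 1)" for j
    by (simp add: I_def card_cartesian_product nat_add_distrib algebra_simps)
  define E where "E j = (\<Union>(i, k)\<in>I j. B j i k)" for j
  have E: "E j \<in> events" for j
    unfolding E_def using B(1) fin by (intro sets.finite_UN) auto
  have prob_E: "prob (E j) \<le> (2 * real j ^ 3 + 1) * ((real j)\<^sup>2 + 1) * (2 * exp (- (real j powr (\<alpha> / 2))))" if "0 < j" for j
  proof -
    have "prob (E j) \<le> (\<Sum>p\<in>I j. prob (case p of (i, k) \<Rightarrow> B j i k))"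
      unfolding E_def using B(1) by (intro measure_UNION_le fin) auto
    also have "\<dots> \<le> (\<Sum>p\<in>I j. 2 * exp (- (real j powr (\<alpha> / 2))))"
      using B(2)[OF that] by (intro sum_mono) auto
    finally show ?thesis by (simp add: card)
  qed
  have bound: "\<forall>\<^sub>F j in sequentially. norm (prob (E j)) \<le> (2 * real j ^ 3 + 1) * ((real j)\<^sup>2 + 1) * (2 * exp (- (real j powr (\<alpha> / 2))))"
    using eventually_gt_at_top[of 0]
  proof eventually_elim
    case (elim j)
    from prob_E[OF this] show ?case by simp
  qed
  have "summable (\<lambda>j. (2 * real j ^ 3 + 1) * ((real j)\<^sup>2 + 1) * (2 * exp (- (real j powr (\<alpha> / 2)))))"
  proof (rule summable_comparison_test_bigo)
    show "summable (\<lambda>j. norm (real j powr (- 2)))" by (simp add: summable_real_powr_iff)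
    show "(\<lambda>j. (2 * real j ^ 3 + 1) * ((real j)\<^sup>2 + 1) * (2 * exp (- (real j powr (\<alpha> / 2))))) \<in> O(\<lambda>j. real j powr (- 2))"
      using alpha by real_asymp
  qed
  from summable_comparison_test_ev[OF bound this] have "summable (\<lambda>j. prob (E j))" .
  then have "AE \<omega> in M. \<forall>\<^sub>F j in sequentially. \<omega> \<in> space M - E j"
    using E by (intro borel_cantelli_AE1) (auto simp: emeasure_eq_measure)
  moreover have "AE \<omega> in M. \<forall>j i k. 0 < j \<longrightarrow> \<omega> \<notin> B j i k \<longrightarrow> grid_estimate j i k \<omega>"
    using B(3) by (auto simp: AE_all_countable)
  ultimately show ?thesis
  proof eventually_elim
    case (elim \<omega>)
    from elim(1) eventually_gt_at_top[of 0] show ?case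
    proof eventually_elim
      case (elim j)
      then show ?case using \<open>\<forall>j i k. 0 < j \<longrightarrow> \<omega> \<notin> B j i k \<longrightarrow> grid_estimate j i k \<omega>\<close>
        by (auto simp: E_def I_def)
    qed
  qed
qed

text \<open>
  At the grid points the count follows the compensator up to factors that tend to \<open>1\<close> and an error
  of smaller order, so it inherits the limit of the normalised compensator.
\<close>

lemma grid_uniform_limit:
  assumes reg: "regular_path \<omega>" and R: "\<And>s. 0 \<le> s \<Longrightarrow> s \<le> T \<Longrightarrow> \<bar>X s \<omega>\<bar> \<le> R" and "0 < e"
    and grid: "\<forall>\<^sub>F j in sequentially. \<forall>i\<in>{- int (j ^ 3)..int (j ^ 3)}. \<forall>k\<le>j\<^sup>2. grid_estimate j i k \<omega>"
  shows "\<forall>\<^sub>F j in sequentially. \<forall>i\<in>{- int (j ^ 3)..int (j ^ 3)}. \<forall>k\<le>j\<^sup>2. time j k \<le> T \<longrightarrow>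
    \<bar>norm_const * (1 / real j) powr \<alpha> * real (jump_count (\<lambda>s. X s \<omega>) (1 / real j) (level j i) (time j k))
      - L (level j i) (time j k) \<omega>\<bar> \<le> e"
proof -
  obtain S where S: "0 \<le> S" "\<And>z t. t \<in> {0..T} \<Longrightarrow> L z t \<omega> \<le> S"
    using local_time_bounded[OF reg R] by metis
  \<comment> \<open>Three errors of size \<open>d\<close>, of which the multiplicative one acts on a quantity of size at most
    \<open>S + 1\<close>, must add up to at most \<open>e\<close>.\<close>
  define d where "d = min 1 (e / (S + 3))"
  have d: "0 < d" "d \<le> 1" "d \<le> e / (S + 3)"
    using \<open>0 < e\<close> S(1) by (auto simp: d_def)
  then have dS: "d * (S + 3) \<le> e" using S(1) by (simp add: pos_le_divide_eq)
  have comp: "\<forall>\<^sub>F h in at_right 0. \<forall>y. \<forall>t\<in>{0..T}. \<bar>norm_const * h powr \<alpha> * compensator h y t \<omega> - L y t \<omega>\<bar> \<le> d"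
    by (rule normalised_compensator_uniform_limit[OF reg R d(1)])
  have f1: "filterlim (\<lambda>j. 1 / real j) (at_right 0) sequentially" by real_asymp
  have f2: "filterlim (\<lambda>j. 1 / (real j + 1)) (at_right 0) sequentially" by real_asymp
  have c1: "\<forall>\<^sub>F j in sequentially. \<forall>y. \<forall>t\<in>{0..T}. \<bar>norm_const * (1 / real j) powr \<alpha> * compensator (1 / real j) y t \<omega> - L y t \<omega>\<bar> \<le> d"
    by (rule eventually_compose_filterlim[OF comp f1])
  have c2: "\<forall>\<^sub>F j in sequentially. \<forall>y. \<forall>t\<in>{0..T}. \<bar>norm_const * (1 / (real j + 1)) powr \<alpha> * compensator (1 / (real j + 1)) y t \<omega> - L y t \<omega>\<bar> \<le> d"
    by (rule eventually_compose_filterlim[OF comp f2])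
  define pU where "pU j = (exp (tilt j) - 1) / tilt j * ((real j + 1) / real j) powr \<alpha>" for j
  define pL where "pL j = (1 - exp (- tilt j)) / tilt j" for j
  define r where "r j = norm_const * (1 / real j) powr \<alpha> * (real j powr (\<alpha> / 2) / tilt j)" for j
  have "pU \<longlonglongrightarrow> 1" unfolding pU_def tilt_def using alpha by real_asymp
  then have pU: "\<forall>\<^sub>F j in sequentially. \<bar>pU j - 1\<bar> < d"
    using tendstoD[OF _ d(1)] by (fastforce simp: dist_real_def)
  have "pL \<longlonglongrightarrow> 1" unfolding pL_def tilt_def using alpha by real_asymp
  then have pL: "\<forall>\<^sub>F j in sequentially. \<bar>pL j - 1\<bar> < d"
    using tendstoD[OF _ d(1)] by (fastforce simp: dist_real_def)
  have "(\<lambda>j. (1 / real j) powr \<alpha> * (real j powr (\<alpha> / 2) / tilt j)) \<longlonglongrightarrow> 0"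
    unfolding tilt_def using alpha by real_asymp
  from tendsto_mult_right_zero[OF this, of norm_const] have "r \<longlonglongrightarrow> 0"
    unfolding r_def by (simp add: mult.assoc)
  then have r: "\<forall>\<^sub>F j in sequentially. \<bar>r j\<bar> < d"
    using tendstoD[OF _ d(1)] by (fastforce simp: dist_real_def)
  show ?thesis
    using c1 c2 pU pL r grid eventually_gt_at_top[of 0]
  proof eventually_elim
    case (elim j)
    show ?case
    proof (intro ballI allI impI)
      fix i k assume ik: "i \<in> {- int (j ^ 3)..int (j ^ 3)}" "k \<le> j\<^sup>2" "time j k \<le> T"
      define m where "m = real (jump_count (\<lambda>s. X s \<omega>) (1 / real j) (level j i) (time j k))"
      define N where "N = norm_const * (1 / real j) powr \<alpha>"
      define l where "l = L (level j i) (time j k) \<omega>"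
      define cU where "cU = compensator (1 / (real j + 1)) (level j i) (time j k) \<omega>"
      define cL where "cL = compensator (1 / real j) (level j i) (time j k) \<omega>"
      define U where "U = norm_const * (1 / (real j + 1)) powr \<alpha> * cU"
      define V where "V = N * cL"
      have t: "time j k \<in> {0..T}" using ik(3) by (simp add: time_def)
      have "0 < N" using norm_const_pos elim(7) by (simp add: N_def)
      have tilt: "0 < tilt j" using elim(7) by (simp add: tilt_def)
      have l: "0 \<le> l" "l \<le> S"
        using local_time_nonneg[OF reg, of "time j k"] S(2)[OF t] t by (auto simp: l_def)
      have U: "\<bar>U - l\<bar> \<le> d" using elim(2) t unfolding U_def cU_def l_def by blast
      have V: "\<bar>V - l\<bar> \<le> d" using elim(1) t unfolding V_def N_def cL_def l_def by blast
      have est: "tilt j * m \<le> (exp (tilt j) - 1) * cU + real j powr (\<alpha> / 2)"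
        "(1 - exp (- tilt j)) * cL - real j powr (\<alpha> / 2) \<le> tilt j * m"
        using elim(6) ik(1,2) unfolding grid_estimate_def m_def cU_def cL_def by (auto simp: algebra_simps)
      have "m \<le> ((exp (tilt j) - 1) * cU + real j powr (\<alpha> / 2)) / tilt j"
        using est(1) tilt by (simp add: pos_le_divide_eq mult.commute)
      from mult_left_mono[OF this less_imp_le[OF \<open>0 < N\<close>]]
      have "N * m \<le> (exp (tilt j) - 1) / tilt j * (N * cU) + r j"
        by (simp add: r_def N_def add_divide_distrib distrib_left mult_ac)
      moreover have "N * cU = ((real j + 1) / real j) powr \<alpha> * U"
        using elim(7) by (simp add: N_def U_def powr_divide)
      ultimately have up: "N * m \<le> pU j * U + r j" by (simp add: pU_def mult.assoc)
      have "((1 - exp (- tilt j)) * cL - real j powr (\<alpha> / 2)) / tilt j \<le> m"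
        using est(2) tilt by (simp add: pos_divide_le_eq mult.commute)
      from mult_left_mono[OF this less_imp_le[OF \<open>0 < N\<close>]]
      have lo: "pL j * V - r j \<le> N * m"
        by (simp add: r_def N_def V_def pL_def diff_divide_distrib right_diff_distrib left_diff_distrib mult_ac)
      have near: "\<bar>p * z - z\<bar> \<le> d * (S + 1)" if "\<bar>p - 1\<bar> < d" "\<bar>z - l\<bar> \<le> d" for p z
      proof -
        have "\<bar>p * z - z\<bar> = \<bar>p - 1\<bar> * \<bar>z\<bar>" by (simp add: left_diff_distrib abs_mult[symmetric])
        also have "\<dots> \<le> d * (S + 1)"
          using that l d by (intro mult_mono) auto
        finally show ?thesis .
      qed
      have de: "d * (S + 1) + d + d \<le> e" using dS by (simp add: algebra_simps)
      have "N * m \<le> l + e" using up near[OF elim(3) U] U elim(5) de by linarith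
      moreover have "l - e \<le> N * m" using lo near[OF elim(4) V] V elim(5) de by linarith
      ultimately show "\<bar>norm_const * (1 / real j) powr \<alpha> * real (jump_count (\<lambda>s. X s \<omega>) (1 / real j) (level j i) (time j k))
        - L (level j i) (time j k) \<omega>\<bar> \<le> e"
        unfolding N_def m_def l_def by linarith
    qed
  qed
qed

lemma grid_level_near:
  assumes "0 < j" "\<bar>y\<bar> \<le> R" "R + 1 \<le> real j"
  obtains i where "i \<in> {- int (j ^ 3)..int (j ^ 3)}" "\<bar>y - level j i\<bar> \<le> 1 / (real j)\<^sup>2"
proof -
  define i where "i = \<lfloor>y * (real j)\<^sup>2\<rfloor>"
  have i: "real_of_int i \<le> y * (real j)\<^sup>2" "y * (real j)\<^sup>2 < real_of_int i + 1"
    by (auto simp: i_def)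
  have sq: "1 \<le> (real j)\<^sup>2" using assms(1) by simp
  have "\<bar>y * (real j)\<^sup>2\<bar> \<le> R * (real j)\<^sup>2"
    using assms(2) by (simp add: abs_mult mult_right_mono)
  moreover have "(R + 1) * (real j)\<^sup>2 \<le> real j * (real j)\<^sup>2"
    using assms(3) by (rule mult_right_mono) simp
  then have "R * (real j)\<^sup>2 + 1 \<le> real j ^ 3"
    using sq by (simp add: power3_eq_cube power2_eq_square algebra_simps)
  ultimately have "\<bar>real_of_int i\<bar> \<le> real j ^ 3" using i by linarith
  then have "\<bar>real_of_int i\<bar> \<le> real_of_int (int (j ^ 3))" by simp
  then have "i \<in> {- int (j ^ 3)..int (j ^ 3)}" by (simp only: atLeastAtMost_iff) linarith
  moreover have "\<bar>y - level j i\<bar> \<le> 1 / (real j)\<^sup>2"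
  proof -
    have "y - level j i = (y * (real j)\<^sup>2 - real_of_int i) / (real j)\<^sup>2"
      using assms(1) by (simp add: level_def field_simps)
    moreover have "\<bar>y * (real j)\<^sup>2 - real_of_int i\<bar> \<le> 1" using i by linarith
    ultimately show ?thesis by (simp add: divide_right_mono)
  qed
  ultimately show ?thesis by (rule that)
qed


text \<open>
  Counts decrease in \<open>h\<close> and increase in time, and shifting the level by \<open>\<epsilon>\<close> can be paid for by changing
  \<open>h\<close> by \<open>\<epsilon>\<close>. Choosing \<open>j\<close> slightly above or below \<open>1 / h\<close> thus traps every count between two
  counts at grid points.
\<close>

lemma pathwise_uniform_limit:
  assumes reg: "regular_path \<omega>"
    and grid: "\<forall>\<^sub>F j in sequentially. \<forall>i\<in>{- int (j ^ 3)..int (j ^ 3)}. \<forall>k\<le>j\<^sup>2. grid_estimate j i k \<omega>"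
    and "0 < T" "0 < e"
  shows "\<forall>\<^sub>F h in at_right 0. \<forall>y. \<forall>t\<in>{0..T}.
    \<bar>norm_const * h powr \<alpha> * real (jump_count (\<lambda>s. X s \<omega>) h y t) - L y t \<omega>\<bar> \<le> e"
proof -
  let ?x = "\<lambda>s. X s \<omega>"
  have x: "cadlag ?x" using reg by (simp add: regular_path_def)
  obtain R0 where "\<And>s. 0 \<le> s \<Longrightarrow> s \<le> T + 1 \<Longrightarrow> \<bar>?x s\<bar> \<le> R0" "\<And>s. 0 \<le> s \<Longrightarrow> s \<le> T + 1 \<Longrightarrow> \<bar>left_limit ?x s\<bar> \<le> R0"
    by (rule cadlag_bounded[OF x, of "T + 1"]) (use \<open>0 < T\<close> in auto)
  then obtain R where R: "\<And>s. 0 \<le> s \<Longrightarrow> s \<le> T + 1 \<Longrightarrow> \<bar>?x s\<bar> \<le> R" "\<And>s. 0 \<le> s \<Longrightarrow> s \<le> T + 1 \<Longrightarrow> \<bar>left_limit ?x s\<bar> \<le> R"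
    by blast
  define e1 where "e1 = min 1 (e / 4)"
  have e1: "0 < e1" "e1 \<le> 1" "e1 \<le> e / 4" using \<open>0 < e\<close> by (auto simp: e1_def)
  obtain S where S: "0 \<le> S" "\<And>z t. t \<in> {0..T + 1} \<Longrightarrow> L z t \<omega> \<le> S"
    using local_time_bounded[OF reg R(1)] by metis
  obtain d where d: "0 < d" "d \<le> 1"
    "\<And>y z s t. \<bar>y - z\<bar> < d \<Longrightarrow> \<bar>s - t\<bar> < d \<Longrightarrow> s \<in> {0..T + 1} \<Longrightarrow> t \<in> {0..T + 1} \<Longrightarrow> \<bar>L y s \<omega> - L z t \<omega>\<bar> < e1"
  proof (rule local_time_uniformly_continuous[where T = "T + 1" and R = R, OF reg _ e1(1)])
    show "\<bar>X s \<omega>\<bar> \<le> R" if "0 \<le> s" "s \<le> T + 1" for s using that by (rule R(1))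
  qed (rule that)
  have "\<forall>\<^sub>F j in sequentially. \<forall>i\<in>{- int (j ^ 3)..int (j ^ 3)}. \<forall>k\<le>j\<^sup>2. time j k \<le> T + 1 \<longrightarrow>
    \<bar>norm_const * (1 / real j) powr \<alpha> * real (jump_count ?x (1 / real j) (level j i) (time j k))
      - L (level j i) (time j k) \<omega>\<bar> \<le> e1"
    by (rule grid_uniform_limit[OF reg R(1) e1(1) grid])
  then obtain j1 where j1: "\<And>j i k. j1 \<le> j \<Longrightarrow> i \<in> {- int (j ^ 3)..int (j ^ 3)} \<Longrightarrow> k \<le> j\<^sup>2 \<Longrightarrow> time j k \<le> T + 1 \<Longrightarrow>
    \<bar>norm_const * (1 / real j) powr \<alpha> * real (jump_count ?x (1 / real j) (level j i) (time j k))
      - L (level j i) (time j k) \<omega>\<bar> \<le> e1"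
    unfolding eventually_sequentially by blast
  \<comment> \<open>For \<open>j \<ge> b\<close> the grid is fine enough for the uniform continuity and wide enough to cover the range
    of the path and the time interval.\<close>
  define b where "b = real j1 + 1 / d + \<bar>R\<bar> + T + 5"
  have b: "0 < b" "real j1 \<le> b" "1 / d < b" "R + 1 \<le> b" "T + 1 \<le> b" "1 \<le> b" "5 \<le> b"
  proof -
    have "0 < 1 / d" "0 \<le> real j1" using d(1) by simp_all
    then show "0 < b" "real j1 \<le> b" "1 / d < b" "R + 1 \<le> b" "T + 1 \<le> b" "1 \<le> b" "5 \<le> b"
      unfolding b_def using \<open>0 < T\<close> by linarith+
  qed
  \<comment> \<open>A grid point close to \<open>(y, t)\<close>, at which the normalised count is close to \<open>L y t\<close>.\<close>
  have point: "\<exists>i. \<bar>y - level j i\<bar> \<le> 1 / (real j)\<^sup>2 \<and>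
      \<bar>norm_const * (1 / real j) powr \<alpha> * real (jump_count ?x (1 / real j) (level j i) (time j k)) - L y t \<omega>\<bar> \<le> 2 * e1"
    if j: "b \<le> real j" and y: "\<bar>y\<bar> \<le> R" and t: "t \<in> {0..T}" and k: "\<bar>time j k - t\<bar> \<le> 1 / real j" for j y t k
  proof -
    have j0: "0 < j" "1 \<le> real j" using b(6) j by auto
    have "1 / real j < d"
    proof -
      have "1 / d < real j" using b(3) j by simp
      then show ?thesis using d(1) j0 by (simp add: field_simps)
    qed
    then have tk: "time j k \<in> {0..T + 1}" "\<bar>time j k - t\<bar> < d"
      using k t d(2) by (auto simp: time_def)
    have "real k \<le> (T + 1 / real j) * real j"
      using k t j0 unfolding time_def by (simp add: abs_le_iff pos_divide_le_eq[symmetric])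
    also have "\<dots> = T * real j + 1" using j0 by (simp add: distrib_right)
    also have "\<dots> \<le> (T + 1) * real j" using j0 by (simp add: distrib_right)
    also have "\<dots> \<le> real j * real j" using b(5) j by (intro mult_right_mono) auto
    finally have "real k \<le> real (j\<^sup>2)" by (simp add: power2_eq_square)
    then have kj: "k \<le> j\<^sup>2" by (simp only: of_nat_le_iff)
    obtain i where i: "i \<in> {- int (j ^ 3)..int (j ^ 3)}" "\<bar>y - level j i\<bar> \<le> 1 / (real j)\<^sup>2"
      by (rule grid_level_near[OF j0(1) y]) (use b(4) j in auto)
    have "1 / (real j)\<^sup>2 \<le> 1 / real j"
      using j0 by (simp add: power2_eq_square field_simps)
    then have "\<bar>level j i - y\<bar> < d" using i(2) \<open>1 / real j < d\<close> by linarith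
    then have "\<bar>L (level j i) (time j k) \<omega> - L y t \<omega>\<bar> < e1"
      using tk t by (intro d(3)) auto
    moreover have "\<bar>norm_const * (1 / real j) powr \<alpha> * real (jump_count ?x (1 / real j) (level j i) (time j k))
      - L (level j i) (time j k) \<omega>\<bar> \<le> e1"
      using b(2) j tk kj i by (intro j1) auto
    ultimately show ?thesis using i(2) by (intro exI[of _ i]) linarith
  qed
  \<comment> \<open>Replacing \<open>1 / j\<close> by \<open>h\<close> changes the normalised count by a factor within \<open>3 h\<close> of \<open>1\<close>, hence by at
    most \<open>3 h (S + 2)\<close>.\<close>
  define g where "g = e / (6 * (S + 2))"
  have g: "0 < g" "3 * g * (S + 2) = e / 2" using \<open>0 < e\<close> S(1) by (auto simp: g_def field_simps)
  define c where "c = min g (1 / (b + 3))"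
  have c: "0 < c" "c \<le> g" "c \<le> 1 / (b + 3)" using g(1) b(1) by (auto simp: c_def)
  have "\<forall>\<^sub>F h in at_right 0. h \<in> {0<..<c}" by (rule eventually_at_right_real) (rule c(1))
  then show ?thesis
  proof eventually_elim
    case (elim h)
    then have h: "0 < h" "h < g" "h < 1 / (b + 3)" using c by auto
    then have hb: "b + 3 < 1 / h" using b(1) by (simp add: field_simps)
    have "5 \<le> b" using b(7) .
    then have "1 / (b + 3) \<le> 1 / 6" by (intro divide_left_mono) auto
    then have h6: "h \<le> 1 / 6" using h(3) by linarith
    have inv: "h * (1 / h) = 1" using h(1) by simp
    show ?case
    proof (intro allI ballI)
      fix y t assume t: "t \<in> {0..T}"
      define m where "m = real (jump_count ?x h y t)"
      define l where "l = L y t \<omega>"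
      have l: "0 \<le> l" "l \<le> S"
        using local_time_nonneg[OF reg, of t] S(2)[of t] t by (auto simp: l_def)
      show "\<bar>norm_const * h powr \<alpha> * real (jump_count ?x h y t) - L y t \<omega>\<bar> \<le> e"
      proof (cases "\<bar>y\<bar> \<le> R")
        case False
        have "jump_count ?x h y t = 0"
          using False t by (intro jump_count_outside_range[OF h(1) R]) auto
        moreover have "L y t \<omega> = 0"
          using False t R(1) by (intro local_time_outside_range[OF reg, of t R]) auto
        ultimately show ?thesis using \<open>0 < e\<close> by simp
      next
        case True
        have rescale: "norm_const * h powr \<alpha> * z = (h * real j) powr \<alpha> * (norm_const * (1 / real j) powr \<alpha> * z)"
          if "0 < j" for j :: nat and z
          using that h(1) by (simp add: powr_mult powr_divide)
        have upper: "norm_const * h powr \<alpha> * m \<le> l + e"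
        proof -
          \<comment> \<open>This \<open>j\<close> satisfies \<open>1 / j + 1 / j\<^sup>2 \<le> h\<close>, so there is room for moving the level to the grid.\<close>
          define j where "j = nat \<lceil>1 / h\<rceil> + 1"
          have "0 < \<lceil>1 / h\<rceil>" using h(1) by simp
          then have jr: "real j = of_int \<lceil>1 / h\<rceil> + 1" by (simp add: j_def)
          have j: "1 / h + 1 \<le> real j" "real j \<le> 1 / h + 2"
            using ceiling_correct[of "1 / h"] unfolding jr by linarith+
          have j0: "0 < j" by (simp add: j_def)
          have hj: "1 + h \<le> h * real j" "h * real j \<le> 1 + 2 * h"
            using mult_left_mono[OF j(1) less_imp_le[OF h(1)]] mult_left_mono[OF j(2) less_imp_le[OF h(1)]] inv
            by (auto simp: distrib_left)
          have "(1 + h) * real j \<le> h * real j * real j"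
            using hj(1) by (rule mult_right_mono) simp
          then have "real j + 1 \<le> h * (real j)\<^sup>2"
            using hj(1) h(1) by (simp add: power2_eq_square algebra_simps)
          then have gap: "1 / real j + 1 / (real j)\<^sup>2 \<le> h"
            using j0 by (simp add: power2_eq_square field_simps)
          define k where "k = nat \<lceil>t * real j\<rceil>"
          have "0 \<le> t * real j" using t by simp
          then have kr: "real k = of_int \<lceil>t * real j\<rceil>" by (simp add: k_def)
          have k: "t * real j \<le> real k" "real k \<le> t * real j + 1"
            using ceiling_correct[of "t * real j"] unfolding kr by linarith+
          have tk: "t \<le> time j k" "time j k \<le> t + 1 / real j"
            using k j0 unfolding time_def by (auto simp: field_simps)
          have "\<bar>time j k - t\<bar> \<le> 1 / real j" using tk by linarith
          moreover have "b \<le> real j" using j(1) hb by linarith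
          ultimately obtain i where i: "\<bar>y - level j i\<bar> \<le> 1 / (real j)\<^sup>2"
            "\<bar>norm_const * (1 / real j) powr \<alpha> * real (jump_count ?x (1 / real j) (level j i) (time j k)) - L y t \<omega>\<bar> \<le> 2 * e1"
            using point[OF _ True t, of j k] by blast
          define m' where "m' = real (jump_count ?x (1 / real j) (level j i) (time j k))"
          have "jump_count ?x h y t \<le> jump_count ?x (1 / real j) (level j i) (time j k)"
            using i(1) gap tk(1) t j0 by (intro jump_count_mono[OF x]) auto
          then have "m \<le> m'" by (simp add: m_def m'_def)
          then have "norm_const * h powr \<alpha> * m \<le> norm_const * h powr \<alpha> * m'"
            using norm_const_pos by (intro mult_left_mono) auto
          also have "\<dots> = (h * real j) powr \<alpha> * (norm_const * (1 / real j) powr \<alpha> * m')" by (rule rescale[OF j0])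
          also have "\<dots> \<le> (1 + 2 * h) * (l + 2 * e1)"
          proof (rule mult_mono)
            have "(h * real j) powr \<alpha> \<le> (h * real j) powr 1"
              using hj(1) h(1) alpha by (intro powr_mono) auto
            then show "(h * real j) powr \<alpha> \<le> 1 + 2 * h" using hj h(1) by simp
            show "norm_const * (1 / real j) powr \<alpha> * m' \<le> l + 2 * e1"
              using i(2) unfolding m'_def l_def by linarith
          qed (use h(1) norm_const_pos in \<open>auto simp: m'_def\<close>)
          also have "\<dots> = l + 2 * e1 + 2 * h * (l + 2 * e1)" by (simp add: algebra_simps)
          also have "2 * h * (l + 2 * e1) \<le> 3 * g * (S + 2)"
            using h l e1 by (intro mult_mono) auto
          finally show ?thesis using g(2) e1(3) by linarith
        qed
        have lower: "l - e \<le> norm_const * h powr \<alpha> * m"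
        proof -
          \<comment> \<open>This \<open>j\<close> satisfies \<open>h + 1 / j\<^sup>2 \<le> 1 / j\<close>; subtracting only \<open>1\<close> would fall short of it.\<close>
          define j where "j = nat (\<lfloor>1 / h\<rfloor> - 2)"
          have "3 \<le> 1 / h" using hb b(1) by linarith
          then have "2 \<le> \<lfloor>1 / h\<rfloor>" by linarith
          then have jr: "real j = of_int \<lfloor>1 / h\<rfloor> - 2" by (simp add: j_def)
          have j: "1 / h - 3 \<le> real j" "real j \<le> 1 / h - 2"
            unfolding jr by linarith+
          have bj: "b \<le> real j" using j(1) hb by linarith
          have j0: "0 < j" using bj b(6) by auto
          have hj: "1 - 3 * h \<le> h * real j" "h * real j \<le> 1 - 2 * h"
            using mult_left_mono[OF j(1) less_imp_le[OF h(1)]] mult_left_mono[OF j(2) less_imp_le[OF h(1)]] inv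
            by (auto simp: right_diff_distrib)
          have "real j * (2 * h) \<le> real j * (1 - h * real j)"
            using hj(2) by (intro mult_left_mono) auto
          moreover have "1 \<le> real j * (2 * h)" using hj(1) h6 by (simp add: mult_ac)
          ultimately have "h * (real j)\<^sup>2 + 1 \<le> real j"
            by (simp add: power2_eq_square algebra_simps)
          then have "(h * (real j)\<^sup>2 + 1) / (real j)\<^sup>2 \<le> real j / (real j)\<^sup>2"
            by (rule divide_right_mono) simp
          then have gap: "h + 1 / (real j)\<^sup>2 \<le> 1 / real j"
            using j0 by (simp add: add_divide_distrib power2_eq_square)
          define k where "k = nat \<lfloor>t * real j\<rfloor>"
          have "0 \<le> t * real j" using t by simp
          then have kr: "real k = of_int \<lfloor>t * real j\<rfloor>" by (simp add: k_def)
          have k: "real k \<le> t * real j" "t * real j \<le> real k + 1"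
            unfolding kr by linarith+
          have tk: "time j k \<le> t" "t \<le> time j k + 1 / real j"
            using k j0 unfolding time_def by (auto simp: field_simps)
          have "\<bar>time j k - t\<bar> \<le> 1 / real j" using tk by linarith
          with bj obtain i where i: "\<bar>y - level j i\<bar> \<le> 1 / (real j)\<^sup>2"
            "\<bar>norm_const * (1 / real j) powr \<alpha> * real (jump_count ?x (1 / real j) (level j i) (time j k)) - L y t \<omega>\<bar> \<le> 2 * e1"
            using point[OF _ True t, of j k] by blast
          define m' where "m' = real (jump_count ?x (1 / real j) (level j i) (time j k))"
          define Z where "Z = norm_const * (1 / real j) powr \<alpha> * m'"
          have Z: "\<bar>Z - l\<bar> \<le> 2 * e1" "0 \<le> Z"
            using i(2) norm_const_pos unfolding Z_def m'_def l_def by auto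
          have "jump_count ?x (1 / real j) (level j i) (time j k) \<le> jump_count ?x h y t"
            using i(1) gap tk(1) t h(1) by (intro jump_count_mono[OF x]) (auto simp: abs_minus_commute)
          then have "m' \<le> m" by (simp add: m_def m'_def)
          have "3 * h * Z \<le> 3 * g * (S + 2)"
            using h Z l e1 by (intro mult_mono) auto
          then have "l - e \<le> (1 - 3 * h) * Z"
            using Z(1) g(2) e1(3) by (simp add: left_diff_distrib)
          also have "\<dots> \<le> (h * real j) powr \<alpha> * Z"
          proof (rule mult_right_mono[OF _ Z(2)])
            have "(h * real j) powr 1 \<le> (h * real j) powr \<alpha>"
              using hj h(1) alpha j0 by (intro powr_mono') auto
            then show "1 - 3 * h \<le> (h * real j) powr \<alpha>" using hj h(1) by simp
          qed
          also have "\<dots> = norm_const * h powr \<alpha> * m'" unfolding Z_def by (rule rescale[OF j0, symmetric])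
          also have "\<dots> \<le> norm_const * h powr \<alpha> * m"
            using \<open>m' \<le> m\<close> norm_const_pos by (intro mult_left_mono) auto
          finally show ?thesis .
        qed
        show ?thesis using upper lower unfolding m_def l_def by linarith
      qed
    qed
  qed
qed

end

theorem corollary2:
  fixes M :: "'a measure"
    and X :: "real \<Rightarrow> 'a \<Rightarrow> real"
    and L :: "real \<Rightarrow> real \<Rightarrow> 'a \<Rightarrow> real"
    and \<alpha> :: real
  assumes "0 < \<alpha>" and "\<alpha> < 1"
    and "spectrally_positive_stable_process M X (1 + \<alpha>)"
    and "has_laplace_exponent M X (\<lambda>\<eta>. \<eta> powr (1 + \<alpha>))"
    and "jointly_continuous_local_times M X L"
  shows "AE \<omega> in M. \<forall>T>0.
    ((\<lambda>h. SUP t\<in>{0..T}. SUP y. ereal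
        \<bar>2 powr \<alpha> * Gamma (1 - \<alpha>) * h powr \<alpha> * real (jump_count (\<lambda>s. X s \<omega>) h y t) - L y t \<omega>\<bar>)
      \<longlongrightarrow> 0) (at_right 0)"
proof -
  interpret spectrally_positive_stable_process M X "1 + \<alpha>" by fact
  interpret stable_local_time M X \<alpha> L
    by standard (use assms in auto)
  show ?thesis
    using AE_regular_path AE_eventually_grid_estimate
  proof eventually_elim
    case (elim \<omega>)
    show ?case
    proof (intro allI impI)
      fix T :: real assume "0 < T"
      define err where "err h t y = \<bar>norm_const * h powr \<alpha> * real (jump_count (\<lambda>s. X s \<omega>) h y t) - L y t \<omega>\<bar>"
        for h t y
      have "((\<lambda>h. SUP t\<in>{0..T}. SUP y. ereal (err h t y)) \<longlongrightarrow> 0) (at_right 0)"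
      proof (rule order_tendstoI)
        fix l :: ereal assume "l < 0"
        have "0 \<le> (SUP t\<in>{0..T}. SUP y. ereal (err h t y))" for h
          using \<open>0 < T\<close> by (intro SUP_upper2[of 0] SUP_upper2[of 0]) (auto simp: err_def)
        with \<open>l < 0\<close> show "\<forall>\<^sub>F h in at_right 0. l < (SUP t\<in>{0..T}. SUP y. ereal (err h t y))"
          by (intro always_eventually allI) (rule less_le_trans)
      next
        fix l :: ereal assume "0 < l"
        then obtain e where e: "0 < ereal e" "ereal e < l" using ereal_dense2 by blast
        then have "0 < e" by simp
        from pathwise_uniform_limit[OF elim \<open>0 < T\<close> this]
        show "\<forall>\<^sub>F h in at_right 0. (SUP t\<in>{0..T}. SUP y. ereal (err h t y)) < l"
        proof eventually_elim
          case (elim h)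
          have "(SUP t\<in>{0..T}. SUP y. ereal (err h t y)) \<le> ereal e"
            using elim by (intro SUP_least) (auto simp: err_def)
          then show ?case using e(2) by (rule le_less_trans)
        qed
      qed
      then show "((\<lambda>h. SUP t\<in>{0..T}. SUP y. ereal
          \<bar>2 powr \<alpha> * Gamma (1 - \<alpha>) * h powr \<alpha> * real (jump_count (\<lambda>s. X s \<omega>) h y t) - L y t \<omega>\<bar>)
        \<longlongrightarrow> 0) (at_right 0)"
        unfolding err_def norm_const_def .
    qed
  qed
qed

end
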